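(* Let $\kappa$ be algebraically closed, $X_0$ a curve of pseudocompact type over $\kappa$ with dual graph $G$, $\mathbf n$ a chain structure on $G$, $w_0$ an admissible multidegree on $(G,\mathbf n)$, $(w_v)_v$ a tight tuple of admissible multidegrees in $V(G(w_0))$, and fix an enriched structure on $\widetilde X_0$. A pre-limit linear series on $(X_0,\mathbf n)$ with respect to $(w_v)_v$ that lifts to a limit linear series must satisfy the weak glueing condition.
   Context: **Graphs.** $G$ is a finite connected graph without loops (multiple edges allowed). $\overline G$ is obtained from $G$ by replacing all edges between each pair of adjacent vertices by a single edge; an edge of $G$ lies over the edge of $\overline G$ with the same endpoints. $G$ is a multitree if $\overline G$ is a tree. A chain structure on $G$ is a function $\mathbf n\colon E(G)\to\mathbb Z_{>0}$. $\Gamma$ is the metric graph with underlying graph $G$ in which $e$ has length $\mathbf n(e)$. $\widetilde G$ is obtained from $G$ by inserting $\mathbf n(e)-1$ vertices in each edge $e$, so $V(\widetilde G)$ is the set of points of $\Gamma$ at integer distance from $V(G)$. A rational function on $\Gamma$ is a continuous piecewise linear function with integer slopes; $\mathrm{ord}_x(f)$ is the sum of the outgoing slopes of $f$ at $x$, and $\mathrm{div}(f)=\sum_x\mathrm{ord}_x(f)(x)$. **Multidegrees.** Fix an orientation of $G$; $\sigma(e,v)=1$ if $v$ is the tail of $e$ and $-1$ if it is the head. An admissible multidegree $w=(w_G,\mu)$ of total degree $d$ on $(G,\mathbf n)$ consists of $w_G\colon V(G)\to\mathbb Z$ and $\mu(e)\in\mathbb Z/\mathbf n(e)\mathbb Z$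 for $e\in E(G)$ with $d=\#\{e:\mu(e)\ne0\}+\sum_vw_G(v)$. $D_w$ is the divisor on $\Gamma$ with coefficient $w_G(v)$ at each $v\in V(G)$ and coefficient $1$ at the point of $e$ at distance $\mu(e)\in\{1,\dots,\mathbf n(e)-1\}$ from the tail, for each $e$ with $\mu(e)\ne 0$. The twist of $w$ at $v\in V(G)$ is obtained by doing, for each edge $e$ of $G$ incident on $v$ (other endpoint $v'$): if $\mu(e)+\sigma(e,v)=0$ increase $w_G(v')$ by $1$; if $\mu(e)=0$ decrease $w_G(v)$ by $1$; then increase $\mu(e)$ by $\sigma(e,v)$. The negative twist is the inverse operation. $V(G(w_0))$ is the set of admissible multidegrees obtained from $w_0$ by sequences of twists at vertices. For a multitree, and an edge $e$ of $\overline G$ with endpoint $v$, the twist at $(e,v)$ performs the same operations only for the edges of $G$ lying over $e$. For a multitree, $w$ is concentrated on $v$ if there is an ordering of $V(G)$ starting at $v$ such that, for each subsequent vertex $v'$, $w$ becomes negative at $v'$ (i.e. $w_G(v')<0$) after taking the composition of the negative twists at all previous vertices. A tuple $(w_v)_{v\in V(G)}$ is tight if each $w_v$ is concentrated on $v$ and, for every edge $e$ of $\overline G$ with endpoints $v_1,v_2$, $w_{v_1}$ is obtained from $w_{v_2}$ by twisting $b_{v_1,v_2}$ times at $(e,v_2)$ for some $b_{v_1,v_2}\in\mathbb Z_{\ge0}$ (then $b_{v_1,v_2}=b_{v_2,v_1}$). **Curves.** All curves are proper, reduced, connected, at worst nodal, with smooth irreducible components. A curve is of pseudocompact type if its dual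 graph is a multitree. For $X_0$ with dual graph $G$, $Z_v$ is the component corresponding to $v$, and $P_e^v\in Z_v$ is the preimage in $Z_v$ of the node corresponding to an edge $e\ni v$. $\widetilde X_0$ is obtained from $X_0$ by inserting a chain of $\mathbf n(e)-1$ projective lines at the node of each $e\in E(G)$; its dual graph is $\widetilde G$. **Multivanishing.** For effective divisors $D_0\le\dots\le D_{b+1}$ on a smooth curve $Z$, $j$ is critical if $D_{j+1}\ne D_j$. If $D_0=0$, $\deg D_{b+1}>d$ and $(\mathscr L,V)$ is a $\mathfrak g^r_d$ on $Z$, write $V(-D)$ for the sections in $V$ vanishing along $D$; the multivanishing sequence $a_0\le\dots\le a_r$ of $(\mathscr L,V)$ along $D_\bullet$ contains the value $a$ exactly $m$ times if for some $i$, $\deg D_i=a<\deg D_{i+1}$ and $\dim V(-D_i)/V(-D_{i+1})=m$. The order of vanishing $\mathrm{ord}_{D_\bullet}(s)$ of $0\neq s\in V$ is $\deg D_i$ with $i$ maximal such that $s\in V(-D_i)$. **Pre-limit linear series.** Write $w_v=((w_v)_G,\mu_v)$ and $d_v=(w_v)_G(v)$. For $e\in E(\overline G)$ with endpoints $v,v'$, the twisting divisors $D_i^{e,v}$ on $Z_v$ are given by $D_0^{e,v}=0$ and $D_{i+1}^{e,v}-D_i^{e,v}=\sum P_{e'}^v$, summed over $e'\in E(G)$ over $e$ with $\sigma(e',v)\mu_v(e')\equiv -i \pmod{\mathbf n(e')}$. (If $D^{e,v}_{i+1}-D_i^{e,v}=\sum_{e'\in I}P^v_{e'}$ then $D^{e,v'}_{b_{v,v'}-i+1}-D^{e,v'}_{b_{v,v'}-i}=\sum_{e'\in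 I}P^{v'}_{e'}$.) Multivanishing sequences along $D^{e,v}_\bullet$ use indices $0,\dots,b_{v,v'}+1$. A pre-limit linear series of rank $r$ with respect to $(w_v)_v$ is a tuple $(\mathscr L_v,V_v)_v$ with $\mathscr L_v$ a line bundle of degree $d_v$ on $Z_v$ and $V_v\subset H^0(Z_v,\mathscr L_v)$ of dimension $r+1$, whose multivanishing sequences $a^{e,v}_\bullet$ along $D^{e,v}_\bullet$ satisfy: for every edge $e$ of $\overline G$ with endpoints $v,v'$ and $l=0,\dots,r$, if $a_l^{e,v}=\deg D_j^{e,v}$ with $j$ critical for $D^{e,v}_\bullet$, then $a_{r-l}^{e,v'}\ge\deg D^{e,v'}_{b_{v,v'}-j}$. **Limit linear series on $(X_0,\mathbf n)$ and lifting.** An enriched structure on $\widetilde X_0$ is a collection of line bundles $(\mathscr O_u)_{u\in V(\widetilde G)}$ on $\widetilde X_0$ with $\bigotimes_u\mathscr O_u\cong\mathscr O$ and, for each component $Z_u$ with closure of complement $Z_u^c$, $\mathscr O_u|_{Z_u}\cong\mathscr O_{Z_u}(-(Z_u\cap Z_u^c))$, $\mathscr O_u|_{Z_u^c}\cong\mathscr O_{Z_u^c}(Z_u\cap Z_u^c)$. A line bundle $\mathscr L$ on $\widetilde X_0$ is of multidegree $w_0$ if its degree on $Z_u$ is the coefficient of $D_{w_0}$ at $u$ for all $u\in V(\widetilde G)$. For $w\in V(G(w_0))$ with $D_w=D_{w_0}+\mathrm{div}(f)$, $f$ integer valued on $V(\widetilde G)$, put $\mathscr L_w=\mathscr L\otimes\bigotimes_u\mathscr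 O_u^{\otimes f(u)}$, and $\mathscr L^v=\mathscr L_{w_v}|_{Z_v}$. For an edge $e$ of $\overline G$ with endpoints $v,v'$ and $0\le i\le b_{v,v'}$, the glueing isomorphism $\varphi_i^{e,v}\colon\mathscr L^v(-D_i^{e,v})/\mathscr L^v(-D_{i+1}^{e,v})\to\mathscr L^{v'}(-D^{e,v'}_{b_{v,v'}-i})/\mathscr L^{v'}(-D^{e,v'}_{b_{v,v'}+1-i})$ is as follows: let $w^i$ be obtained from $w_v$ by twisting $i$ times at $(e,v)$; then $\mathscr L_{w^i}|_{Z_v}\cong\mathscr L^v(-D_i^{e,v})$ and $\mathscr L_{w^i}|_{Z_{v'}}\cong\mathscr L^{v'}(-D_{b_{v,v'}-i}^{e,v'})$, and for each $e'$ over $e$ with $P^v_{e'}$ in the support of $D^{e,v}_{i+1}-D^{e,v}_i$, $\mathscr L_{w^i}$ is trivial on the inserted chain over $e'$, which identifies its fibers at $P_{e'}^v$ and $P_{e'}^{v'}$; $\varphi_i^{e,v}$ is the direct sum of these identifications. A tuple $(\mathscr L,(V_v)_v)$, with $\mathscr L$ of multidegree $w_0$ and $V_v\subset H^0(Z_v,\mathscr L^v)$ of dimension $r+1$, is a limit linear series on $(X_0,\mathbf n)$ if $(\mathscr L^v,V_v)_v$ is a pre-limit linear series and for each edge $e$ of $\overline G$ with endpoints $v,v'$ there are bases $s_0^{e,v},\dots,s_r^{e,v}$ of $V_v$ and $s_0^{e,v'},\dots,s_r^{e,v'}$ of $V_{v'}$ with $\mathrm{ord}_{D_\bullet^{e,v}}s_l^{e,v}=a_l^{e,v}$,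 $\mathrm{ord}_{D_\bullet^{e,v'}}s_l^{e,v'}=a_l^{e,v'}$, such that whenever $a_l^{e,v}=\deg D_j^{e,v}$ with $j$ critical and $a_{r-l}^{e,v'}=\deg D^{e,v'}_{b_{v,v'}-j}$, one has $\varphi_j^{e,v}(s_l^{e,v})=s_{r-l}^{e,v'}$. A pre-limit linear series $(\mathscr L_v,V_v)_v$ lifts to a limit linear series if there is $\mathscr L$ of multidegree $w_0$ on $\widetilde X_0$ with $\mathscr L^v=\mathscr L_v$ for all $v$ such that $(\mathscr L,(V_v)_v)$ is a limit linear series. **Weak glueing condition.** For an edge $e$ of $\overline G$ with endpoints $v,v'$ and $j$ critical for $D_\bullet^{e,v}$, let $g_j=\#\{l: a_l^{e,v}=\deg D_j^{e,v},\ a_{r-l}^{e,v'}=\deg D^{e,v'}_{b_{v,v'}-j}\}$. Let $D_{j+1}^{e,v}-D_j^{e,v}=P_{e_1}^v+\dots+P_{e_m}^v$. Evaluation at the points identifies $\mathscr L_v(-D_j^{e,v})/\mathscr L_v(-D_{j+1}^{e,v})$ with $\kappa^m$ up to coordinatewise scaling, and similarly $\mathscr L_{v'}(-D^{e,v'}_{b_{v,v'}-j})/\mathscr L_{v'}(-D^{e,v'}_{b_{v,v'}-j+1})$ using $P_{e_1}^{v'},\dots,P_{e_m}^{v'}$; torus orbits are the sets $T_v^I$, $T_{v'}^I$ of elements whose nonzero coordinates are exactly those in $I\subset\{1,\dots,m\}$ (glueing isomorphisms carry $T_v^I$ to $T_{v'}^I$). A pre-limit linear series satisfies the weak glueing condition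 if for all $e$ and all critical $j$ there are subspaces $W_v\subset V_v(-D_j^{e,v})/V_v(-D_{j+1}^{e,v})$ and $W_{v'}\subset V_{v'}(-D^{e,v'}_{b_{v,v'}-j})/V_{v'}(-D^{e,v'}_{b_{v,v'}-j+1})$, both of dimension $g_j$, such that $\dim(T_v^I\cap W_v)=\dim(T_{v'}^I\cap W_{v'})$ for all $I$. *)

theory Defs
  imports
    "HOL-Analysis.Analysis"
    "HOL-Library.Function_Algebras"
    "HOL-Library.Multiset"
    "HOL-Number_Theory.Cong"
    "HOL-Computational_Algebra.Formal_Power_Series"
    "Graph_Theory.Digraph_Component"
begin

section \<open>Varieties over an algebraically closed field\<close>

text \<open>
  All curves in question are reduced and of finite type over an algebraically closed field, so
  they are modelled classically (Serre, Kempf, Springer): a variety is a topological space of closed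
  points together with, for each open set \<open>U\<close>, the set of regular functions on \<open>U\<close> with
  values in the ground field, locally isomorphic to a Zariski closed subset of affine space.
  Functions are total; only their values on \<open>U\<close> matter.
\<close>

record ('x, 'k) fspace =
  ftop :: "'x topology"
  freg :: "'x set \<Rightarrow> ('x \<Rightarrow> 'k) set"

definition space_with_functions :: "('x, 'k::field) fspace \<Rightarrow> bool" where
  "space_with_functions X \<longleftrightarrow>
    (\<forall>U. openin (ftop X) U \<longrightarrow>
      (\<forall>c. (\<lambda>_. c) \<in> freg X U) \<and>
      (\<forall>f\<in>freg X U. \<forall>g\<in>freg X U. (\<lambda>y. f y + g y) \<in> freg X U \<and> (\<lambda>y. f y * g y) \<in> freg X U) \<and>
      (\<forall>f\<in>freg X U. \<forall>g. (\<forall>y\<in>U. g y = f y) \<longrightarrow> g \<in> freg X U) \<and>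
      (\<forall>f\<in>freg X U. \<forall>V. openin (ftop X) V \<and> V \<subseteq> U \<longrightarrow> f \<in> freg X V) \<and>
      (\<forall>f. (\<forall>x\<in>U. \<exists>V. openin (ftop X) V \<and> x \<in> V \<and> V \<subseteq> U \<and> f \<in> freg X V) \<longrightarrow> f \<in> freg X U) \<and>
      (\<forall>f\<in>freg X U. openin (ftop X) {y\<in>U. f y \<noteq> 0} \<and>
         (\<lambda>y. inverse (f y)) \<in> freg X {y\<in>U. f y \<noteq> 0}))"

text \<open>The structure induced on a subset; for a closed set this is the reduced closed subvariety.\<close>

definition subsp :: "('x, 'k) fspace \<Rightarrow> 'x set \<Rightarrow> ('x, 'k) fspace" where
  "subsp X Y = \<lparr> ftop = subtopology (ftop X) Y,
     freg = (\<lambda>W. {f. \<forall>x\<in>W. \<exists>U. openin (ftop X) U \<and> x \<in> U \<and> (\<exists>g\<in>freg X U. \<forall>y\<in>U \<inter> W. f y = g y)}) \<rparr>"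

definition fspace_morphism :: "('x, 'k) fspace \<Rightarrow> ('y, 'k) fspace \<Rightarrow> ('x \<Rightarrow> 'y) \<Rightarrow> bool" where
  "fspace_morphism X Y \<psi> \<longleftrightarrow> continuous_map (ftop X) (ftop Y) \<psi> \<and>
    (\<forall>U. openin (ftop Y) U \<longrightarrow> (\<forall>f\<in>freg Y U. f \<circ> \<psi> \<in> freg X {x\<in>topspace (ftop X). \<psi> x \<in> U}))"

definition fspace_iso :: "('x, 'k) fspace \<Rightarrow> ('y, 'k) fspace \<Rightarrow> ('x \<Rightarrow> 'y) \<Rightarrow> bool" where
  "fspace_iso X Y \<psi> \<longleftrightarrow> homeomorphic_map (ftop X) (ftop Y) \<psi> \<and>
    (\<forall>U. openin (ftop Y) U \<longrightarrow>
      (\<forall>f. f \<in> freg Y U \<longleftrightarrow> f \<circ> \<psi> \<in> freg X {x\<in>topspace (ftop X). \<psi> x \<in> U}))"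

text \<open>
  Affine space with coordinates indexed by \<open>I\<close>: points are functions vanishing outside \<open>I\<close>.
\<close>

inductive_set polyfun :: "'i set \<Rightarrow> (('i \<Rightarrow> 'k::field) \<Rightarrow> 'k) set" for I :: "'i set" where
  pf_const: "(\<lambda>_. c) \<in> polyfun I"
| pf_coord: "i \<in> I \<Longrightarrow> (\<lambda>x. x i) \<in> polyfun I"
| pf_add: "p \<in> polyfun I \<Longrightarrow> q \<in> polyfun I \<Longrightarrow> (\<lambda>x. p x + q x) \<in> polyfun I"
| pf_mult: "p \<in> polyfun I \<Longrightarrow> q \<in> polyfun I \<Longrightarrow> (\<lambda>x. p x * q x) \<in> polyfun I"

definition aff_points :: "'i set \<Rightarrow> ('i \<Rightarrow> 'k::field) set" where
  "aff_points I = {x. \<forall>i. i \<notin> I \<longrightarrow> x i = 0}"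

definition zariski :: "'i set \<Rightarrow> ('i \<Rightarrow> 'k::field) topology" where
  "zariski I = topology (\<lambda>U. \<exists>S\<subseteq>polyfun I. U = {x\<in>aff_points I. \<exists>p\<in>S. p x \<noteq> 0})"

definition aff_space :: "'i set \<Rightarrow> ('i \<Rightarrow> 'k::field, 'k) fspace" where
  "aff_space I = \<lparr> ftop = zariski I,
     freg = (\<lambda>U. {f. \<forall>x\<in>U. \<exists>V. openin (zariski I) V \<and> x \<in> V \<and> V \<subseteq> U \<and>
        (\<exists>p\<in>polyfun I. \<exists>q\<in>polyfun I. \<forall>y\<in>V. q y \<noteq> 0 \<and> f y = p y / q y)}) \<rparr>"

definition prevariety :: "('x, 'k::field) fspace \<Rightarrow> bool" where
  "prevariety X \<longleftrightarrow> space_with_functions X \<and>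
    (\<exists>\<U>. finite \<U> \<and> \<Union>\<U> = topspace (ftop X) \<and>
      (\<forall>U\<in>\<U>. openin (ftop X) U \<and>
        (\<exists>n A \<psi>. closedin (zariski {..<n::nat}) A \<and>
           fspace_iso (subsp X U) (subsp (aff_space {..<n}) A) \<psi>)))"

text \<open>
  The topology of the product variety: the basic open sets are the loci in \<open>U \<times> V\<close> where a function
  of the form \<open>\<Sum> f\<^sub>i \<otimes> g\<^sub>i\<close> does not vanish.
\<close>

definition zprod :: "('x, 'k::field) fspace \<Rightarrow> ('y, 'k) fspace \<Rightarrow> ('x \<times> 'y) topology" where
  "zprod X Y = topology_generated_by
     {{(x, y) \<in> U \<times> V. (\<Sum>i<N. f i x * g i y) \<noteq> 0} | U V N f g.
        openin (ftop X) U \<and> openin (ftop Y) V \<and>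
        (\<forall>i<(N::nat). f i \<in> freg X U \<and> g i \<in> freg Y V)}"

definition separated :: "('x, 'k::field) fspace \<Rightarrow> bool" where
  "separated X \<longleftrightarrow> closedin (zprod X X) {(x, x) | x. x \<in> topspace (ftop X)}"

text \<open>
  Universal closedness is local on the base and affine varieties are closed in affine spaces, so
  it is enough to require it for affine spaces.
\<close>

definition proper_variety :: "('x, 'k::field) fspace \<Rightarrow> bool" where
  "proper_variety X \<longleftrightarrow> prevariety X \<and> separated X \<and>
    (\<forall>n::nat. closed_map (zprod X (aff_space {..<n})) (ftop (aff_space {..<n})) snd)"

definition irreducible_set :: "'a topology \<Rightarrow> 'a set \<Rightarrow> bool" where
  "irreducible_set T S \<longleftrightarrow> S \<noteq> {} \<and> S \<subseteq> topspace T \<and>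
    (\<forall>A B. closedin T A \<and> closedin T B \<and> S \<subseteq> A \<union> B \<longrightarrow> S \<subseteq> A \<or> S \<subseteq> B)"

definition irreducible_components :: "'a topology \<Rightarrow> 'a set set" where
  "irreducible_components T =
    {C. irreducible_set T C \<and> (\<forall>S. irreducible_set T S \<and> C \<subseteq> S \<longrightarrow> S = C)}"

text \<open>Krull dimension; the empty space has dimension \<open>-\<infinity>\<close>.\<close>

definition krull_dim :: "'a topology \<Rightarrow> ereal" where
  "krull_dim T = Sup {ereal (real n) | n. \<exists>C. (\<forall>i\<le>n. closedin T (C i) \<and> irreducible_set T (C i)) \<and>
     (\<forall>i<n. C i \<subset> C (Suc i))}"

section \<open>Local rings, smooth points and nodes\<close>

text \<open>
  Functions regular near \<open>x\<close>; they represent elements of the local ring at \<open>x\<close>, two of them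
  representing the same element iff they agree near \<open>x\<close>.
\<close>

definition germs :: "('x, 'k) fspace \<Rightarrow> 'x \<Rightarrow> ('x \<Rightarrow> 'k) set" where
  "germs X x = \<Union>{freg X U | U. openin (ftop X) U \<and> x \<in> U}"

text \<open>A nonzero generator of the maximal ideal of the local ring.\<close>

definition local_param :: "('x, 'k::field) fspace \<Rightarrow> 'x \<Rightarrow> ('x \<Rightarrow> 'k) \<Rightarrow> bool" where
  "local_param X x t \<longleftrightarrow> t \<in> germs X x \<and> t x = 0 \<and>
    \<not> (\<forall>\<^sub>F y in nhdsin (ftop X) x. t y = 0) \<and>
    (\<forall>f\<in>germs X x. f x = 0 \<longrightarrow> (\<exists>g\<in>germs X x. \<forall>\<^sub>F y in nhdsin (ftop X) x. f y = t y * g y))"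

text \<open>
  The local ring is a discrete valuation ring (noetherianity being automatic on a variety), i.e.
  a regular local ring of dimension one.
\<close>

definition smooth_pt :: "('x, 'k::field) fspace \<Rightarrow> 'x \<Rightarrow> bool" where
  "smooth_pt X x \<longleftrightarrow> x \<in> topspace (ftop X) \<and>
    (\<forall>f\<in>germs X x. \<forall>g\<in>germs X x. (\<forall>\<^sub>F y in nhdsin (ftop X) x. f y * g y = 0) \<longrightarrow>
       (\<forall>\<^sub>F y in nhdsin (ftop X) x. f y = 0) \<or> (\<forall>\<^sub>F y in nhdsin (ftop X) x. g y = 0)) \<and>
    (\<exists>t. local_param X x t)"

definition max_ideal_pow :: "('x, 'k::field) fspace \<Rightarrow> 'x \<Rightarrow> nat \<Rightarrow> ('x \<Rightarrow> 'k) set" where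
  "max_ideal_pow X x n = {f \<in> germs X x. \<exists>N c h.
     (\<forall>j<(N::nat). c j \<in> germs X x \<and> (\<forall>i<n. h j i \<in> germs X x \<and> h j i x = 0)) \<and>
     (\<forall>\<^sub>F y in nhdsin (ftop X) x. f y = (\<Sum>j<N. c j y * (\<Prod>i<n. h j i y)))}"

text \<open>
  The completed local ring is isomorphic to \<open>k[[S,T]]/(ST)\<close>.  The latter is the ring of pairs
  \<open>(a, b) \<in> k[[S]] \<times> k[[T]]\<close> with equal constant terms, the \<open>n\<close>-th power (\<open>n \<ge> 1\<close>) of whose maximal
  ideal consists of the pairs whose coefficients below \<open>n\<close> vanish; \<open>f \<mapsto> (p f, q f)\<close> induces
  isomorphisms modulo all powers of the maximal ideals.
\<close>

definition node_pt :: "('x, 'k::field) fspace \<Rightarrow> 'x \<Rightarrow> bool" where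
  "node_pt X x \<longleftrightarrow> x \<in> topspace (ftop X) \<and>
    (\<exists>p q :: ('x \<Rightarrow> 'k) \<Rightarrow> 'k fps.
      (\<forall>f\<in>germs X x. \<forall>g\<in>germs X x.
         p (\<lambda>y. f y + g y) = p f + p g \<and> q (\<lambda>y. f y + g y) = q f + q g \<and>
         p (\<lambda>y. f y * g y) = p f * p g \<and> q (\<lambda>y. f y * g y) = q f * q g) \<and>
      (\<forall>c. p (\<lambda>_. c) = fps_const c \<and> q (\<lambda>_. c) = fps_const c) \<and>
      (\<forall>f\<in>germs X x. fps_nth (p f) 0 = fps_nth (q f) 0) \<and>
      (\<forall>n\<ge>1. \<forall>f\<in>germs X x.
         f \<in> max_ideal_pow X x n \<longleftrightarrow> (\<forall>i<n. fps_nth (p f) i = 0 \<and> fps_nth (q f) i = 0)) \<and>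
      (\<forall>n a b. fps_nth a 0 = fps_nth b 0 \<longrightarrow>
         (\<exists>f\<in>germs X x. \<forall>i<n. fps_nth (p f) i = fps_nth a i \<and> fps_nth (q f) i = fps_nth b i)))"

definition curve :: "('x, 'k::field) fspace \<Rightarrow> bool" where
  "curve X \<longleftrightarrow> proper_variety X \<and> topspace (ftop X) \<noteq> {} \<and> connected_space (ftop X) \<and>
    (\<forall>x\<in>topspace (ftop X). smooth_pt X x \<or> node_pt X x) \<and>
    (\<forall>C\<in>irreducible_components (ftop X). \<forall>x\<in>C. smooth_pt (subsp X C) x)"

text \<open>
  The projective line, \<open>None\<close> being the point at infinity.  A fraction \<open>p / q\<close> is regular
  there iff \<open>degree p \<le> degree q\<close>.
\<close>

definition proj_line :: "('k::field option, 'k) fspace" where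
  "proj_line = (let T = topology (\<lambda>U. U = {} \<or> finite (- U)) in
     \<lparr> ftop = T,
       freg = (\<lambda>U. {f. \<forall>x\<in>U. \<exists>V p q. openin T V \<and> x \<in> V \<and> V \<subseteq> U \<and>
          (\<forall>a. Some a \<in> V \<longrightarrow> poly q a \<noteq> 0 \<and> f (Some a) = poly p a / poly q a) \<and>
          (None \<in> V \<longrightarrow> degree p \<le> degree q \<and> f None = coeff p (degree q) / lead_coeff q)}) \<rparr>)"

section \<open>Line bundles\<close>

text \<open>
  A line bundle is given by transition functions, with one trivialising neighbourhood \<open>chart L x\<close>
  for each point \<open>x\<close>.  A section is a family \<open>s x\<close> of functions on the charts with
  \<open>s x = cocycle L x y * s y\<close>; the chart at \<open>x\<close> identifies the fibre at \<open>x\<close> with the ground field,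
  the value of \<open>s\<close> at \<open>x\<close> being \<open>s x x\<close>.
\<close>

record ('x, 'k) lbundle =
  chart :: "'x \<Rightarrow> 'x set"
  cocycle :: "'x \<Rightarrow> 'x \<Rightarrow> 'x \<Rightarrow> 'k"

definition line_bundle :: "('x, 'k::field) fspace \<Rightarrow> ('x, 'k) lbundle \<Rightarrow> bool" where
  "line_bundle X L \<longleftrightarrow>
    (\<forall>x\<in>topspace (ftop X). openin (ftop X) (chart L x) \<and> x \<in> chart L x) \<and>
    (\<forall>x\<in>topspace (ftop X). \<forall>y\<in>topspace (ftop X).
       cocycle L x y \<in> freg X (chart L x \<inter> chart L y) \<and>
       (\<forall>z\<in>chart L x \<inter> chart L y. cocycle L x y z \<noteq> 0)) \<and>
    (\<forall>x\<in>topspace (ftop X). \<forall>y\<in>topspace (ftop X). \<forall>u\<in>topspace (ftop X).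
       \<forall>z\<in>chart L x \<inter> chart L y \<inter> chart L u. cocycle L x u z = cocycle L x y z * cocycle L y u z)"

text \<open>An isomorphism \<open>h\<close> sends a section \<open>s\<close> to the section given by \<open>h x * s x\<close>.\<close>

definition bundle_iso ::
  "('x, 'k::field) fspace \<Rightarrow> ('x, 'k) lbundle \<Rightarrow> ('x, 'k) lbundle \<Rightarrow> ('x \<Rightarrow> 'x \<Rightarrow> 'k) \<Rightarrow> bool" where
  "bundle_iso X L M h \<longleftrightarrow>
    (\<forall>x\<in>topspace (ftop X). h x \<in> freg X (chart L x \<inter> chart M x) \<and>
       (\<forall>z\<in>chart L x \<inter> chart M x. h x z \<noteq> 0)) \<and>
    (\<forall>x\<in>topspace (ftop X). \<forall>y\<in>topspace (ftop X).
       \<forall>z\<in>chart L x \<inter> chart M x \<inter> (chart L y \<inter> chart M y).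
         h x z * cocycle L x y z = cocycle M x y z * h y z)"

definition bundle_isomorphic ::
  "('x, 'k::field) fspace \<Rightarrow> ('x, 'k) lbundle \<Rightarrow> ('x, 'k) lbundle \<Rightarrow> bool" where
  "bundle_isomorphic X L M \<longleftrightarrow> (\<exists>h. bundle_iso X L M h)"

definition lb_trivial :: "('x, 'k::field) fspace \<Rightarrow> ('x, 'k) lbundle" where
  "lb_trivial X = \<lparr> chart = (\<lambda>_. topspace (ftop X)), cocycle = (\<lambda>_ _ _. 1) \<rparr>"

definition lb_tensor :: "('x, 'k::field) lbundle \<Rightarrow> ('x, 'k) lbundle \<Rightarrow> ('x, 'k) lbundle" where
  "lb_tensor L M = \<lparr> chart = (\<lambda>x. chart L x \<inter> chart M x),
     cocycle = (\<lambda>x y z. cocycle L x y z * cocycle M x y z) \<rparr>"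

text \<open>\<open>L \<otimes> \<Otimes>\<^sub>u (N u)\<^bsup>\<otimes> f u\<^esup>\<close> over \<open>u \<in> S\<close>.\<close>

definition lb_twist ::
  "('x, 'k::field) lbundle \<Rightarrow> 'u set \<Rightarrow> ('u \<Rightarrow> ('x, 'k) lbundle) \<Rightarrow> ('u \<Rightarrow> int) \<Rightarrow> ('x, 'k) lbundle" where
  "lb_twist L S N f = \<lparr> chart = (\<lambda>x. chart L x \<inter> (\<Inter>u\<in>S. chart (N u) x)),
     cocycle = (\<lambda>x y z. cocycle L x y z * (\<Prod>u\<in>S. cocycle (N u) x y z powi f u)) \<rparr>"

definition lb_restr :: "('x, 'k) lbundle \<Rightarrow> 'x set \<Rightarrow> ('x, 'k) lbundle" where
  "lb_restr L Y = \<lparr> chart = (\<lambda>x. chart L x \<inter> Y), cocycle = cocycle L \<rparr>"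

definition lb_pullback :: "('y \<Rightarrow> 'x) \<Rightarrow> 'y set \<Rightarrow> ('x, 'k) lbundle \<Rightarrow> ('y, 'k) lbundle" where
  "lb_pullback \<pi> Y L = \<lparr> chart = (\<lambda>x. {z\<in>Y. \<pi> z \<in> chart L (\<pi> x)}),
     cocycle = (\<lambda>x y z. cocycle L (\<pi> x) (\<pi> y) (\<pi> z)) \<rparr>"

definition loc_par :: "('x, 'k::field) fspace \<Rightarrow> 'x \<Rightarrow> 'x \<Rightarrow> 'k" where
  "loc_par X x = (SOME t. local_param X x t)"

text \<open>
  \<open>M\<close> is \<open>\<O>(D)\<close>, for a divisor \<open>D\<close> supported at smooth points: a rational function \<open>f\<close> with
  \<open>div f + D \<ge> 0\<close> corresponds to the section given by \<open>f * t\<^sub>x ^ D x\<close> on the chart at \<open>x\<close>,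
  where \<open>t\<^sub>x\<close> is the local parameter at \<open>x\<close>.
\<close>

definition div_bundle :: "('x, 'k::field) fspace \<Rightarrow> ('x \<Rightarrow> int) \<Rightarrow> ('x, 'k) lbundle \<Rightarrow> bool" where
  "div_bundle X D M \<longleftrightarrow> line_bundle X M \<and>
    (\<forall>x\<in>topspace (ftop X).
       (\<forall>y\<in>chart M x. y \<noteq> x \<longrightarrow> D y = 0) \<and>
       (D x \<noteq> 0 \<longrightarrow> local_param X x (loc_par X x) \<and> loc_par X x \<in> freg X (chart M x) \<and>
          (\<forall>y\<in>chart M x. y \<noteq> x \<longrightarrow> loc_par X x y \<noteq> 0))) \<and>
    (\<forall>x\<in>topspace (ftop X). \<forall>y\<in>topspace (ftop X). x \<noteq> y \<longrightarrow>
       (\<forall>z\<in>chart M x \<inter> chart M y.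
          cocycle M x y z = loc_par X x z powi D x / loc_par X y z powi D y))"

text \<open>
  The degree on a smooth proper irreducible curve: the number of zeros minus poles of a rational
  section \<open>s\<close>, defined on a nonempty open set \<open>W\<close> and with order \<open>m x\<close> at \<open>x\<close>.
\<close>

definition lb_degree :: "('x, 'k::field) fspace \<Rightarrow> ('x, 'k) lbundle \<Rightarrow> int \<Rightarrow> bool" where
  "lb_degree X L d \<longleftrightarrow> (\<exists>W s m. openin (ftop X) W \<and> W \<noteq> {} \<and>
    (\<forall>x\<in>topspace (ftop X). s x \<in> freg X (chart L x \<inter> W)) \<and>
    (\<forall>x\<in>topspace (ftop X). \<forall>y\<in>topspace (ftop X). \<forall>z\<in>chart L x \<inter> chart L y \<inter> W.
       s x z = cocycle L x y z * s y z) \<and>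
    (\<forall>x\<in>topspace (ftop X). \<exists>t u. local_param X x t \<and> u \<in> germs X x \<and> u x \<noteq> 0 \<and>
       (\<forall>\<^sub>F y in nhdsin (ftop X) x. y \<in> W \<and> y \<noteq> x \<longrightarrow> s x y = t y powi m x * u y)) \<and>
    finite {x\<in>topspace (ftop X). m x \<noteq> 0} \<and>
    d = (\<Sum>x\<in>{x\<in>topspace (ftop X). m x \<noteq> 0}. m x))"

text \<open>
  Global sections; the component functions are normalised to be \<open>0\<close> where they are irrelevant,
  so that equality of sections is equality of functions.
\<close>

definition gsect :: "('x, 'k::field) fspace \<Rightarrow> ('x, 'k) lbundle \<Rightarrow> ('x \<Rightarrow> 'x \<Rightarrow> 'k) set" where
  "gsect X L = {s.
    (\<forall>x\<in>topspace (ftop X). s x \<in> freg X (chart L x)) \<and>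
    (\<forall>x\<in>topspace (ftop X). \<forall>y\<in>topspace (ftop X). \<forall>z\<in>chart L x \<inter> chart L y.
       s x z = cocycle L x y z * s y z) \<and>
    (\<forall>x z. x \<notin> topspace (ftop X) \<or> z \<notin> chart L x \<longrightarrow> s x z = 0)}"

interpretation sect: vector_space "\<lambda>(c::'k::field) (s :: 'x \<Rightarrow> 'y \<Rightarrow> 'k) x z. c * s x z"
  by unfold_locales (auto simp: fun_eq_iff algebra_simps)

interpretation vec: vector_space "\<lambda>(c::'k::field) (a :: 'i \<Rightarrow> 'k) i. c * a i"
  by unfold_locales (auto simp: fun_eq_iff algebra_simps)

section \<open>Multivanishing sequences\<close>

text \<open>Effective divisors are multisets of points; the degree is the size.\<close>

definition vanishes_to :: "('x, 'k::field) fspace \<Rightarrow> 'x \<Rightarrow> nat \<Rightarrow> ('x \<Rightarrow> 'k) \<Rightarrow> bool" where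
  "vanishes_to X x m f \<longleftrightarrow>
    (\<exists>t g. local_param X x t \<and> g \<in> germs X x \<and> (\<forall>\<^sub>F y in nhdsin (ftop X) x. f y = t y ^ m * g y))"

definition van ::
  "('x, 'k::field) fspace \<Rightarrow> ('x \<Rightarrow> 'x \<Rightarrow> 'k) set \<Rightarrow> 'x multiset \<Rightarrow> ('x \<Rightarrow> 'x \<Rightarrow> 'k) set" where
  "van X V D = {s\<in>V. \<forall>x\<in>#D. vanishes_to X x (count D x) (s x)}"

definition crit :: "(nat \<Rightarrow> 'x multiset) \<Rightarrow> nat \<Rightarrow> bool" where
  "crit D j \<longleftrightarrow> D (Suc j) \<noteq> D j"

text \<open>
  The multivanishing sequence along \<open>D 0 \<le> \<dots> \<le> D (b+1)\<close>.  It has as many terms as \<open>dim V\<close> if and only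
  if no nonzero element of \<open>V\<close> vanishes along \<open>D (b+1)\<close>.
\<close>

definition mvseq ::
  "('x, 'k::field) fspace \<Rightarrow> ('x \<Rightarrow> 'x \<Rightarrow> 'k) set \<Rightarrow> (nat \<Rightarrow> 'x multiset) \<Rightarrow> nat \<Rightarrow> nat list" where
  "mvseq X V D b = sorted_list_of_multiset
     (\<Sum>i | i \<le> b \<and> crit D i.
        replicate_mset (sect.dim (van X V (D i)) - sect.dim (van X V (D (Suc i)))) (size (D i)))"

definition ord_along ::
  "('x, 'k::field) fspace \<Rightarrow> ('x \<Rightarrow> 'x \<Rightarrow> 'k) set \<Rightarrow> (nat \<Rightarrow> 'x multiset) \<Rightarrow> nat \<Rightarrow>
   ('x \<Rightarrow> 'x \<Rightarrow> 'k) \<Rightarrow> nat" where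
  "ord_along X V D b s = size (D (Max {i. i \<le> Suc b \<and> s \<in> van X V (D i)}))"

text \<open>
  The value at \<open>x\<close> of \<open>f / t\<^sub>x ^ m\<close>, for \<open>f\<close> vanishing to order \<open>m\<close> at \<open>x\<close>.
\<close>

definition lead_val :: "('x, 'k::field) fspace \<Rightarrow> 'x \<Rightarrow> nat \<Rightarrow> ('x \<Rightarrow> 'k) \<Rightarrow> 'k" where
  "lead_val X x m f = (THE c. \<exists>g\<in>germs X x. g x = c \<and>
     (\<forall>\<^sub>F y in nhdsin (ftop X) x. f y = loc_par X x y ^ m * g y))"

text \<open>
  If \<open>D' - D\<close> is the sum of the distinct points \<open>P e\<close>, \<open>e \<in> I\<close>, this is the evaluation map from the
  sections of \<open>\<L>(-D)\<close> to \<open>\<L>(-D)/\<L>(-D') \<cong> k\<^bsup>I\<^esup>\<close>; its kernel on \<open>V(-D)\<close> is \<open>V(-D')\<close>, so the image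
  of \<open>V(-D)\<close> is \<open>V(-D)/V(-D')\<close>.  A change of local parameters or charts rescales the coordinates.
\<close>

definition eval_map ::
  "('x, 'k::field) fspace \<Rightarrow> ('e \<Rightarrow> 'x) \<Rightarrow> 'x multiset \<Rightarrow> 'e set \<Rightarrow> ('x \<Rightarrow> 'x \<Rightarrow> 'k) \<Rightarrow> 'e \<Rightarrow> 'k" where
  "eval_map X P D I s = (\<lambda>e. if e \<in> I then lead_val X (P e) (count D (P e)) (s (P e)) else 0)"

section \<open>Graphs and chain structures\<close>

text \<open>
  A multigraph with a fixed orientation is a \<open>pre_digraph\<close>; \<open>mk_symmetric\<close> replaces parallel edges
  by a single one (recorded as a pair of opposite arcs, so that an actual cycle has length at least 3).
\<close>

definition multitree :: "('v, 'e) pre_digraph \<Rightarrow> bool" where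
  "multitree G \<longleftrightarrow> fin_digraph G \<and> loopfree_digraph G \<and> Digraph_Component.connected G \<and>
    \<not> (\<exists>p. pre_digraph.cycle (with_proj (mk_symmetric G)) p \<and> 3 \<le> length p)"

definition chain_structure :: "('v, 'e) pre_digraph \<Rightarrow> ('e \<Rightarrow> nat) \<Rightarrow> bool" where
  "chain_structure G n \<longleftrightarrow> (\<forall>e\<in>arcs G. 0 < n e)"

definition incident :: "('v, 'e) pre_digraph \<Rightarrow> 'v \<Rightarrow> 'e set" where
  "incident G v = {e\<in>arcs G. v = tail G e \<or> v = head G e}"

text \<open>
  An edge of the simple graph is given by its endpoints \<open>v\<close>, \<open>v'\<close>; the edges of \<open>G\<close> lying over it are:
\<close>

definition between :: "('v, 'e) pre_digraph \<Rightarrow> 'v \<Rightarrow> 'v \<Rightarrow> 'e set" where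
  "between G v v' = {e\<in>arcs G. {tail G e, head G e} = {v, v'}}"

definition adjacent :: "('v, 'e) pre_digraph \<Rightarrow> 'v \<Rightarrow> 'v \<Rightarrow> bool" where
  "adjacent G v v' \<longleftrightarrow> between G v v' \<noteq> {}"

definition orient :: "('v, 'e) pre_digraph \<Rightarrow> 'e \<Rightarrow> 'v \<Rightarrow> int" where
  "orient G e v = (if v = tail G e then 1 else - 1)"

subsection \<open>The metric graph\<close>

datatype ('v, 'e) mpoint = Vtx 'v | Inn 'e real

text \<open>The point on \<open>e\<close> at distance \<open>t\<close> from the tail.\<close>

definition on_edge :: "('v, 'e) pre_digraph \<Rightarrow> ('e \<Rightarrow> nat) \<Rightarrow> 'e \<Rightarrow> real \<Rightarrow> ('v, 'e) mpoint" where
  "on_edge G n e t =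
    (if t \<le> 0 then Vtx (tail G e) else if real (n e) \<le> t then Vtx (head G e) else Inn e t)"

definition metric_graph :: "('v, 'e) pre_digraph \<Rightarrow> ('e \<Rightarrow> nat) \<Rightarrow> ('v, 'e) mpoint set" where
  "metric_graph G n = Vtx ` verts G \<union> {Inn e t | e t. e \<in> arcs G \<and> 0 < t \<and> t < real (n e)}"

text \<open>
  The graph obtained by inserting \<open>n e - 1\<close> vertices in each edge \<open>e\<close>; its edge \<open>(e, i)\<close> is the segment of
  \<open>e\<close> between the points at distance \<open>i\<close> and \<open>i + 1\<close> from the tail.
\<close>

definition subdiv :: "('v, 'e) pre_digraph \<Rightarrow> ('e \<Rightarrow> nat) \<Rightarrow> (('v, 'e) mpoint, 'e \<times> nat) pre_digraph" where
  "subdiv G n = \<lparr>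
     verts = Vtx ` verts G \<union> {Inn e (real i) | e i. e \<in> arcs G \<and> 0 < i \<and> i < n e},
     arcs = {(e, i). e \<in> arcs G \<and> i < n e},
     tail = (\<lambda>(e, i). on_edge G n e (real i)),
     head = (\<lambda>(e, i). on_edge G n e (real (Suc i))) \<rparr>"

definition rational_fun :: "('v, 'e) pre_digraph \<Rightarrow> ('e \<Rightarrow> nat) \<Rightarrow> (('v, 'e) mpoint \<Rightarrow> real) \<Rightarrow> bool" where
  "rational_fun G n f \<longleftrightarrow> (\<forall>e\<in>arcs G.
     continuous_on {0..real (n e)} (\<lambda>t. f (on_edge G n e t)) \<and>
     (\<exists>S. finite S \<and> (\<forall>t\<in>{0<..<real (n e)} - S. \<exists>k::int.
        \<forall>\<^sub>F u in at t. f (on_edge G n e u) = f (on_edge G n e t) + of_int k * (u - t))))"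

definition init_slope :: "(real \<Rightarrow> real) \<Rightarrow> int" where
  "init_slope g = (THE k. \<forall>\<^sub>F u in at_right 0. g u = g 0 + of_int k * u)"

fun ord_at :: "('v, 'e) pre_digraph \<Rightarrow> ('e \<Rightarrow> nat) \<Rightarrow> (('v, 'e) mpoint \<Rightarrow> real) \<Rightarrow> ('v, 'e) mpoint \<Rightarrow> int" where
  "ord_at G n f (Vtx v) =
     (\<Sum>e | e \<in> arcs G \<and> tail G e = v. init_slope (\<lambda>u. f (on_edge G n e u))) +
     (\<Sum>e | e \<in> arcs G \<and> head G e = v. init_slope (\<lambda>u. f (on_edge G n e (real (n e) - u))))"
| "ord_at G n f (Inn e t) =
     init_slope (\<lambda>u. f (on_edge G n e (t + u))) + init_slope (\<lambda>u. f (on_edge G n e (t - u)))"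

subsection \<open>Admissible multidegrees\<close>

text \<open>
  Elements of \<open>\<int>/n(e)\<close> are represented by integers in \<open>{0..<n e}\<close>; both functions are \<open>0\<close> outside
  the graph, so that equality of multidegrees is equality of records.
\<close>

record ('v, 'e) mdeg =
  vdeg :: "'v \<Rightarrow> int"
  cpos :: "'e \<Rightarrow> int"

definition admissible :: "('v, 'e) pre_digraph \<Rightarrow> ('e \<Rightarrow> nat) \<Rightarrow> int \<Rightarrow> ('v, 'e) mdeg \<Rightarrow> bool" where
  "admissible G n d w \<longleftrightarrow>
    (\<forall>e\<in>arcs G. 0 \<le> cpos w e \<and> cpos w e < int (n e)) \<and>
    (\<forall>e. e \<notin> arcs G \<longrightarrow> cpos w e = 0) \<and> (\<forall>v. v \<notin> verts G \<longrightarrow> vdeg w v = 0) \<and>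
    d = int (card {e\<in>arcs G. cpos w e \<noteq> 0}) + (\<Sum>v\<in>verts G. vdeg w v)"

fun md_divisor :: "('v, 'e) mdeg \<Rightarrow> ('v, 'e) mpoint \<Rightarrow> int" where
  "md_divisor w (Vtx v) = vdeg w v"
| "md_divisor w (Inn e t) = (if cpos w e \<noteq> 0 \<and> t = of_int (cpos w e) then 1 else 0)"

text \<open>The twisting operation at \<open>v\<close>, performed only for the edges in a set \<open>F\<close> of edges incident on \<open>v\<close>.\<close>

definition twist_on ::
  "('v, 'e) pre_digraph \<Rightarrow> ('e \<Rightarrow> nat) \<Rightarrow> 'v \<Rightarrow> 'e set \<Rightarrow> ('v, 'e) mdeg \<Rightarrow> ('v, 'e) mdeg" where
  "twist_on G n v F w = \<lparr>
     vdeg = (\<lambda>u. if u = v then vdeg w v - int (card {e\<in>F. cpos w e = 0})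
                 else vdeg w u + int (card {e\<in>F. (u = tail G e \<or> u = head G e) \<and>
                                             [cpos w e + orient G e v = 0] (mod int (n e))})),
     cpos = (\<lambda>e. if e \<in> F then (cpos w e + orient G e v) mod int (n e) else cpos w e) \<rparr>"

definition twist :: "('v, 'e) pre_digraph \<Rightarrow> ('e \<Rightarrow> nat) \<Rightarrow> 'v \<Rightarrow> ('v, 'e) mdeg \<Rightarrow> ('v, 'e) mdeg" where
  "twist G n v = twist_on G n v (incident G v)"

definition neg_twist :: "('v, 'e) pre_digraph \<Rightarrow> ('e \<Rightarrow> nat) \<Rightarrow> 'v \<Rightarrow> ('v, 'e) mdeg \<Rightarrow> ('v, 'e) mdeg" where
  "neg_twist G n v = inv_into {w. \<exists>d. admissible G n d w} (twist G n v)"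

text \<open>The twist at \<open>(e, v)\<close>, where \<open>e\<close> is the edge of the simple graph with endpoints \<open>v\<close> and \<open>v'\<close>.\<close>

definition edge_twist :: "('v, 'e) pre_digraph \<Rightarrow> ('e \<Rightarrow> nat) \<Rightarrow> 'v \<Rightarrow> 'v \<Rightarrow> ('v, 'e) mdeg \<Rightarrow> ('v, 'e) mdeg" where
  "edge_twist G n v v' = twist_on G n v (between G v v')"

inductive_set twist_class :: "('v, 'e) pre_digraph \<Rightarrow> ('e \<Rightarrow> nat) \<Rightarrow> ('v, 'e) mdeg \<Rightarrow> ('v, 'e) mdeg set"
  for G n w0 where
  tc_base: "w0 \<in> twist_class G n w0"
| tc_step: "w \<in> twist_class G n w0 \<Longrightarrow> v \<in> verts G \<Longrightarrow> twist G n v w \<in> twist_class G n w0"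

definition concentrated :: "('v, 'e) pre_digraph \<Rightarrow> ('e \<Rightarrow> nat) \<Rightarrow> 'v \<Rightarrow> ('v, 'e) mdeg \<Rightarrow> bool" where
  "concentrated G n v w \<longleftrightarrow> (\<exists>vs. distinct vs \<and> set vs = verts G \<and> vs \<noteq> [] \<and> hd vs = v \<and>
     (\<forall>i. 0 < i \<and> i < length vs \<longrightarrow> vdeg (fold (neg_twist G n) (take i vs) w) (vs ! i) < 0))"

definition tight ::
  "('v, 'e) pre_digraph \<Rightarrow> ('e \<Rightarrow> nat) \<Rightarrow> ('v \<Rightarrow> ('v, 'e) mdeg) \<Rightarrow> ('v \<Rightarrow> 'v \<Rightarrow> nat) \<Rightarrow> bool" where
  "tight G n w b \<longleftrightarrow> (\<forall>v\<in>verts G. concentrated G n v (w v)) \<and>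
     (\<forall>v v'. adjacent G v v' \<longrightarrow> w v = (edge_twist G n v' v ^^ b v v') (w v'))"

section \<open>Dual graphs and inserted chains\<close>

definition dual_graph ::
  "('x, 'k::field) fspace \<Rightarrow> ('v, 'e) pre_digraph \<Rightarrow> ('v \<Rightarrow> 'x set) \<Rightarrow> ('e \<Rightarrow> 'x) \<Rightarrow> bool" where
  "dual_graph X G Z nd \<longleftrightarrow>
    bij_betw Z (verts G) (irreducible_components (ftop X)) \<and>
    bij_betw nd (arcs G) {x\<in>topspace (ftop X). \<not> smooth_pt X x} \<and>
    (\<forall>e\<in>arcs G. \<forall>v\<in>verts G. nd e \<in> Z v \<longleftrightarrow> v = tail G e \<or> v = head G e)"

text \<open>
  \<open>X'\<close> is obtained from \<open>X\<close> by inserting a chain of \<open>n e - 1\<close> projective lines at each node \<open>nd e\<close>;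
  \<open>\<pi>\<close> is the contraction of the chains.
\<close>

definition chain_insertion ::
  "('x, 'k::field) fspace \<Rightarrow> ('v, 'e) pre_digraph \<Rightarrow> ('v \<Rightarrow> 'x set) \<Rightarrow> ('e \<Rightarrow> 'x) \<Rightarrow> ('e \<Rightarrow> nat) \<Rightarrow>
   ('y, 'k) fspace \<Rightarrow> (('v, 'e) mpoint \<Rightarrow> 'y set) \<Rightarrow> ('e \<times> nat \<Rightarrow> 'y) \<Rightarrow> ('y \<Rightarrow> 'x) \<Rightarrow> bool" where
  "chain_insertion X G Z nd n X' Z' nd' \<pi> \<longleftrightarrow>
    curve X' \<and> dual_graph X' (subdiv G n) Z' nd' \<and> fspace_morphism X' X \<pi> \<and>
    (\<forall>v\<in>verts G. fspace_iso (subsp X' (Z' (Vtx v))) (subsp X (Z v)) \<pi>) \<and>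
    (\<forall>e\<in>arcs G. \<forall>i<n e. \<pi> (nd' (e, i)) = nd e) \<and>
    (\<forall>e\<in>arcs G. \<forall>i. 0 < i \<and> i < n e \<longrightarrow>
       (\<forall>x\<in>Z' (Inn e (real i)). \<pi> x = nd e) \<and>
       (\<exists>\<psi>. fspace_iso (subsp X' (Z' (Inn e (real i)))) proj_line \<psi>))"

text \<open>The point of \<open>Z' (Vtx v)\<close> lying over the node \<open>nd e\<close>.\<close>

definition end_node :: "('v, 'e) pre_digraph \<Rightarrow> ('e \<Rightarrow> nat) \<Rightarrow> ('e \<times> nat \<Rightarrow> 'y) \<Rightarrow> 'e \<Rightarrow> 'v \<Rightarrow> 'y" where
  "end_node G n nd' e v = nd' (e, if v = tail G e then 0 else n e - 1)"

text \<open>The inserted chain over \<open>e\<close>, including the two end points; this is the node itself if \<open>n e = 1\<close>.\<close>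

definition inserted_chain ::
  "('e \<Rightarrow> nat) \<Rightarrow> (('v, 'e) mpoint \<Rightarrow> 'y set) \<Rightarrow> ('e \<times> nat \<Rightarrow> 'y) \<Rightarrow> 'e \<Rightarrow> 'y set" where
  "inserted_chain n Z' nd' e =
    (\<Union>i\<in>{0<..<n e}. Z' (Inn e (real i))) \<union> {nd' (e, i) | i. i < n e}"

definition enriched_structure ::
  "('y, 'k::field) fspace \<Rightarrow> ('u, 'a) pre_digraph \<Rightarrow> ('u \<Rightarrow> 'y set) \<Rightarrow> ('u \<Rightarrow> ('y, 'k) lbundle) \<Rightarrow> bool" where
  "enriched_structure X H Z N \<longleftrightarrow>
    (\<forall>u\<in>verts H. line_bundle X (N u)) \<and>
    bundle_isomorphic X (lb_twist (lb_trivial X) (verts H) N (\<lambda>_. 1)) (lb_trivial X) \<and>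
    (\<forall>u\<in>verts H. let Zc = ftop X closure_of (topspace (ftop X) - Z u);
                     D = (\<lambda>x. if x \<in> Z u \<inter> Zc then 1 else 0) in
       (\<exists>M. div_bundle (subsp X (Z u)) (\<lambda>x. - D x) M \<and>
            bundle_isomorphic (subsp X (Z u)) (lb_restr (N u) (Z u)) M) \<and>
       (\<exists>M. div_bundle (subsp X Zc) D M \<and> bundle_isomorphic (subsp X Zc) (lb_restr (N u) Zc) M))"

section \<open>Pre-limit linear series\<close>

text \<open>
  \<open>C v\<close> is the component corresponding to \<open>v\<close> and \<open>P e v\<close> its point at \<open>e\<close>; \<open>twist_support\<close> is the set of
  \<open>e'\<close> such that \<open>P e' v\<close> occurs in \<open>D\<^sub>i\<^sub>+\<^sub>1 - D\<^sub>i\<close>, for the edge with endpoints \<open>v\<close>, \<open>v'\<close>.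
\<close>

definition twist_support ::
  "('v, 'e) pre_digraph \<Rightarrow> ('e \<Rightarrow> nat) \<Rightarrow> ('v \<Rightarrow> ('v, 'e) mdeg) \<Rightarrow> 'v \<Rightarrow> 'v \<Rightarrow> nat \<Rightarrow> 'e set" where
  "twist_support G n w v v' i =
    {e\<in>between G v v'. [orient G e v * cpos (w v) e = - int i] (mod int (n e))}"

definition twist_div ::
  "('v, 'e) pre_digraph \<Rightarrow> ('e \<Rightarrow> nat) \<Rightarrow> ('v \<Rightarrow> ('v, 'e) mdeg) \<Rightarrow> ('e \<Rightarrow> 'v \<Rightarrow> 'p) \<Rightarrow>
   'v \<Rightarrow> 'v \<Rightarrow> nat \<Rightarrow> 'p multiset" where
  "twist_div G n w P v v' i =
    (\<Sum>k<i. image_mset (\<lambda>e. P e v) (mset_set (twist_support G n w v v' k)))"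

definition mv ::
  "('v, 'e) pre_digraph \<Rightarrow> ('e \<Rightarrow> nat) \<Rightarrow> ('v \<Rightarrow> ('v, 'e) mdeg) \<Rightarrow> ('v \<Rightarrow> 'v \<Rightarrow> nat) \<Rightarrow>
   ('v \<Rightarrow> ('p, 'k::field) fspace) \<Rightarrow> ('e \<Rightarrow> 'v \<Rightarrow> 'p) \<Rightarrow> ('v \<Rightarrow> ('p \<Rightarrow> 'p \<Rightarrow> 'k) set) \<Rightarrow>
   'v \<Rightarrow> 'v \<Rightarrow> nat list" where
  "mv G n w b C P V v v' = mvseq (C v) (V v) (twist_div G n w P v v') (b v v')"

definition prelimit_series ::
  "('v, 'e) pre_digraph \<Rightarrow> ('e \<Rightarrow> nat) \<Rightarrow> ('v \<Rightarrow> ('v, 'e) mdeg) \<Rightarrow> ('v \<Rightarrow> 'v \<Rightarrow> nat) \<Rightarrow>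
   ('v \<Rightarrow> ('p, 'k::field) fspace) \<Rightarrow> ('e \<Rightarrow> 'v \<Rightarrow> 'p) \<Rightarrow> nat \<Rightarrow>
   ('v \<Rightarrow> ('p, 'k) lbundle) \<Rightarrow> ('v \<Rightarrow> ('p \<Rightarrow> 'p \<Rightarrow> 'k) set) \<Rightarrow> bool" where
  "prelimit_series G n w b C P r L V \<longleftrightarrow>
    (\<forall>v\<in>verts G. line_bundle (C v) (L v) \<and> lb_degree (C v) (L v) (vdeg (w v) v) \<and>
       V v \<subseteq> gsect (C v) (L v) \<and> sect.subspace (V v) \<and> sect.dim (V v) = r + 1) \<and>
    (\<forall>v v'. adjacent G v v' \<longrightarrow>
       length (mv G n w b C P V v v') = r + 1 \<and>
       (\<forall>l\<le>r. \<forall>j\<le>b v v'. crit (twist_div G n w P v v') j \<and>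
          mv G n w b C P V v v' ! l = size (twist_div G n w P v v' j) \<longrightarrow>
          size (twist_div G n w P v' v (b v v' - j)) \<le> mv G n w b C P V v' v ! (r - l)))"

section \<open>The weak glueing condition\<close>

definition torus_orbit :: "'e set \<Rightarrow> ('e \<Rightarrow> 'k::field) set" where
  "torus_orbit I = {x. {e. x e \<noteq> 0} = I}"

definition weak_glueing ::
  "('v, 'e) pre_digraph \<Rightarrow> ('e \<Rightarrow> nat) \<Rightarrow> ('v \<Rightarrow> ('v, 'e) mdeg) \<Rightarrow> ('v \<Rightarrow> 'v \<Rightarrow> nat) \<Rightarrow>
   ('v \<Rightarrow> ('p, 'k::field) fspace) \<Rightarrow> ('e \<Rightarrow> 'v \<Rightarrow> 'p) \<Rightarrow> nat \<Rightarrow> ('v \<Rightarrow> ('p \<Rightarrow> 'p \<Rightarrow> 'k) set) \<Rightarrow> bool" where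
  "weak_glueing G n w b C P r V \<longleftrightarrow>
    (\<forall>v v' j. adjacent G v v' \<and> j \<le> b v v' \<and> crit (twist_div G n w P v v') j \<longrightarrow>
      (let D = twist_div G n w P v v' j;
           D' = twist_div G n w P v' v (b v v' - j);
           S = twist_support G n w v v' j;
           S' = twist_support G n w v' v (b v v' - j);
           g = card {l. l \<le> r \<and> mv G n w b C P V v v' ! l = size D \<and>
                        mv G n w b C P V v' v ! (r - l) = size D'}
       in \<exists>W W'.
         vec.subspace W \<and> W \<subseteq> eval_map (C v) (\<lambda>e. P e v) D S ` van (C v) (V v) D \<and>
         vec.subspace W' \<and> W' \<subseteq> eval_map (C v') (\<lambda>e. P e v') D' S' ` van (C v') (V v') D' \<and>
         vec.dim W = g \<and> vec.dim W' = g \<and>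
         (\<forall>I\<subseteq>S. krull_dim (subtopology (zariski S) (torus_orbit I \<inter> W)) =
                 krull_dim (subtopology (zariski S') (torus_orbit I \<inter> W')))))"

section \<open>Limit linear series\<close>

text \<open>
  The line bundle of multidegree \<open>w\<close> determined by \<open>L\<close>, for \<open>w\<close> in the twist class of \<open>w0\<close>; the function
  \<open>f\<close> is unique up to an additive constant, hence the bundle is unique up to isomorphism.
\<close>

definition lb_of_mdeg ::
  "('v, 'e) pre_digraph \<Rightarrow> ('e \<Rightarrow> nat) \<Rightarrow> (('v, 'e) mpoint \<Rightarrow> ('y, 'k::field) lbundle) \<Rightarrow> ('v, 'e) mdeg \<Rightarrow>
   ('y, 'k) lbundle \<Rightarrow> ('v, 'e) mdeg \<Rightarrow> ('y, 'k) lbundle" where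
  "lb_of_mdeg G n N w0 L w =
    (let f = (SOME f. rational_fun G n f \<and> (\<forall>u\<in>verts (subdiv G n). f u \<in> \<int>) \<and>
                (\<forall>p\<in>metric_graph G n. md_divisor w p = md_divisor w0 p + ord_at G n f p))
     in lb_twist L (verts (subdiv G n)) N (\<lambda>u. \<lfloor>f u\<rfloor>))"

definition of_multidegree ::
  "('v, 'e) pre_digraph \<Rightarrow> ('e \<Rightarrow> nat) \<Rightarrow> ('y, 'k::field) fspace \<Rightarrow> (('v, 'e) mpoint \<Rightarrow> 'y set) \<Rightarrow>
   ('v, 'e) mdeg \<Rightarrow> ('y, 'k) lbundle \<Rightarrow> bool" where
  "of_multidegree G n X Z w0 L \<longleftrightarrow>
    (\<forall>u\<in>verts (subdiv G n). lb_degree (subsp X (Z u)) (lb_restr L (Z u)) (md_divisor w0 u))"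

text \<open>
  \<open>\<phi>\<close> is the \<open>i\<close>-th glueing isomorphism for the edge with endpoints \<open>v\<close>, \<open>v'\<close>, written in the coordinates
  of \<open>eval_map\<close>.  Here \<open>\<alpha>\<close> and \<open>\<beta>\<close> identify the restrictions of the bundle of multidegree \<open>w\<^sup>i\<close> with
  \<open>\<L>\<^sup>v(-D\<^sub>i)\<close> and \<open>\<L>\<^sup>v\<^sup>'(-D'\<^sub>b\<^sub>-\<^sub>i)\<close>, and the trivialisations \<open>\<tau> e\<close> along the inserted chains identify its
  fibres at the two ends.  Since \<open>\<alpha>\<close>, \<open>\<beta>\<close> are unique up to scalars, so is \<open>\<phi>\<close>.
\<close>

definition glueing_iso ::
  "('v, 'e) pre_digraph \<Rightarrow> ('e \<Rightarrow> nat) \<Rightarrow> ('v \<Rightarrow> ('v, 'e) mdeg) \<Rightarrow> ('v \<Rightarrow> 'v \<Rightarrow> nat) \<Rightarrow>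
   ('y, 'k::field) fspace \<Rightarrow> (('v, 'e) mpoint \<Rightarrow> 'y set) \<Rightarrow> ('e \<times> nat \<Rightarrow> 'y) \<Rightarrow>
   (('v, 'e) mdeg \<Rightarrow> ('y, 'k) lbundle) \<Rightarrow> 'v \<Rightarrow> 'v \<Rightarrow> nat \<Rightarrow> (('e \<Rightarrow> 'k) \<Rightarrow> 'e \<Rightarrow> 'k) \<Rightarrow> bool" where
  "glueing_iso G n w b X Z nd Lw v v' i \<phi> \<longleftrightarrow>
    (let D = twist_div G n w (end_node G n nd) v v' i;
         D' = twist_div G n w (end_node G n nd) v' v (b v v' - i);
         S = twist_support G n w v v' i;
         Y = Z (Vtx v); Y' = Z (Vtx v');
         Li = Lw ((edge_twist G n v v' ^^ i) (w v))
     in \<exists>M M' \<alpha> \<beta> \<tau>.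
       div_bundle (subsp X Y) (\<lambda>x. - int (count D x)) M \<and>
       div_bundle (subsp X Y') (\<lambda>x. - int (count D' x)) M' \<and>
       bundle_iso (subsp X Y) (lb_restr Li Y) (lb_tensor (lb_restr (Lw (w v)) Y) M) \<alpha> \<and>
       bundle_iso (subsp X Y') (lb_restr Li Y') (lb_tensor (lb_restr (Lw (w v')) Y') M') \<beta> \<and>
       (\<forall>e\<in>S. let T = inserted_chain n Z nd e; P = end_node G n nd e v; P' = end_node G n nd e v' in
          bundle_iso (subsp X T) (lb_restr Li T) (lb_trivial (subsp X T)) (\<tau> e) \<and>
          (\<forall>x. \<tau> e P' P' * (\<phi> x e / \<beta> P' P') = \<tau> e P P * (x e / \<alpha> P P))) \<and>
       (\<forall>x e. e \<notin> S \<longrightarrow> \<phi> x e = 0))"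

definition is_basis :: "nat \<Rightarrow> ('x \<Rightarrow> 'y \<Rightarrow> 'k::field) set \<Rightarrow> (nat \<Rightarrow> 'x \<Rightarrow> 'y \<Rightarrow> 'k) \<Rightarrow> bool" where
  "is_basis r V s \<longleftrightarrow>
    inj_on s {..r} \<and> sect.independent (s ` {..r}) \<and> sect.span (s ` {..r}) = V"

definition limit_series ::
  "('v, 'e) pre_digraph \<Rightarrow> ('e \<Rightarrow> nat) \<Rightarrow> ('v, 'e) mdeg \<Rightarrow> ('v \<Rightarrow> ('v, 'e) mdeg) \<Rightarrow> ('v \<Rightarrow> 'v \<Rightarrow> nat) \<Rightarrow>
   ('y, 'k::field) fspace \<Rightarrow> (('v, 'e) mpoint \<Rightarrow> 'y set) \<Rightarrow> ('e \<times> nat \<Rightarrow> 'y) \<Rightarrow>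
   (('v, 'e) mpoint \<Rightarrow> ('y, 'k) lbundle) \<Rightarrow> nat \<Rightarrow>
   ('y, 'k) lbundle \<Rightarrow> ('v \<Rightarrow> ('y \<Rightarrow> 'y \<Rightarrow> 'k) set) \<Rightarrow> bool" where
  "limit_series G n w0 w b X Z nd N r L V \<longleftrightarrow>
    (let C = (\<lambda>v. subsp X (Z (Vtx v)));
         P = end_node G n nd;
         Lw = lb_of_mdeg G n N w0 L;
         a = mv G n w b C P V
     in line_bundle X L \<and> of_multidegree G n X Z w0 L \<and>
        prelimit_series G n w b C P r (\<lambda>v. lb_restr (Lw (w v)) (Z (Vtx v))) V \<and>
        (\<forall>v v'. adjacent G v v' \<longrightarrow>
          (let D = twist_div G n w P v v'; D' = twist_div G n w P v' v in
           \<exists>s s'. is_basis r (V v) s \<and> is_basis r (V v') s' \<and>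
             (\<forall>l\<le>r. ord_along (C v) (V v) D (b v v') (s l) = a v v' ! l) \<and>
             (\<forall>l\<le>r. ord_along (C v') (V v') D' (b v' v) (s' l) = a v' v ! l) \<and>
             (\<forall>j\<le>b v v'. crit D j \<longrightarrow>
               (\<exists>\<phi>. glueing_iso G n w b X Z nd Lw v v' j \<phi> \<and>
                 (\<forall>l\<le>r. a v v' ! l = size (D j) \<and> a v' v ! (r - l) = size (D' (b v v' - j)) \<longrightarrow>
                    \<phi> (eval_map (C v) (\<lambda>e. P e v) (D j) (twist_support G n w v v' j) (s l)) =
                    eval_map (C v') (\<lambda>e. P e v') (D' (b v v' - j))
                      (twist_support G n w v' v (b v v' - j)) (s' (r - l))))))))"

text \<open>
  Sections of \<open>L\<close> corresponding to elements of \<open>V\<close> (a set of sections of a bundle \<open>M\<close> on the target of \<open>\<pi>\<close>)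
  under an isomorphism \<open>h\<close> from \<open>L\<close> to the pullback of \<open>M\<close>.
\<close>

definition transported ::
  "('y, 'k::field) fspace \<Rightarrow> ('y, 'k) lbundle \<Rightarrow> ('y \<Rightarrow> 'x) \<Rightarrow> ('x, 'k) lbundle \<Rightarrow> ('y \<Rightarrow> 'y \<Rightarrow> 'k) \<Rightarrow>
   ('x \<Rightarrow> 'x \<Rightarrow> 'k) set \<Rightarrow> ('y \<Rightarrow> 'y \<Rightarrow> 'k) set" where
  "transported Y L \<pi> M h V = {s\<in>gsect Y L. \<exists>s'\<in>V. \<forall>x\<in>topspace (ftop Y).
     \<forall>z\<in>chart L x \<inter> chart (lb_pullback \<pi> (topspace (ftop Y)) M) x. s' (\<pi> x) (\<pi> z) = h x z * s x z}"

definition lifts_to_limit_series ::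
  "('v, 'e) pre_digraph \<Rightarrow> ('e \<Rightarrow> nat) \<Rightarrow> ('v, 'e) mdeg \<Rightarrow> ('v \<Rightarrow> ('v, 'e) mdeg) \<Rightarrow> ('v \<Rightarrow> 'v \<Rightarrow> nat) \<Rightarrow>
   ('y, 'k::field) fspace \<Rightarrow> (('v, 'e) mpoint \<Rightarrow> 'y set) \<Rightarrow> ('e \<times> nat \<Rightarrow> 'y) \<Rightarrow> ('y \<Rightarrow> 'x) \<Rightarrow>
   (('v, 'e) mpoint \<Rightarrow> ('y, 'k) lbundle) \<Rightarrow> nat \<Rightarrow>
   ('v \<Rightarrow> ('x, 'k) lbundle) \<Rightarrow> ('v \<Rightarrow> ('x \<Rightarrow> 'x \<Rightarrow> 'k) set) \<Rightarrow> bool" where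
  "lifts_to_limit_series G n w0 w b X Z nd \<pi> N r L V \<longleftrightarrow>
    (\<exists>\<L> h. let C = (\<lambda>v. subsp X (Z (Vtx v)));
               \<L>v = (\<lambda>v. lb_restr (lb_of_mdeg G n N w0 \<L> (w v)) (Z (Vtx v)))
     in (\<forall>v\<in>verts G. bundle_iso (C v) (\<L>v v) (lb_pullback \<pi> (Z (Vtx v)) (L v)) (h v)) \<and>
        limit_series G n w0 w b X Z nd N r \<L> (\<lambda>v. transported (C v) (\<L>v v) \<pi> (L v) (h v) (V v)))"

end

theory Submission
  imports Defs
begin

text \<open>
  The glueing isomorphisms of a limit linear series act diagonally in the coordinates given by
  evaluation at the nodes, hence so do their composites with the changes of charts and local
  parameters between the components of the blown-up curve and those of the original one.  Let \<open>U\<close> be the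
  span of the evaluations of those members \<open>s l\<close> of an adapted basis which are counted by \<open>g\<^sub>j\<close>.  They are
  linearly independent: the basis sections of larger order already span all sections vanishing along
  the next divisor, because the multivanishing sequence has the full length \<open>r + 1\<close>.  The subspaces
  required by the weak glueing condition are two diagonal rescalings of \<open>U\<close>, and a diagonal rescaling is
  a homeomorphism preserving torus orbits.
\<close>

section \<open>Linear algebra\<close>

text \<open>The limit series lives on the blown-up curve, the glueing condition on the original one,
  and \<open>transported\<close> does not say that every element of \<open>V v\<close> is reached.
  This is settled by counting: the transported tuple is itself a pre-limit series, so both spaces
  have dimension \<open>r + 1\<close>, and the injective map \<open>push\<close> must be onto. Full
  length of a multivanishing sequence is used in the same numerical way: the length telescopes to
  \<open>dim V - dim V(-D_(b+1))\<close>, so \<open>r + 1\<close> terms force the last space to be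
  zero, and the entries above \<open>deg D_j\<close> then number exactly
  \<open>dim V(-D_(j+1))\<close>. Independence is proved at the end \<open>v\<close> alone. Glueing
  carries the evaluation of \<open>s l\<close> to that of \<open>s' (r - l)\<close>, so a rescaling
  of \<open>U\<close> lies in the image at \<open>v'\<close> and keeps its dimension. Comparing
  torus orbits at the two ends also requires one common coordinate set. Tightness provides it: the
  edges entering at step \<open>j\<close> from \<open>v\<close> are those entering at step
  \<open>b - j\<close> from \<open>v'\<close>.\<close>

text \<open>
  The facts below cannot be added to the locale \<open>vector_space\<close> itself: it is interpreted twice under the
  prefix \<open>vec\<close>, so that they would clash.
\<close>

locale linear_space = vector_space
begin

text \<open>An infinite basis has \<open>card\<close> 0, so a positive \<open>dim\<close> already
  certifies finite dimension.\<close>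

lemma finite_spanning_if_dim_pos:
  assumes "0 < dim B"
  obtains F where "finite F" "B \<subseteq> span F"
proof -
  obtain C where C: "C \<subseteq> B" "independent C" "B \<subseteq> span C" "card C = dim B"
    by (rule basis_exists)
  then have "finite C" using assms card.infinite by fastforce
  then show thesis using C that by blast
qed

text \<open>The finite spanning set matters because \<open>dim\<close> is 0 on infinite-dimensional
  spaces. It may lie outside \<open>B\<close>.\<close>

lemma dim_le_of_subset:
  assumes "A \<subseteq> B" "B \<subseteq> span F" "finite F"
  shows "dim A \<le> dim B"
proof -
  obtain C where C: "C \<subseteq> A" "independent C" "A \<subseteq> span C" "card C = dim A"
    by (rule basis_exists)
  obtain E where E: "C \<subseteq> E" "E \<subseteq> B" "independent E" "B \<subseteq> span E"
    using maximal_independent_subset_extend[of C B] C assms by blast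
  have "finite E" using independent_span_bound[OF assms(3) E(3)] E(2) assms(2) by blast
  then have "card C \<le> card E" using E(1) card_mono by blast
  also have "card E = dim B" using E by (intro basis_card_eq_dim) auto
  finally show ?thesis using C by simp
qed

text \<open>Replaces explicit expansions and preimages by dimension counts, both for spans of basis
  sections and for the image of \<open>push\<close>.\<close>

lemma subspace_eq_of_dim_eq:
  assumes "subspace A" "subspace B" "A \<subseteq> B" "dim A = dim B" "B \<subseteq> span F" "finite F"
  shows "A = B"
proof -
  obtain C where C: "C \<subseteq> A" "independent C" "A \<subseteq> span C" "card C = dim A"
    by (rule basis_exists)
  obtain E where E: "C \<subseteq> E" "E \<subseteq> B" "independent E" "B \<subseteq> span E"
    using maximal_independent_subset_extend[of C B] C assms(3) by blast
  have "finite E" using independent_span_bound[OF assms(6) E(3)] E(2) assms(5) by blast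
  moreover have "card C = card E" using E C(4) assms(4) basis_card_eq_dim[of E B] by simp
  ultimately have "C = E" using E(1) by (simp add: card_subset_eq)
  then have "B \<subseteq> span A" using E(4) C(1) span_mono by blast
  then show ?thesis using assms(1,3) span_eq_iff by blast
qed

text \<open>\<open>independent\<close> speaks of sets, but the evaluations form a family indexed by
  \<open>l\<close>. Injectivity keeps indices from merging, so that the dimension of the span is the
  number of indices.\<close>

lemma independent_family:
  assumes "finite I" and "\<And>c i. (\<Sum>i\<in>I. scale (c i) (f i)) = 0 \<Longrightarrow> i \<in> I \<Longrightarrow> c i = 0"
  shows "inj_on f I" "independent (f ` I)"
proof -
  show inj: "inj_on f I"
  proof (rule inj_onI, rule ccontr)
    fix i j assume ij: "i \<in> I" "j \<in> I" "f i = f j" "i \<noteq> j"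
    \<comment> \<open>A coincidence \<open>f i = f j\<close> is itself a nontrivial relation, with
      coefficients 1 and -1.\<close>
    let ?c = "\<lambda>k. if k = i then 1 else if k = j then - 1 else 0"
    have "(\<Sum>k\<in>I. scale (?c k) (f k)) = (\<Sum>k\<in>{i, j}. scale (?c k) (f k))"
      using ij assms(1) by (intro sum.mono_neutral_right) auto
    also have "\<dots> = 0" using ij by simp
    finally show False using assms(2)[of ?c i] ij(1) by simp
  qed
  show "independent (f ` I)"
  proof
    assume "dependent (f ` I)"
    then obtain u i where "(\<Sum>v\<in>f ` I. scale (u v) v) = 0" "i \<in> I" "u (f i) \<noteq> 0"
      using dependent_finite[of "f ` I"] assms(1) by auto
    then show False using assms(2)[of "\<lambda>i. u (f i)"] inj by (simp add: sum.reindex)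
  qed
qed

end

locale linear_space_pair = vector_space_pair

text \<open>Injectivity is asked on \<open>V\<close> only, because \<open>push\<close> reads just
  the diagonal values \<open>s x x\<close> and is far from injective on arbitrary functions.\<close>

lemma (in linear_space_pair) dim_image_inj:
  assumes lf: "Vector_Spaces.linear s1 s2 f" and V: "vs1.subspace V" and inj: "inj_on f V"
  shows "vs2.dim (f ` V) = vs1.dim V"
proof -
  obtain B where B: "B \<subseteq> V" "vs1.independent B" "V \<subseteq> vs1.span B" "card B = vs1.dim V"
    by (rule vs1.basis_exists)
  have sp: "vs1.span B = V" using B V by (simp add: vs1.span_subspace)
  have "vs2.independent (f ` B)"
    using linear_independent_injective_image[OF lf B(2)] inj sp by simp
  moreover have "vs2.span (f ` B) = f ` V" using linear_span_image[OF lf] sp by simp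
  ultimately have "vs2.dim (f ` V) = card (f ` B)"
    using vs2.dim_span_eq_card_independent by metis
  also have "\<dots> = card B" using inj B(1) by (meson card_image inj_on_subset)
  finally show ?thesis using B(4) by simp
qed

interpretation sect_space: linear_space "\<lambda>(c::'k::field) (s :: 'x \<Rightarrow> 'y \<Rightarrow> 'k) x z. c * s x z"
  by unfold_locales

interpretation vec_space: linear_space "\<lambda>(c::'k::field) (a :: 'i \<Rightarrow> 'k) i. c * a i"
  by unfold_locales

interpretation sect_pair: linear_space_pair
  "\<lambda>(c::'k::field) (s :: 'x \<Rightarrow> 'y \<Rightarrow> 'k) x z. c * s x z"
  "\<lambda>(c::'k::field) (s :: 'u \<Rightarrow> 'v \<Rightarrow> 'k) x z. c * s x z"
  by unfold_locales

interpretation vec_pair: linear_space_pair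
  "\<lambda>(c::'k::field) (a :: 'i \<Rightarrow> 'k) i. c * a i" "\<lambda>(c::'k::field) (a :: 'i \<Rightarrow> 'k) i. c * a i"
  by unfold_locales

section \<open>Diagonal rescalings and the Zariski topology\<close>

text \<open>The action of diagonal matrices on coordinate space. Invertibility will be required at
  every index, so scalars attached to finitely many edges are extended by 1.\<close>

definition rescale :: "('i \<Rightarrow> 'k::field) \<Rightarrow> ('i \<Rightarrow> 'k) \<Rightarrow> 'i \<Rightarrow> 'k" where
  "rescale c x = (\<lambda>i. c i * x i)"

lemma linear_rescale:
  "Vector_Spaces.linear (\<lambda>(c::'k::field) (a :: 'i \<Rightarrow> 'k) i. c * a i)
     (\<lambda>(c::'k) (a :: 'i \<Rightarrow> 'k) i. c * a i) (rescale k)"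
  by (auto simp: Vector_Spaces.linear_iff vec.vector_space_axioms rescale_def fun_eq_iff algebra_simps)

lemma rescale_inverse:
  assumes "\<forall>i. c i \<noteq> 0"
  shows "rescale (\<lambda>i. inverse (c i)) (rescale c x) = x"
    and "rescale c (rescale (\<lambda>i. inverse (c i)) x) = x"
  using assms by (auto simp: rescale_def fun_eq_iff)

lemma inj_rescale: "\<forall>i. c i \<noteq> 0 \<Longrightarrow> inj (rescale c)"
  by (auto simp: rescale_def inj_def fun_eq_iff)

lemma rescale_torus_orbit:
  "\<forall>i. c i \<noteq> 0 \<Longrightarrow> rescale c x \<in> torus_orbit I \<longleftrightarrow> x \<in> torus_orbit I"
  by (simp add: rescale_def torus_orbit_def)

text \<open>\<open>topology\<close> returns the intended open sets only once
  \<open>istopology\<close> is verified.\<close>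

lemma openin_zariski:
  fixes I :: "'i set" and U :: "('i \<Rightarrow> 'k::field) set"
  shows "openin (zariski I) U \<longleftrightarrow> (\<exists>S\<subseteq>polyfun I. U = {x\<in>aff_points I. \<exists>p\<in>S. p x \<noteq> 0})"
proof -
  let ?D = "\<lambda>S :: (('i \<Rightarrow> 'k) \<Rightarrow> 'k) set. {x\<in>aff_points I. \<exists>p\<in>S. p x \<noteq> 0}"
  have "istopology (\<lambda>U. \<exists>S\<subseteq>polyfun I. U = ?D S)"
    unfolding istopology_def
  proof (intro conjI allI impI)
    fix U U' assume "\<exists>S\<subseteq>polyfun I. U = ?D S" "\<exists>S\<subseteq>polyfun I. U' = ?D S"
    then obtain S S' where S: "S \<subseteq> polyfun I" "U = ?D S" "S' \<subseteq> polyfun I" "U' = ?D S'" by auto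
    \<comment> \<open>A product in a field is nonzero iff both factors are, so products of the two
      families cut out the intersection.\<close>
    let ?T = "{\<lambda>x. p x * q x | p q. p \<in> S \<and> q \<in> S'}"
    have "?T \<subseteq> polyfun I" using S by (auto intro: pf_mult)
    moreover have "(\<exists>p\<in>?T. p x \<noteq> 0) \<longleftrightarrow> (\<exists>p\<in>S. p x \<noteq> 0) \<and> (\<exists>q\<in>S'. q x \<noteq> 0)" for x
    proof
      assume "(\<exists>p\<in>S. p x \<noteq> 0) \<and> (\<exists>q\<in>S'. q x \<noteq> 0)"
      then obtain p q where "p \<in> S" "p x \<noteq> 0" "q \<in> S'" "q x \<noteq> 0" by blast
      then show "\<exists>p\<in>?T. p x \<noteq> 0" by (intro bexI[of _ "\<lambda>x. p x * q x"]) auto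
    qed auto
    then have "U \<inter> U' = ?D ?T"
      by (intro set_eqI) (simp only: S(2,4) mem_Collect_eq Int_iff, blast)
    ultimately show "\<exists>S\<subseteq>polyfun I. U \<inter> U' = ?D S" by (intro exI[of _ ?T] conjI)
  next
    fix \<K> assume K: "\<forall>U\<in>\<K>. \<exists>S\<subseteq>polyfun I. U = ?D S"
    \<comment> \<open>An open set may have many defining sets of polynomials; one is chosen for each
      member, and their union defines the union.\<close>
    define f where "f U = (SOME S. S \<subseteq> polyfun I \<and> U = ?D S)" for U
    have f: "f U \<subseteq> polyfun I" "?D (f U) = U" if "U \<in> \<K>" for U
      using someI_ex[OF K[rule_format, OF that]] by (simp_all only: f_def)
    then have "\<Union>\<K> = (\<Union>U\<in>\<K>. ?D (f U))" by simp
    also have "\<dots> = ?D (\<Union>(f ` \<K>))" by auto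
    finally show "\<exists>S\<subseteq>polyfun I. \<Union>\<K> = ?D S"
      using f(1) by (intro exI[of _ "\<Union>(f ` \<K>)"] conjI) (blast, assumption)
  qed
  then show ?thesis unfolding zariski_def by (simp add: topology_inverse')
qed

lemma topspace_zariski: "topspace (zariski I) = aff_points I"
proof
  show "topspace (zariski I) \<subseteq> aff_points I" unfolding topspace_def openin_zariski by blast
  have "openin (zariski I) (aff_points I)"
    unfolding openin_zariski
    by (rule exI[of _ "{\<lambda>_. 1}"]) (auto intro: pf_const)
  then show "aff_points I \<subseteq> topspace (zariski I)" by (rule openin_subset)
qed

lemma polyfun_rescale: "p \<in> polyfun I \<Longrightarrow> (\<lambda>x. p (rescale c x)) \<in> polyfun I"
proof (induction rule: polyfun.induct)
  case (pf_coord i)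
  have "(\<lambda>x. (\<lambda>_. c i) x * (\<lambda>x. x i) x) \<in> polyfun I"
    by (intro polyfun.pf_mult polyfun.pf_const polyfun.pf_coord pf_coord)
  then show ?case by (simp add: rescale_def)
qed (auto intro: polyfun.intros)

lemma continuous_map_rescale:
  fixes c :: "'i \<Rightarrow> 'k::field"
  shows "continuous_map (zariski I) (zariski I) (rescale c)"
  unfolding continuous_map_def
proof (intro conjI allI impI)
  show "rescale c \<in> topspace (zariski I) \<rightarrow> topspace (zariski I)"
    by (auto simp: topspace_zariski aff_points_def rescale_def)
  fix U :: "('i \<Rightarrow> 'k) set" assume "openin (zariski I) U"
  then obtain S where S: "S \<subseteq> polyfun I" "U = {x\<in>aff_points I. \<exists>p\<in>S. p x \<noteq> 0}"
    by (auto simp: openin_zariski)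
  let ?S = "(\<lambda>p x. p (rescale c x)) ` S"
  have aff: "rescale c x \<in> aff_points I" if "x \<in> aff_points I" for x
    using that by (simp add: aff_points_def rescale_def)
  then have eq: "{x \<in> topspace (zariski I). rescale c x \<in> U} = {x\<in>aff_points I. \<exists>p\<in>?S. p x \<noteq> 0}"
    by (intro set_eqI) (simp add: S(2) topspace_zariski aff cong: conj_cong)
  have "?S \<subseteq> polyfun I" using S(1) polyfun_rescale by blast
  then show "openin (zariski I) {x \<in> topspace (zariski I). rescale c x \<in> U}"
    unfolding openin_zariski eq by (intro exI[of _ ?S] conjI refl)
qed

lemma homeomorphic_map_rescale:
  assumes "\<forall>i. c i \<noteq> 0"
  shows "homeomorphic_map (zariski I) (zariski I) (rescale c)"
  using assms unfolding homeomorphic_map_maps homeomorphic_maps_def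
  by (intro exI[of _ "rescale (\<lambda>i. inverse (c i))"]) (simp add: continuous_map_rescale rescale_inverse)

lemma irreducible_set_homeomorphic_image:
  assumes f: "homeomorphic_map T T' f" and S: "irreducible_set T S"
  shows "irreducible_set T' (f ` S)"
  unfolding irreducible_set_def
proof (intro conjI allI impI)
  have sub: "S \<subseteq> topspace T" using S by (simp add: irreducible_set_def)
  show "f ` S \<noteq> {}" using S by (simp add: irreducible_set_def)
  show "f ` S \<subseteq> topspace T'"
    using sub homeomorphic_imp_surjective_map[OF f] by blast
  fix A B assume AB: "closedin T' A \<and> closedin T' B \<and> f ` S \<subseteq> A \<union> B"
  let ?p = "\<lambda>A. {x \<in> topspace T. f x \<in> A}"
  have "closedin T (?p A)" "closedin T (?p B)"
    using AB homeomorphic_imp_continuous_map[OF f] closedin_continuous_map_preimage by blast+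
  moreover have "S \<subseteq> ?p A \<union> ?p B" using AB sub by auto
  ultimately have "S \<subseteq> ?p A \<or> S \<subseteq> ?p B" using S unfolding irreducible_set_def by blast
  then show "f ` S \<subseteq> A \<or> f ` S \<subseteq> B" by auto
qed

text \<open>Chains of irreducible closed sets are carried forward, and injectivity keeps the
  inclusions strict.\<close>

lemma krull_dim_le_homeomorphic:
  assumes f: "homeomorphic_map T T' f"
  shows "krull_dim T \<le> krull_dim T'"
  unfolding krull_dim_def
proof (rule Sup_subset_mono, clarify)
  fix n C assume C: "\<forall>i\<le>n. closedin T (C i) \<and> irreducible_set T (C i)" "\<forall>i<n. C i \<subset> C (Suc i)"
  have inj: "inj_on f (topspace T)" using f homeomorphic_imp_injective_map by blast
  have sub: "\<forall>i\<le>n. C i \<subseteq> topspace T" using C(1) closedin_subset by blast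
  have "\<forall>i\<le>n. closedin T' (f ` C i) \<and> irreducible_set T' (f ` C i)"
    using C(1) f homeomorphic_map_closedness_eq irreducible_set_homeomorphic_image by blast
  moreover have "\<forall>i<n. f ` C i \<subset> f ` C (Suc i)"
  proof (intro allI impI)
    fix i assume i: "i < n"
    then have "C i \<subset> C (Suc i)" "C (Suc i) \<subseteq> topspace T" using C(2) sub by auto
    then show "f ` C i \<subset> f ` C (Suc i)"
      using inj by (metis inj_on_image_eq_iff psubset_eq subset_trans image_mono)
  qed
  ultimately show "\<exists>m. ereal (real n) = ereal (real m) \<and>
     (\<exists>C. (\<forall>i\<le>m. closedin T' (C i) \<and> irreducible_set T' (C i)) \<and> (\<forall>i<m. C i \<subset> C (Suc i)))"
    by (intro exI[of _ n] conjI refl exI[of _ "\<lambda>i. f ` C i"]) auto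
qed

lemma krull_dim_homeomorphic:
  assumes "homeomorphic_map T T' f"
  shows "krull_dim T = krull_dim T'"
proof -
  obtain g where "homeomorphic_map T' T g"
    using assms homeomorphic_map_maps homeomorphic_maps_map by metis
  then show ?thesis using assms krull_dim_le_homeomorphic by (metis antisym)
qed

lemma krull_dim_torus_orbit_rescale:
  fixes c :: "'i \<Rightarrow> 'k::field"
  assumes c: "\<forall>i. c i \<noteq> 0" and I: "I \<subseteq> S"
  shows "krull_dim (subtopology (zariski S) (torus_orbit I \<inter> rescale c ` W)) =
    krull_dim (subtopology (zariski S) (torus_orbit I \<inter> W))"
proof -
  \<comment> \<open>Since \<open>I \<subseteq> S\<close>, the whole orbit lies in affine space over
    \<open>S\<close>; intersecting with the underlying space changes nothing and the homeomorphism
    restricts.\<close>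
  have "torus_orbit I \<subseteq> (topspace (zariski S) :: ('i \<Rightarrow> 'k) set)"
    using I by (auto simp: torus_orbit_def topspace_zariski aff_points_def)
  then have "topspace (zariski S) \<inter> (torus_orbit I \<inter> A) = torus_orbit I \<inter> A"
    for A :: "('i \<Rightarrow> 'k) set" by blast
  moreover have "rescale c ` (torus_orbit I \<inter> W) = torus_orbit I \<inter> rescale c ` W"
    using rescale_torus_orbit[OF c] by blast
  ultimately have "homeomorphic_map (subtopology (zariski S) (torus_orbit I \<inter> W))
      (subtopology (zariski S) (torus_orbit I \<inter> rescale c ` W)) (rescale c)"
    using homeomorphic_map_rescale[OF c, of S]
    by (intro homeomorphic_map_subtopologies) simp_all
  then show ?thesis using krull_dim_homeomorphic by metis
qed

section \<open>Orders of vanishing at smooth points\<close>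

lemma space_with_functionsD:
  assumes "space_with_functions X" "openin (ftop X) U"
  shows "\<forall>c. (\<lambda>_. c) \<in> freg X U"
    and "\<forall>f\<in>freg X U. \<forall>g\<in>freg X U. (\<lambda>y. f y + g y) \<in> freg X U \<and> (\<lambda>y. f y * g y) \<in> freg X U"
    and "\<forall>f\<in>freg X U. \<forall>g. (\<forall>y\<in>U. g y = f y) \<longrightarrow> g \<in> freg X U"
    and "\<forall>f\<in>freg X U. \<forall>V. openin (ftop X) V \<and> V \<subseteq> U \<longrightarrow> f \<in> freg X V"
    and "\<forall>f\<in>freg X U. openin (ftop X) {y\<in>U. f y \<noteq> 0} \<and>
         (\<lambda>y. inverse (f y)) \<in> freg X {y\<in>U. f y \<noteq> 0}"
  using assms(1)[unfolded space_with_functions_def, rule_format, OF assms(2)]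
  by - (elim conjE, assumption)+

section \<open>Germs of regular functions at a point\<close>

locale pointed_fspace =
  fixes X :: "('x, 'k::field) fspace" and x :: 'x
  assumes swf: "space_with_functions X" and pt: "x \<in> topspace (ftop X)"
begin

abbreviation near :: "('x \<Rightarrow> bool) \<Rightarrow> bool" where
  "near P \<equiv> eventually P (nhdsin (ftop X) x)"

lemma near_open: "openin (ftop X) U \<Longrightarrow> x \<in> U \<Longrightarrow> near (\<lambda>y. y \<in> U)"
  by (auto simp: eventually_nhdsin)

lemma near_at: "near P \<Longrightarrow> P x"
  using pt by (auto simp: eventually_nhdsin)

lemma germsI: "openin (ftop X) U \<Longrightarrow> x \<in> U \<Longrightarrow> f \<in> freg X U \<Longrightarrow> f \<in> germs X x"
  by (auto simp: germs_def)

lemma germsE: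
  assumes "f \<in> germs X x"
  obtains U where "openin (ftop X) U" "x \<in> U" "f \<in> freg X U"
  using assms by (auto simp: germs_def)

lemma freg_mono:
  "f \<in> freg X U \<Longrightarrow> openin (ftop X) U \<Longrightarrow> openin (ftop X) V \<Longrightarrow> V \<subseteq> U \<Longrightarrow> f \<in> freg X V"
  using space_with_functionsD(4)[OF swf, of U] by blast

lemma germs_const: "(\<lambda>_. c) \<in> germs X x"
proof (rule germsI)
  show "(\<lambda>_. c) \<in> freg X (topspace (ftop X))"
    using space_with_functionsD(1)[OF swf] by simp
qed (use pt in auto)

lemma germs_common_domain:
  assumes "f \<in> germs X x" "g \<in> germs X x"
  obtains U where "openin (ftop X) U" "x \<in> U" "f \<in> freg X U" "g \<in> freg X U"
proof -
  obtain U V where "openin (ftop X) U" "x \<in> U" "f \<in> freg X U"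
    "openin (ftop X) V" "x \<in> V" "g \<in> freg X V"
    using assms by (meson germsE)
  then show thesis using that[of "U \<inter> V"] freg_mono by (metis IntI inf_le1 inf_le2 openin_Int)
qed

lemma germs_add:
  assumes "f \<in> germs X x" "g \<in> germs X x"
  shows "(\<lambda>y. f y + g y) \<in> germs X x"
proof -
  obtain U where U: "openin (ftop X) U" "x \<in> U" "f \<in> freg X U" "g \<in> freg X U"
    using assms by (rule germs_common_domain)
  then show ?thesis using germsI[OF U(1,2)] space_with_functionsD(2)[OF swf U(1)] by blast
qed

lemma germs_mult:
  assumes "f \<in> germs X x" "g \<in> germs X x"
  shows "(\<lambda>y. f y * g y) \<in> germs X x"
proof -
  obtain U where U: "openin (ftop X) U" "x \<in> U" "f \<in> freg X U" "g \<in> freg X U"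
    using assms by (rule germs_common_domain)
  then show ?thesis using germsI[OF U(1,2)] space_with_functionsD(2)[OF swf U(1)] by blast
qed

lemma germs_power: "f \<in> germs X x \<Longrightarrow> (\<lambda>y. f y ^ m) \<in> germs X x"
  by (induction m) (auto intro: germs_mult germs_const)

lemma germs_diff: "f \<in> germs X x \<Longrightarrow> g \<in> germs X x \<Longrightarrow> (\<lambda>y. f y - g y) \<in> germs X x"
  using germs_add[of f "\<lambda>y. - 1 * g y"] germs_mult[OF germs_const[of "- 1"], of g] by simp

lemma germs_nonzero:
  assumes "f \<in> germs X x" "f x \<noteq> 0"
  shows "near (\<lambda>y. f y \<noteq> 0)" "(\<lambda>y. inverse (f y)) \<in> germs X x"
proof -
  obtain U where U: "openin (ftop X) U" "x \<in> U" "f \<in> freg X U" using assms(1) by (rule germsE)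
  let ?V = "{y\<in>U. f y \<noteq> 0}"
  have V: "openin (ftop X) ?V" "(\<lambda>y. inverse (f y)) \<in> freg X ?V" "x \<in> ?V"
    using space_with_functionsD(5)[OF swf U(1)] U assms(2) by simp_all
  show "near (\<lambda>y. f y \<noteq> 0)" using near_open[OF V(1,3)] by (rule eventually_mono) simp
  show "(\<lambda>y. inverse (f y)) \<in> germs X x" using V germsI by blast
qed

end

section \<open>Orders and leading values at a smooth point\<close>

locale smooth_point = pointed_fspace +
  assumes smooth: "smooth_pt X x"
begin

lemma local_param_loc_par: "local_param X x (loc_par X x)"
  unfolding loc_par_def using smooth someI_ex[of "local_param X x"] by (auto simp: smooth_pt_def)

lemma local_paramD:
  assumes "local_param X x t" "f \<in> germs X x" "f x = 0"
  obtains g where "g \<in> germs X x" "near (\<lambda>y. f y = t y * g y)"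
  using assms by (auto simp: local_param_def)

lemma loc_par_germs: "loc_par X x \<in> germs X x"
  using local_param_loc_par by (simp add: local_param_def)

text \<open>The local ring is a domain and a parameter is a nonzero germ, so its factors cancel one
  at a time.\<close>

lemma local_param_cancel:
  assumes t: "local_param X x t" and fg: "f \<in> germs X x" "g \<in> germs X x"
    and eq: "near (\<lambda>y. t y ^ m * f y = t y ^ m * g y)"
  shows "near (\<lambda>y. f y = g y)"
proof -
  have t': "t \<in> germs X x" "\<not> near (\<lambda>y. t y = 0)" using t by (auto simp: local_param_def)
  have cancel: "near (\<lambda>y. u y = 0)" if "u \<in> germs X x" "near (\<lambda>y. t y ^ k * u y = 0)" for u k
    using that
  proof (induction k arbitrary: u)
    case (Suc k)
    have "near (\<lambda>y. t y * u y = 0)"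
      using Suc.prems(2) by (intro Suc.IH[OF germs_mult[OF t'(1) Suc.prems(1)]]) (simp add: algebra_simps)
    then show ?case using smooth t' Suc.prems(1) unfolding smooth_pt_def by blast
  qed simp
  have "near (\<lambda>y. t y ^ m * (f y - g y) = 0)"
    using eq by (rule eventually_mono) (simp add: algebra_simps)
  then have "near (\<lambda>y. f y - g y = 0)" using germs_diff[OF fg] cancel by blast
  then show ?thesis by simp
qed

text \<open>\<open>vanishes_to\<close> lets the parameter vary with \<open>f\<close>. Any parameter
  is a germ multiple of \<open>t\<close>, so the order can be tested against one fixed
  \<open>t\<close>, which makes different functions comparable.\<close>

lemma vanishes_to_iff:
  assumes t: "local_param X x t"
  shows "vanishes_to X x m f \<longleftrightarrow> (\<exists>g\<in>germs X x. near (\<lambda>y. f y = t y ^ m * g y))"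
proof
  assume "vanishes_to X x m f"
  then obtain t' g where g: "local_param X x t'" "g \<in> germs X x" "near (\<lambda>y. f y = t' y ^ m * g y)"
    unfolding vanishes_to_def by blast
  then have "t' \<in> germs X x" "t' x = 0" by (auto simp: local_param_def)
  then obtain a where a: "a \<in> germs X x" "near (\<lambda>y. t' y = t y * a y)"
    by (rule local_paramD[OF t])
  have "near (\<lambda>y. f y = t y ^ m * (a y ^ m * g y))"
    using g(3) a(2) by eventually_elim (simp add: power_mult_distrib)
  then show "\<exists>g\<in>germs X x. near (\<lambda>y. f y = t y ^ m * g y)"
    by (intro bexI[OF _ germs_mult[OF germs_power[OF a(1)] g(2)]])
qed (use t in \<open>auto simp: vanishes_to_def\<close>)

text \<open>Cancellation makes the cofactor germ unique, which gives the definite description in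
  \<open>lead_val\<close> its value.\<close>

lemma lead_val_eqI:
  assumes "g \<in> germs X x" "near (\<lambda>y. f y = loc_par X x y ^ m * g y)"
  shows "lead_val X x m f = g x"
  unfolding lead_val_def
proof (rule the_equality)
  show "\<exists>h\<in>germs X x. h x = g x \<and> near (\<lambda>y. f y = loc_par X x y ^ m * h y)"
    using assms by blast
  fix c assume "\<exists>h\<in>germs X x. h x = c \<and> near (\<lambda>y. f y = loc_par X x y ^ m * h y)"
  then obtain h where h: "h \<in> germs X x" "h x = c" "near (\<lambda>y. f y = loc_par X x y ^ m * h y)"
    by blast
  have "near (\<lambda>y. loc_par X x y ^ m * h y = loc_par X x y ^ m * g y)"
    using assms(2) h(3) by eventually_elim simp
  then have "near (\<lambda>y. h y = g y)" using local_param_cancel[OF local_param_loc_par h(1) assms(1)] by blast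
  then show "c = g x" using near_at h(2) by blast
qed

lemma vanishes_toI:
  "g \<in> germs X x \<Longrightarrow> near (\<lambda>y. f y = loc_par X x y ^ m * g y) \<Longrightarrow> vanishes_to X x m f"
  using vanishes_to_iff[OF local_param_loc_par] by blast

lemma vanishes_toE:
  assumes "vanishes_to X x m f"
  obtains g where "g \<in> germs X x" "near (\<lambda>y. f y = loc_par X x y ^ m * g y)"
    "lead_val X x m f = g x"
  using assms lead_val_eqI vanishes_to_iff[OF local_param_loc_par] by blast

lemma vanishes_to_zero: "vanishes_to X x m (\<lambda>_. 0)"
  by (rule vanishes_toI[OF germs_const[of 0]]) simp

lemma vanishes_to_add:
  assumes f: "vanishes_to X x m f" and g: "vanishes_to X x m g"
  shows "vanishes_to X x m (\<lambda>y. f y + g y)"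
    and "lead_val X x m (\<lambda>y. f y + g y) = lead_val X x m f + lead_val X x m g"
proof -
  obtain f' where f': "f' \<in> germs X x" "near (\<lambda>y. f y = loc_par X x y ^ m * f' y)"
      "lead_val X x m f = f' x"
    using f by (rule vanishes_toE)
  obtain g' where g': "g' \<in> germs X x" "near (\<lambda>y. g y = loc_par X x y ^ m * g' y)"
      "lead_val X x m g = g' x"
    using g by (rule vanishes_toE)
  have add: "near (\<lambda>y. f y + g y = loc_par X x y ^ m * (f' y + g' y))"
    using f'(2) g'(2) by eventually_elim (simp add: algebra_simps)
  show "vanishes_to X x m (\<lambda>y. f y + g y)"
    by (rule vanishes_toI[OF germs_add[OF f'(1) g'(1)] add])
  show "lead_val X x m (\<lambda>y. f y + g y) = lead_val X x m f + lead_val X x m g"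
    using lead_val_eqI[OF germs_add[OF f'(1) g'(1)] add] f'(3) g'(3) by simp
qed

lemma vanishes_to_scale:
  assumes f: "vanishes_to X x m f"
  shows "vanishes_to X x m (\<lambda>y. c * f y)"
    and "lead_val X x m (\<lambda>y. c * f y) = c * lead_val X x m f"
proof -
  obtain f' where f': "f' \<in> germs X x" "near (\<lambda>y. f y = loc_par X x y ^ m * f' y)"
      "lead_val X x m f = f' x"
    using f by (rule vanishes_toE)
  have scale: "near (\<lambda>y. c * f y = loc_par X x y ^ m * (c * f' y))"
    using f'(2) by eventually_elim (simp add: algebra_simps)
  show "vanishes_to X x m (\<lambda>y. c * f y)"
    by (rule vanishes_toI[OF germs_mult[OF germs_const f'(1)] scale])
  show "lead_val X x m (\<lambda>y. c * f y) = c * lead_val X x m f"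
    using lead_val_eqI[OF germs_mult[OF germs_const f'(1)] scale] f'(3) by simp
qed

lemma vanishes_to_mono:
  assumes "vanishes_to X x m f" "k \<le> m"
  shows "vanishes_to X x k f"
proof -
  obtain g where g: "g \<in> germs X x" "near (\<lambda>y. f y = loc_par X x y ^ m * g y)"
    using assms(1) by (rule vanishes_toE)
  have "near (\<lambda>y. f y = loc_par X x y ^ k * (loc_par X x y ^ (m - k) * g y))"
    using g(2) by (rule eventually_mono) (simp add: assms(2) flip: power_add mult.assoc)
  then show ?thesis
    by (intro vanishes_toI[OF germs_mult[OF germs_power[OF loc_par_germs] g(1)]])
qed

text \<open>A cofactor with value 0 lies in the maximal ideal and so contributes one more factor of
  the parameter.\<close>

lemma vanishes_to_SucI:
  assumes "vanishes_to X x m f" "lead_val X x m f = 0"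
  shows "vanishes_to X x (Suc m) f"
proof -
  obtain g where g: "g \<in> germs X x" "near (\<lambda>y. f y = loc_par X x y ^ m * g y)"
      "lead_val X x m f = g x"
    using assms(1) by (rule vanishes_toE)
  then obtain h where h: "h \<in> germs X x" "near (\<lambda>y. g y = loc_par X x y * h y)"
    using local_paramD[OF local_param_loc_par, of g] assms(2) by metis
  have "near (\<lambda>y. f y = loc_par X x y ^ Suc m * h y)"
    using g(2) h(2) by eventually_elim simp
  then show ?thesis using h(1) by (intro vanishes_toI)
qed

end

section \<open>Comparison of orders and leading values along an isomorphism\<close>

locale smooth_point_iso = Y: smooth_point Y y + X: smooth_point X "\<pi> y"
  for Y :: "('y, 'k::field) fspace" and y and X :: "('x, 'k) fspace" and \<pi> +
  assumes iso: "fspace_iso Y X \<pi>"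
begin

lemma inj: "inj_on \<pi> (topspace (ftop Y))"
  using iso homeomorphic_imp_injective_map by (auto simp: fspace_iso_def)

lemma openin_preimage:
  "openin (ftop X) U \<Longrightarrow> openin (ftop Y) {z\<in>topspace (ftop Y). \<pi> z \<in> U}"
  using iso openin_continuous_map_preimage[OF homeomorphic_imp_continuous_map]
  by (auto simp: fspace_iso_def)

lemma openin_image: "openin (ftop Y) U \<Longrightarrow> openin (ftop X) (\<pi> ` U)"
  using iso homeomorphic_imp_open_map by (auto simp: fspace_iso_def open_map_def)

lemma near_pullback:
  assumes "X.near P"
  shows "Y.near (\<lambda>z. P (\<pi> z))"
proof -
  obtain U where "openin (ftop X) U" "\<pi> y \<in> U" "\<forall>x\<in>U. P x"
    using assms X.pt by (auto simp: eventually_nhdsin)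
  then show ?thesis using openin_preimage[of U] Y.pt unfolding eventually_nhdsin
    by (intro disjI2 exI[of _ "{z\<in>topspace (ftop Y). \<pi> z \<in> U}"]) simp
qed

lemma near_pushforward:
  assumes "Y.near (\<lambda>z. P (\<pi> z))"
  shows "X.near P"
proof -
  obtain U where "openin (ftop Y) U" "y \<in> U" "\<forall>z\<in>U. P (\<pi> z)"
    using assms Y.pt by (auto simp: eventually_nhdsin)
  then show ?thesis using openin_image[of U] unfolding eventually_nhdsin
    by (intro disjI2 exI[of _ "\<pi> ` U"]) simp
qed

lemma germs_pullback:
  assumes "f \<in> germs X (\<pi> y)"
  shows "(\<lambda>z. f (\<pi> z)) \<in> germs Y y"
proof -
  obtain U where U: "openin (ftop X) U" "\<pi> y \<in> U" "f \<in> freg X U" using assms by (rule X.germsE)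
  have "f \<circ> \<pi> \<in> freg Y {z\<in>topspace (ftop Y). \<pi> z \<in> U}"
    using iso U unfolding fspace_iso_def by blast
  then show ?thesis
    using Y.germsI[OF openin_preimage[OF U(1)]] U(2) Y.pt by (simp add: comp_def)
qed

text \<open>The germ is transported by inverting \<open>\<pi>\<close> on the space. Agreement is
  claimed only there, since values elsewhere are arbitrary and do not affect regularity.\<close>

lemma germs_pushforward:
  assumes "g \<in> germs Y y"
  obtains f where "f \<in> germs X (\<pi> y)" "\<And>z. z \<in> topspace (ftop Y) \<Longrightarrow> f (\<pi> z) = g z"
proof -
  obtain U where U: "openin (ftop Y) U" "y \<in> U" "g \<in> freg Y U" using assms by (rule Y.germsE)
  define f where "f = g \<circ> inv_into (topspace (ftop Y)) \<pi>"
  have f: "f (\<pi> z) = g z" if "z \<in> topspace (ftop Y)" for z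
    using that inj by (simp add: f_def)
  have sub: "U \<subseteq> topspace (ftop Y)" using U(1) openin_subset by blast
  have "{z \<in> topspace (ftop Y). \<pi> z \<in> \<pi> ` U} = U"
    using sub inj by (auto simp: inj_on_def)
  moreover have "f \<circ> \<pi> \<in> freg Y U"
  proof -
    have "\<forall>z\<in>U. (f \<circ> \<pi>) z = g z" using f sub by auto
    then show ?thesis using space_with_functionsD(3)[OF Y.swf U(1)] U(3) by blast
  qed
  ultimately have "f \<in> freg X (\<pi> ` U)"
    using iso openin_image[OF U(1)] by (simp add: fspace_iso_def)
  then have "f \<in> germs X (\<pi> y)" using U openin_image by (intro X.germsI[of "\<pi> ` U"]) auto
  then show thesis using f that by blast
qed

lemma Y_near_topspace: "Y.near (\<lambda>z. z \<in> topspace (ftop Y))"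
  using Y.near_open[OF openin_topspace Y.pt] .

lemma local_param_pullback:
  assumes t: "local_param X (\<pi> y) t"
  shows "local_param Y y (\<lambda>z. t (\<pi> z))"
  unfolding local_param_def
proof (intro conjI ballI impI)
  show "(\<lambda>z. t (\<pi> z)) \<in> germs Y y" "t (\<pi> y) = 0"
    using t germs_pullback by (auto simp: local_param_def)
  show "\<not> Y.near (\<lambda>z. t (\<pi> z) = 0)"
    using t near_pushforward[of "\<lambda>x. t x = 0"] by (auto simp: local_param_def)
  fix f assume f: "f \<in> germs Y y" "f y = 0"
  obtain f' where f': "f' \<in> germs X (\<pi> y)" "\<And>z. z \<in> topspace (ftop Y) \<Longrightarrow> f' (\<pi> z) = f z"
    using germs_pushforward[OF f(1)] by metis
  then have "f' (\<pi> y) = 0" using f Y.pt by simp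
  then obtain g where g: "g \<in> germs X (\<pi> y)" "X.near (\<lambda>x. f' x = t x * g x)"
    by (rule X.local_paramD[OF t f'(1)])
  have "Y.near (\<lambda>z. f z = t (\<pi> z) * g (\<pi> z))"
    using near_pullback[OF g(2)] Y_near_topspace by eventually_elim (simp add: f'(2))
  then show "\<exists>g\<in>germs Y y. Y.near (\<lambda>z. f z = t (\<pi> z) * g z)"
    by (intro bexI[OF _ germs_pullback[OF g(1)]])
qed

text \<open>\<open>c\<close> is chosen before the sections and depends only on the point,
  \<open>m\<close>, \<open>h\<close> and the parameters. This uniformity turns the transport of
  evaluations into a diagonal map.\<close>

lemma transport_section:
  assumes h: "h \<in> germs Y y" "h y \<noteq> 0"
  obtains c where "c \<noteq> 0"
    "\<forall>s s'. Y.near (\<lambda>z. s' (\<pi> z) = h z * s z) \<longrightarrow>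
       (vanishes_to X (\<pi> y) m s' \<longleftrightarrow> vanishes_to Y y m s) \<and>
       (vanishes_to Y y m s \<longrightarrow> lead_val X (\<pi> y) m s' = c * lead_val Y y m s)"
proof -
  let ?t = "\<lambda>z. loc_par X (\<pi> y) (\<pi> z)" and ?u = "loc_par Y y"
  have t: "local_param Y y ?t" using X.local_param_loc_par by (rule local_param_pullback)
  have u: "local_param Y y ?u" by (rule Y.local_param_loc_par)
  have t0: "?t \<in> germs Y y" "?t y = 0" and u0: "?u \<in> germs Y y" "?u y = 0"
    using t u by (simp_all add: local_param_def)
  obtain a where a: "a \<in> germs Y y" "Y.near (\<lambda>z. ?u z = ?t z * a z)"
    by (rule Y.local_paramD[OF t u0])
  obtain b where b: "b \<in> germs Y y" "Y.near (\<lambda>z. ?t z = ?u z * b z)"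
    by (rule Y.local_paramD[OF u t0])
  \<comment> \<open>The germs \<open>a\<close> and \<open>b\<close> compare the two parameters in
    both directions; cancelling \<open>?t\<close> shows that they are inverse units.\<close>
  have "Y.near (\<lambda>z. ?t z ^ 1 * (a z * b z) = ?t z ^ 1 * 1)"
    using a(2) b(2) by eventually_elim (metis mult.assoc mult.right_neutral power_one_right)
  then have "Y.near (\<lambda>z. a z * b z = 1)"
    using Y.local_param_cancel[OF t Y.germs_mult[OF a(1) b(1)] Y.germs_const] by blast
  then have a0: "a y \<noteq> 0" using Y.near_at by fastforce
  show thesis
  proof (rule that; (intro allI impI)?)
    \<comment> \<open>If \<open>s = ?u ^ m * g\<close>, then \<open>s'\<close> pulls back to
      \<open>h * s = ?t ^ m * (a ^ m * h * g)\<close>, so the leading value is multiplied by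
      \<open>a y ^ m * h y\<close>.\<close>
    show "a y ^ m * h y \<noteq> 0" using a0 h by simp
    fix s s' assume s: "Y.near (\<lambda>z. s' (\<pi> z) = h z * s z)"
    have fwd: "vanishes_to X (\<pi> y) m s' \<and> lead_val X (\<pi> y) m s' = a y ^ m * h y * lead_val Y y m s"
      if van: "vanishes_to Y y m s"
    proof -
      obtain g where g: "g \<in> germs Y y" "Y.near (\<lambda>z. s z = ?u z ^ m * g z)" "lead_val Y y m s = g y"
        using van by (rule Y.vanishes_toE)
      obtain f where f: "f \<in> germs X (\<pi> y)"
        "\<And>z. z \<in> topspace (ftop Y) \<Longrightarrow> f (\<pi> z) = a z ^ m * h z * g z"
        using germs_pushforward[OF Y.germs_mult[OF Y.germs_mult[OF Y.germs_power[OF a(1)] h(1)] g(1)]]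
        by blast
      have "Y.near (\<lambda>z. s' (\<pi> z) = ?t z ^ m * f (\<pi> z))"
        using s g(2) a(2) Y_near_topspace
        by eventually_elim (simp add: f(2) power_mult_distrib algebra_simps)
      then have "X.near (\<lambda>x. s' x = loc_par X (\<pi> y) x ^ m * f x)"
        by (rule near_pushforward)
      then show ?thesis
        using X.vanishes_toI[OF f(1)] X.lead_val_eqI[OF f(1)] f(2)[OF Y.pt] g(3) by metis
    qed
    have "vanishes_to Y y m s" if van: "vanishes_to X (\<pi> y) m s'"
    proof -
      obtain g where g: "g \<in> germs X (\<pi> y)" "X.near (\<lambda>x. s' x = loc_par X (\<pi> y) x ^ m * g x)"
        using van by (rule X.vanishes_toE)
      \<comment> \<open>Dividing by the unit \<open>h\<close> gives the order with respect to the
        pulled-back parameter \<open>?t\<close>, which is as good as \<open>?u\<close>.\<close>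
      have "Y.near (\<lambda>z. s z = ?t z ^ m * (inverse (h z) * g (\<pi> z)))"
        using near_pullback[OF g(2)] s Y.germs_nonzero(1)[OF h]
        by eventually_elim (auto simp: field_simps)
      then show ?thesis
        unfolding Y.vanishes_to_iff[OF t]
        by (intro bexI[OF _ Y.germs_mult[OF Y.germs_nonzero(2)[OF h] germs_pullback[OF g(1)]]])
    qed
    with fwd show "(vanishes_to X (\<pi> y) m s' \<longleftrightarrow> vanishes_to Y y m s) \<and>
       (vanishes_to Y y m s \<longrightarrow> lead_val X (\<pi> y) m s' = a y ^ m * h y * lead_val Y y m s)"
      by blast
  qed
qed

end

section \<open>The structure induced on a subset\<close>

lemma freg_subspI:
  assumes "\<And>x. x \<in> W \<Longrightarrow>
    \<exists>U g. openin (ftop X) U \<and> x \<in> U \<and> g \<in> freg X U \<and> (\<forall>y\<in>U \<inter> W. f y = g y)"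
  shows "f \<in> freg (subsp X Y) W"
  unfolding subsp_def fspace.simps mem_Collect_eq
proof
  fix x assume "x \<in> W"
  then obtain U g where "openin (ftop X) U" "x \<in> U" "g \<in> freg X U" "\<forall>y\<in>U \<inter> W. f y = g y"
    using assms by metis
  then show "\<exists>U. openin (ftop X) U \<and> x \<in> U \<and> (\<exists>g\<in>freg X U. \<forall>y\<in>U \<inter> W. f y = g y)"
    by (intro exI[of _ U] conjI bexI[of _ g])
qed

lemma freg_subspE:
  assumes "f \<in> freg (subsp X Y) W" "x \<in> W"
  obtains U g where "openin (ftop X) U" "x \<in> U" "g \<in> freg X U" "\<forall>y\<in>U \<inter> W. f y = g y"
  using assms by (auto simp: subsp_def)

lemma openin_subsp:
  "openin (ftop (subsp X Y)) V \<longleftrightarrow> (\<exists>U. openin (ftop X) U \<and> V = U \<inter> Y)"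
  by (auto simp: subsp_def openin_subtopology)

text \<open>Regular functions on a subset are local restrictions of ambient ones, so each axiom is
  inherited after shrinking neighbourhoods. This makes the local theory above applicable to
  components.\<close>

lemma space_with_functions_subsp:
  assumes X: "space_with_functions X"
  shows "space_with_functions (subsp X Y)"
  unfolding space_with_functions_def
proof (intro allI impI conjI ballI)
  fix W assume W: "openin (ftop (subsp X Y)) W"
  have W_top: "W \<subseteq> topspace (ftop X)" and WY: "W \<subseteq> Y"
    using W openin_subset by (auto simp: openin_subsp)
  {
    fix c
    have "(\<lambda>_. c) \<in> freg X (topspace (ftop X))"
      using space_with_functionsD(1)[OF X] by simp
    then show "(\<lambda>_. c) \<in> freg (subsp X Y) W"
      using W_top by (intro freg_subspI exI[of _ "topspace (ftop X)"] exI[of _ "\<lambda>_. c"]) auto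
  next
    fix f g assume fg: "f \<in> freg (subsp X Y) W" "g \<in> freg (subsp X Y) W"
    have loc: "\<exists>U f' g'. openin (ftop X) U \<and> x \<in> U \<and> f' \<in> freg X U \<and> g' \<in> freg X U \<and>
        (\<forall>y\<in>U \<inter> W. f y = f' y \<and> g y = g' y)" if x: "x \<in> W" for x
    proof -
      obtain U f' where U: "openin (ftop X) U" "x \<in> U" "f' \<in> freg X U" "\<forall>y\<in>U \<inter> W. f y = f' y"
        using fg(1) x by (rule freg_subspE)
      obtain U' g' where U': "openin (ftop X) U'" "x \<in> U'" "g' \<in> freg X U'" "\<forall>y\<in>U' \<inter> W. g y = g' y"
        using fg(2) x by (rule freg_subspE)
      have "openin (ftop X) (U \<inter> U') \<and> U \<inter> U' \<subseteq> U" "openin (ftop X) (U \<inter> U') \<and> U \<inter> U' \<subseteq> U'"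
        using U(1) U'(1) by auto
      then have "f' \<in> freg X (U \<inter> U')" "g' \<in> freg X (U \<inter> U')"
        using space_with_functionsD(4)[OF X] U(1,3) U'(1,3) by blast+
      then show ?thesis using U U'
        by (intro exI[of _ "U \<inter> U'"] exI[of _ f'] exI[of _ g']) auto
    qed
    show "(\<lambda>y. f y + g y) \<in> freg (subsp X Y) W"
    proof (rule freg_subspI)
      fix x assume "x \<in> W"
      then obtain U f' g' where U: "openin (ftop X) U" "x \<in> U" "f' \<in> freg X U" "g' \<in> freg X U"
        "\<forall>y\<in>U \<inter> W. f y = f' y \<and> g y = g' y" using loc by blast
      then show "\<exists>U h. openin (ftop X) U \<and> x \<in> U \<and> h \<in> freg X U \<and> (\<forall>y\<in>U \<inter> W. f y + g y = h y)"
        using space_with_functionsD(2)[OF X U(1)]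
        by (intro exI[of _ U] exI[of _ "\<lambda>y. f' y + g' y"]) auto
    qed
    show "(\<lambda>y. f y * g y) \<in> freg (subsp X Y) W"
    proof (rule freg_subspI)
      fix x assume "x \<in> W"
      then obtain U f' g' where U: "openin (ftop X) U" "x \<in> U" "f' \<in> freg X U" "g' \<in> freg X U"
        "\<forall>y\<in>U \<inter> W. f y = f' y \<and> g y = g' y" using loc by blast
      then show "\<exists>U h. openin (ftop X) U \<and> x \<in> U \<and> h \<in> freg X U \<and> (\<forall>y\<in>U \<inter> W. f y * g y = h y)"
        using space_with_functionsD(2)[OF X U(1)]
        by (intro exI[of _ U] exI[of _ "\<lambda>y. f' y * g' y"]) auto
    qed
  next
    fix f g assume f: "f \<in> freg (subsp X Y) W" and eq: "\<forall>y\<in>W. g y = f y"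
    show "g \<in> freg (subsp X Y) W"
    proof (rule freg_subspI)
      fix x assume "x \<in> W"
      with f obtain U h where "openin (ftop X) U" "x \<in> U" "h \<in> freg X U" "\<forall>y\<in>U \<inter> W. f y = h y"
        by (rule freg_subspE)
      then show "\<exists>U h. openin (ftop X) U \<and> x \<in> U \<and> h \<in> freg X U \<and> (\<forall>y\<in>U \<inter> W. g y = h y)"
        using eq by (intro exI[of _ U] exI[of _ h]) auto
    qed
  next
    fix f V assume f: "f \<in> freg (subsp X Y) W" and V: "openin (ftop (subsp X Y)) V \<and> V \<subseteq> W"
    show "f \<in> freg (subsp X Y) V"
    proof (rule freg_subspI)
      fix x assume "x \<in> V"
      with V have "x \<in> W" by blast
      with f obtain U h where "openin (ftop X) U" "x \<in> U" "h \<in> freg X U" "\<forall>y\<in>U \<inter> W. f y = h y"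
        by (rule freg_subspE)
      then show "\<exists>U h. openin (ftop X) U \<and> x \<in> U \<and> h \<in> freg X U \<and> (\<forall>y\<in>U \<inter> V. f y = h y)"
        using V by (intro exI[of _ U] exI[of _ h]) auto
    qed
  next
    fix f
    assume loc: "\<forall>x\<in>W. \<exists>V. openin (ftop (subsp X Y)) V \<and> x \<in> V \<and> V \<subseteq> W \<and> f \<in> freg (subsp X Y) V"
    show "f \<in> freg (subsp X Y) W"
    proof (rule freg_subspI)
      fix x assume "x \<in> W"
      then obtain V where V: "openin (ftop (subsp X Y)) V" "x \<in> V" "V \<subseteq> W" "f \<in> freg (subsp X Y) V"
        using loc by blast
      obtain V' where V': "openin (ftop X) V'" "V = V' \<inter> Y" using V(1) by (auto simp: openin_subsp)
      obtain U g where U: "openin (ftop X) U" "x \<in> U" "g \<in> freg X U" "\<forall>y\<in>U \<inter> V. f y = g y"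
        using V(4,2) by (rule freg_subspE)
      \<comment> \<open>The extension \<open>g\<close> matches \<open>f\<close> only on
        \<open>V\<close>. Cutting down to \<open>V'\<close> repairs this, as
        \<open>U \<inter> V' \<inter> W\<close> lies in \<open>V\<close>.\<close>
      show "\<exists>U h. openin (ftop X) U \<and> x \<in> U \<and> h \<in> freg X U \<and> (\<forall>y\<in>U \<inter> W. f y = h y)"
        using U V' V(2) WY space_with_functionsD(4)[OF X U(1), rule_format, OF U(3), of "U \<inter> V'"]
        by (intro exI[of _ "U \<inter> V'"] exI[of _ g]) auto
    qed
  next
    fix f assume f: "f \<in> freg (subsp X Y) W"
    let ?V = "{y \<in> W. f y \<noteq> 0}"
    \<comment> \<open>Shrinking to the nonvanishing locus of the ambient extension serves both the
      openness of \<open>?V\<close> and the regularity of the inverse.\<close>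
    have nz: "\<exists>U g. openin (ftop X) U \<and> x \<in> U \<and> (\<forall>y\<in>U \<inter> W. f y \<noteq> 0) \<and>
        g \<in> freg X U \<and> (\<forall>y\<in>U \<inter> W. inverse (f y) = g y)" if x: "x \<in> W" "f x \<noteq> 0" for x
    proof -
      obtain U g where U: "openin (ftop X) U" "x \<in> U" "g \<in> freg X U" "\<forall>y\<in>U \<inter> W. f y = g y"
        using f x(1) by (rule freg_subspE)
      then show ?thesis using space_with_functionsD(5)[OF X U(1)] x
        by (intro exI[of _ "{y\<in>U. g y \<noteq> 0}"] exI[of _ "\<lambda>y. inverse (g y)"]) auto
    qed
    show "(\<lambda>y. inverse (f y)) \<in> freg (subsp X Y) ?V"
    proof (rule freg_subspI)
      fix x assume "x \<in> ?V"
      then obtain U g where "openin (ftop X) U" "x \<in> U" "g \<in> freg X U"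
          "\<forall>y\<in>U \<inter> W. inverse (f y) = g y" using nz[of x] by blast
      then show "\<exists>U h. openin (ftop X) U \<and> x \<in> U \<and> h \<in> freg X U \<and> (\<forall>y\<in>U \<inter> ?V. inverse (f y) = h y)"
        by (intro exI[of _ U] exI[of _ g]) auto
    qed
    have "\<exists>T. openin (ftop (subsp X Y)) T \<and> x \<in> T \<and> T \<subseteq> ?V" if x: "x \<in> ?V" for x
    proof -
      obtain U where U: "openin (ftop X) U" "x \<in> U" "\<forall>y\<in>U \<inter> W. f y \<noteq> 0" using nz[of x] x by blast
      obtain W' where "openin (ftop X) W'" "W = W' \<inter> Y" using W by (auto simp: openin_subsp)
      then have "openin (ftop (subsp X Y)) (U \<inter> W)"
        unfolding openin_subsp using U(1) by (intro exI[of _ "U \<inter> W'"]) auto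
      then show ?thesis using U x by (intro exI[of _ "U \<inter> W"]) auto
    qed
    then show "openin (ftop (subsp X Y)) ?V" using openin_subopen[of _ ?V] by blast
  }
qed

lemma smooth_point_component:
  assumes "curve X" "C \<in> irreducible_components (ftop X)" "x \<in> C"
  shows "smooth_point (subsp X C) x"
proof
  have "space_with_functions X"
    using assms(1) by (simp add: curve_def proper_variety_def prevariety_def)
  then show "space_with_functions (subsp X C)" by (rule space_with_functions_subsp)
  show "smooth_pt (subsp X C) x" using assms by (simp add: curve_def)
  then show "x \<in> topspace (ftop (subsp X C))" by (simp add: smooth_pt_def)
qed

section \<open>Multivanishing sequences and adapted bases\<close>

text \<open>Natural subtraction truncates; monotonicity makes the differences exact.\<close>

lemma sum_diff_telescope_nat:
  fixes d :: "nat \<Rightarrow> nat"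
  assumes "antimono d" "m \<le> n"
  shows "(\<Sum>i\<in>{m..<n}. d i - d (Suc i)) = d m - d n"
  using assms(2)
proof (induction n rule: dec_induct)
  case (step n)
  have "d (Suc n) \<le> d n" "d n \<le> d m" using assms(1) step.hyps by (auto simp: antimono_def)
  then show ?case using step by simp
qed simp

lemma size_filter_mset_sum_replicate:
  "finite A \<Longrightarrow> size (filter_mset p (\<Sum>i\<in>A. replicate_mset (m i) (f i))) =
     (\<Sum>i\<in>A. if p (f i) then m i else 0)"
proof (induction A rule: finite_induct)
  case (insert x A)
  have "filter_mset p (replicate_mset k a) = (if p a then replicate_mset k a else {#})" for k a
    by (induction k) auto
  then show ?case using insert by simp
qed simp

text \<open>The twisting divisors of one edge of the simple graph, seen on one component:
  \<open>E\<close> is the set of edges over it and \<open>T i\<close> consists of those whose points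
  enter at step \<open>i\<close>. The same \<open>E\<close> and \<open>T\<close> serve the blown-up
  and the original curve; only the points change.\<close>

locale divisor_chain =
  fixes C :: "('x, 'k::field) fspace" and E :: "'e set" and P :: "'e \<Rightarrow> 'x" and T :: "nat \<Rightarrow> 'e set"
    and V :: "('x \<Rightarrow> 'x \<Rightarrow> 'k) set" and D :: "nat \<Rightarrow> 'x multiset"
  assumes finite_E: "finite E" and inj_P: "inj_on P E" and T_subset: "\<And>i. T i \<subseteq> E"
    and smooth_P: "\<And>e. e \<in> E \<Longrightarrow> smooth_point C (P e)"
    and subspace_V: "sect.subspace V"
    and V_germs: "\<And>s e. s \<in> V \<Longrightarrow> e \<in> E \<Longrightarrow> s (P e) \<in> germs C (P e)"
    and D_eq: "\<And>i. D i = (\<Sum>k<i. image_mset P (mset_set (T k)))"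
begin

lemma finite_T: "finite (T i)"
  using T_subset finite_E finite_subset by blast

lemma D_Suc: "D (Suc i) = D i + image_mset P (mset_set (T i))"
  by (simp add: D_eq)

lemma count_image_T: "e \<in> E \<Longrightarrow> count (image_mset P (mset_set (T i))) (P e) = (if e \<in> T i then 1 else 0)"
proof -
  assume e: "e \<in> E"
  have "inj_on P (T i)" using inj_P T_subset inj_on_subset by blast
  then have "image_mset P (mset_set (T i)) = mset_set (P ` T i)" by (rule image_mset_mset_set)
  moreover have "P e \<in> P ` T i \<longleftrightarrow> e \<in> T i" using inj_on_image_mem_iff[OF inj_P e T_subset] .
  ultimately show ?thesis using finite_T by (simp add: count_mset_set')
qed

text \<open>Each step adds a point at most once, so multiplicities depend on \<open>T\<close> but
  not on the curve.\<close>

lemma count_D: "e \<in> E \<Longrightarrow> count (D i) (P e) = card {k. k < i \<and> e \<in> T k}"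
proof (induction i)
  case (Suc i)
  have "{k. k < Suc i \<and> e \<in> T k} = (if e \<in> T i then insert i {k. k < i \<and> e \<in> T k} else {k. k < i \<and> e \<in> T k})"
    by (auto simp: less_Suc_eq)
  then show ?case using Suc count_image_T[OF Suc.prems] by (simp add: D_Suc)
qed (simp add: D_eq)

lemma set_D: "set_mset (D i) \<subseteq> P ` E"
  using T_subset by (induction i) (auto simp: D_eq finite_T)

lemma D_mono: "i \<le> j \<Longrightarrow> D i \<subseteq># D j"
  by (induction j rule: dec_induct) (auto simp: D_Suc intro: subset_mset.order_trans)

lemma size_D_mono: "i \<le> j \<Longrightarrow> size (D i) \<le> size (D j)"
  using D_mono size_mset_mono by blast

text \<open>The divisors are nested, so a degree determines the divisor, although several indices
  may share it.\<close>

lemma D_eqI: "size (D i) = size (D j) \<Longrightarrow> D i = D j"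
  by (metis D_mono linear mset_subset_size nat_less_le subset_mset.less_le)

lemma size_D: "size (D i) = (\<Sum>k<i. card (T k))"
  by (induction i) (simp_all add: D_eq)

lemma crit_iff: "crit D i \<longleftrightarrow> T i \<noteq> {}"
  using finite_T by (simp add: crit_def D_Suc mset_set_empty_iff)

lemma size_D_less: "crit D i \<Longrightarrow> i < j \<Longrightarrow> size (D i) < size (D j)"
proof -
  assume "crit D i" "i < j"
  then have "size (D i) < size (D (Suc i))"
    using finite_T by (simp add: crit_iff D_Suc card_gt_0_iff)
  also have "\<dots> \<le> size (D j)" using \<open>i < j\<close> by (intro size_D_mono) simp
  finally show ?thesis .
qed

text \<open>Testing all of \<open>E\<close> instead of the support of \<open>D i\<close> gives a
  condition of the same shape on both curves. At a point outside the support the order is 0, which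
  every germ attains.\<close>

lemma van_iff:
  "s \<in> van C V (D i) \<longleftrightarrow>
     s \<in> V \<and> (\<forall>e\<in>E. vanishes_to C (P e) (card {k. k < i \<and> e \<in> T k}) (s (P e)))"
proof -
  have "vanishes_to C (P e) (count (D i) (P e)) (s (P e))"
    if "s \<in> V" "e \<in> E" "P e \<notin># D i" for e
  proof -
    interpret smooth_point C "P e" using smooth_P that by blast
    have "count (D i) (P e) = 0" using that by (simp add: not_in_iff)
    then show ?thesis using vanishes_toI[OF V_germs[OF that(1,2)], of "s (P e)" 0] by simp
  qed
  then have "s \<in> van C V (D i) \<longleftrightarrow> s \<in> V \<and> (\<forall>e\<in>E. vanishes_to C (P e) (count (D i) (P e)) (s (P e)))"
    using set_D[of i] unfolding van_def by blast
  then show ?thesis by (simp add: count_D)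
qed

lemma van_subset: "van C V (D i) \<subseteq> V"
  by (auto simp: van_def)

lemma van_0: "van C V (D 0) = V"
  by (auto simp: van_def D_eq)

lemma subspace_van: "sect.subspace (van C V (D i))"
proof (rule sect.subspaceI)
  show "0 \<in> van C V (D i)"
    using sect.subspace_0[OF subspace_V] smooth_point.vanishes_to_zero[OF smooth_P]
    by (simp add: van_iff zero_fun_def)
next
  fix s t assume st: "s \<in> van C V (D i)" "t \<in> van C V (D i)"
  then show "s + t \<in> van C V (D i)"
    using sect.subspace_add[OF subspace_V] smooth_point.vanishes_to_add(1)[OF smooth_P]
    by (simp add: van_iff plus_fun_def)
next
  fix c s assume "s \<in> van C V (D i)"
  then show "(\<lambda>x z. c * s x z) \<in> van C V (D i)"
    using sect.subspace_scale[OF subspace_V] smooth_point.vanishes_to_scale(1)[OF smooth_P]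
    by (simp add: van_iff)
qed

lemma van_antimono:
  assumes "i \<le> j"
  shows "van C V (D j) \<subseteq> van C V (D i)"
proof
  fix s assume s: "s \<in> van C V (D j)"
  have "card {k. k < i \<and> e \<in> T k} \<le> card {k. k < j \<and> e \<in> T k}" for e
    using assms by (intro card_mono) auto
  then show "s \<in> van C V (D i)"
    using s smooth_point.vanishes_to_mono[OF smooth_P] unfolding van_iff by blast
qed

text \<open>\<open>lead_val\<close> is controlled only for sections that reach the required order,
  so linearity is stated on \<open>van\<close> rather than globally.\<close>

lemma eval_map_add:
  assumes "s \<in> van C V (D i)" "t \<in> van C V (D i)"
  shows "eval_map C P (D i) (T i) (s + t) = eval_map C P (D i) (T i) s + eval_map C P (D i) (T i) t"
proof
  fix e
  have "lead_val C (P e) (count (D i) (P e)) (s (P e) + t (P e)) =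
      lead_val C (P e) (count (D i) (P e)) (s (P e)) + lead_val C (P e) (count (D i) (P e)) (t (P e))"
    if "e \<in> T i"
  proof -
    have e: "e \<in> E" using that T_subset by blast
    show ?thesis
      using smooth_point.vanishes_to_add(2)[OF smooth_P[OF e]] assms e
      by (simp add: van_iff count_D plus_fun_def)
  qed
  then show "eval_map C P (D i) (T i) (s + t) e = (eval_map C P (D i) (T i) s + eval_map C P (D i) (T i) t) e"
    by (simp add: eval_map_def)
qed

lemma eval_map_scale:
  assumes "s \<in> van C V (D i)"
  shows "eval_map C P (D i) (T i) (\<lambda>x z. c * s x z) = (\<lambda>e. c * eval_map C P (D i) (T i) s e)"
proof
  fix e
  have "lead_val C (P e) (count (D i) (P e)) (\<lambda>z. c * s (P e) z) =
      c * lead_val C (P e) (count (D i) (P e)) (s (P e))" if "e \<in> T i"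
  proof -
    have e: "e \<in> E" using that T_subset by blast
    show ?thesis
      using smooth_point.vanishes_to_scale(2)[OF smooth_P[OF e]] assms e by (simp add: van_iff count_D)
  qed
  then show "eval_map C P (D i) (T i) (\<lambda>x z. c * s x z) e = c * eval_map C P (D i) (T i) s e"
    by (simp add: eval_map_def)
qed

lemma eval_map_sum:
  assumes "finite I" "\<And>l. l \<in> I \<Longrightarrow> s l \<in> van C V (D i)"
  shows "eval_map C P (D i) (T i) (\<Sum>l\<in>I. (\<lambda>x z. c l * s l x z)) =
    (\<Sum>l\<in>I. (\<lambda>e. c l * eval_map C P (D i) (T i) (s l) e))"
  using assms
proof (induction I rule: finite_induct)
  case empty
  show ?case
    using eval_map_scale[OF sect.subspace_0[OF subspace_van], of i 0] by (simp add: zero_fun_def)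
next
  case (insert l I)
  have sc: "(\<lambda>x z. c m * s m x z) \<in> van C V (D i)" if "m \<in> insert l I" for m
    using sect.subspace_scale[OF subspace_van] insert.prems that by blast
  then have "(\<Sum>l\<in>I. (\<lambda>x z. c l * s l x z)) \<in> van C V (D i)"
    by (intro sect.subspace_sum[OF subspace_van]) blast
  then have "eval_map C P (D i) (T i) (\<Sum>l\<in>insert l I. (\<lambda>x z. c l * s l x z)) =
      eval_map C P (D i) (T i) (\<lambda>x z. c l * s l x z) +
      eval_map C P (D i) (T i) (\<Sum>l\<in>I. (\<lambda>x z. c l * s l x z))"
    unfolding sum.insert[OF insert.hyps] using sc by (intro eval_map_add) auto
  also have "eval_map C P (D i) (T i) (\<lambda>x z. c l * s l x z) =
      (\<lambda>e. c l * eval_map C P (D i) (T i) (s l) e)"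
    using insert.prems by (intro eval_map_scale) auto
  also have "eval_map C P (D i) (T i) (\<Sum>l\<in>I. (\<lambda>x z. c l * s l x z)) =
      (\<Sum>l\<in>I. (\<lambda>e. c l * eval_map C P (D i) (T i) (s l) e))"
    using insert by blast
  finally show ?case unfolding sum.insert[OF insert.hyps] .
qed

text \<open>Linearity is available only on \<open>van\<close>, so closure is checked directly
  instead of through images of linear maps.\<close>

lemma subspace_eval_image: "vec.subspace (eval_map C P (D i) (T i) ` van C V (D i))"
proof (rule vec.subspaceI)
  have "eval_map C P (D i) (T i) 0 = 0"
    using eval_map_sum[of "{}"] by simp
  then show "0 \<in> eval_map C P (D i) (T i) ` van C V (D i)"
    using sect.subspace_0[OF subspace_van] by (metis imageI)
next
  fix x y assume "x \<in> eval_map C P (D i) (T i) ` van C V (D i)" "y \<in> eval_map C P (D i) (T i) ` van C V (D i)"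
  then show "x + y \<in> eval_map C P (D i) (T i) ` van C V (D i)"
    using sect.subspace_add[OF subspace_van] eval_map_add by (auto simp: image_iff) metis
next
  fix c x assume "x \<in> eval_map C P (D i) (T i) ` van C V (D i)"
  then obtain s where "s \<in> van C V (D i)" "x = eval_map C P (D i) (T i) s" by blast
  then show "(\<lambda>e. c * x e) \<in> eval_map C P (D i) (T i) ` van C V (D i)"
    using sect.subspace_scale[OF subspace_van, of s i c] eval_map_scale[of s i c] by force
qed

text \<open>Only the points entering at step \<open>i\<close> demand a higher order, and there the
  leading value is a coordinate of the evaluation.\<close>

lemma van_Suc_if_eval_zero:
  assumes s: "s \<in> van C V (D i)" and ev: "eval_map C P (D i) (T i) s = 0"
  shows "s \<in> van C V (D (Suc i))"
proof -
  have "vanishes_to C (P e) (card {k. k < Suc i \<and> e \<in> T k}) (s (P e))" if e: "e \<in> E" for e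
  proof -
    interpret smooth_point C "P e" using smooth_P e .
    have van: "vanishes_to C (P e) (card {k. k < i \<and> e \<in> T k}) (s (P e))"
      using s e by (simp add: van_iff)
    have split: "{k. k < Suc i \<and> e \<in> T k} =
        (if e \<in> T i then insert i {k. k < i \<and> e \<in> T k} else {k. k < i \<and> e \<in> T k})"
      by (auto simp: less_Suc_eq)
    show ?thesis
    proof (cases "e \<in> T i")
      case True
      then have "lead_val C (P e) (card {k. k < i \<and> e \<in> T k}) (s (P e)) = 0"
        using fun_cong[OF ev, of e] e by (simp add: eval_map_def count_D)
      then show ?thesis using vanishes_to_SucI[OF van] True split by simp
    qed (use van split in simp)
  qed
  then show ?thesis using s by (simp add: van_iff)
qed

lemma ord_along_attained:
  assumes "s \<in> V"
  obtains M where "ord_along C V D b s = size (D M)" "s \<in> van C V (D M)"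
proof -
  let ?A = "{i. i \<le> Suc b \<and> s \<in> van C V (D i)}"
  have "0 \<in> ?A" "finite ?A" using assms by (auto simp: van_0)
  then have "Max ?A \<in> ?A" using Max_in by blast
  then show thesis using that by (simp add: ord_along_def)
qed

lemma van_if_ord_along:
  assumes "s \<in> V" "ord_along C V D b s = size (D k)"
  shows "s \<in> van C V (D k)"
  using ord_along_attained[OF assms(1)] assms(2) D_eqI by metis

lemma van_Suc_if_less_ord_along:
  assumes "s \<in> V" "size (D k) < ord_along C V D b s"
  shows "s \<in> van C V (D (Suc k))"
proof -
  obtain M where M: "ord_along C V D b s = size (D M)" "s \<in> van C V (D M)"
    using ord_along_attained[OF assms(1)] .
  then have "Suc k \<le> M" using assms(2) size_D_mono by (metis not_less not_less_eq_eq)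
  then show ?thesis using M(2) van_antimono by blast
qed

text \<open>Converts the numerical data of the sequence into the dimension of a space of sections.
  Finite dimension enters through the monotonicity of \<open>d\<close>.\<close>

lemma card_mvseq_greater:
  assumes F: "finite F" "V \<subseteq> sect.span F"
    and len: "length (mvseq C V D b) = sect.dim V" and j: "j \<le> b" "crit D j"
  shows "card {l. l < sect.dim V \<and> size (D j) < mvseq C V D b ! l} = sect.dim (van C V (D (Suc j)))"
proof -
  define d where "d i = sect.dim (van C V (D i))" for i
  have anti: "antimono d"
  proof
    fix i j :: nat assume "i \<le> j"
    then show "d j \<le> d i" unfolding d_def
      using van_antimono van_subset F by (intro sect_space.dim_le_of_subset[of _ _ F]) blast+
  qed
  let ?A = "{i. i \<le> b \<and> crit D i}"
  let ?M = "\<Sum>i\<in>?A. replicate_mset (d i - d (Suc i)) (size (D i))"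
  have M: "mset (mvseq C V D b) = ?M"
    by (simp add: mvseq_def d_def)
  have filt: "size (filter_mset p ?M) = (\<Sum>i<Suc b. if p (size (D i)) then d i - d (Suc i) else 0)" for p
  proof -
    have "size (filter_mset p ?M) = (\<Sum>i\<in>?A. if p (size (D i)) then d i - d (Suc i) else 0)"
      by (intro size_filter_mset_sum_replicate) simp
    \<comment> \<open>Noncritical steps contribute no jump, so the sum may run over all
      \<open>i \<le> b\<close> and can telescope.\<close>
    also have "\<dots> = (\<Sum>i<Suc b. if p (size (D i)) then d i - d (Suc i) else 0)"
      by (intro sum.mono_neutral_left) (auto simp: crit_def d_def)
    finally show ?thesis .
  qed
  have "d 0 = sect.dim V" by (simp add: d_def van_0)
  moreover have "length (mvseq C V D b) = d 0 - d (Suc b)"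
  proof -
    have "length (mvseq C V D b) = size (filter_mset (\<lambda>_. True) ?M)" using M by (metis filter_mset_True size_mset)
    also have "\<dots> = (\<Sum>i\<in>{0..<Suc b}. d i - d (Suc i))" unfolding filt by (simp add: atLeast0LessThan)
    also have "\<dots> = d 0 - d (Suc b)" by (intro sum_diff_telescope_nat anti) simp
    finally show ?thesis .
  qed
  moreover have "d (Suc b) \<le> d 0" using anti by (simp add: antimono_def)
  \<comment> \<open>The jumps already use up all of \<open>dim V\<close>, so no nonzero section
    vanishes along \<open>D (Suc b)\<close>.\<close>
  ultimately have last: "d (Suc b) = 0" using len by linarith
  \<comment> \<open>Criticality of \<open>j\<close> makes the degree grow right after
    \<open>j\<close>, so comparing degrees with that of \<open>D j\<close> is comparing
    indices.\<close>
  have less_iff: "size (D j) < size (D i) \<longleftrightarrow> j < i" for i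
    using size_D_less[OF j(2)] size_D_mono[of i j] by (meson leD not_less)
  have "card {l. l < length (mvseq C V D b) \<and> size (D j) < mvseq C V D b ! l} =
      length (filter (\<lambda>a. size (D j) < a) (mvseq C V D b))"
    by (simp add: length_filter_conv_card)
  also have "\<dots> = size (filter_mset (\<lambda>a. size (D j) < a) ?M)"
    by (metis M mset_filter size_mset)
  also have "\<dots> = (\<Sum>i<Suc b. if j < i then d i - d (Suc i) else 0)"
    unfolding filt less_iff ..
  also have "\<dots> = (\<Sum>i\<in>{Suc j..<Suc b}. d i - d (Suc i))"
    by (intro sum.mono_neutral_cong_right) auto
  also have "\<dots> = d (Suc j) - d (Suc b)"
    using j(1) by (intro sum_diff_telescope_nat anti) simp
  finally show ?thesis using len last by (simp add: d_def)
qed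

text \<open>\<open>\<Lambda>\<close> may be a proper part of the indices of order
  \<open>deg D_j\<close>, because the number \<open>g_j\<close> also restricts the other end. A
  relation among evaluations lifts to a section in the next space, hence to a relation between basis
  sections of order \<open>deg D_j\<close> and those of larger order.\<close>

lemma independent_eval_map:
  assumes basis: "is_basis r V s" and dim: "sect.dim V = r + 1"
    and len: "length (mvseq C V D b) = r + 1"
    and ord: "\<forall>l\<le>r. ord_along C V D b (s l) = mvseq C V D b ! l"
    and j: "j \<le> b" "crit D j"
    and \<Lambda>: "\<Lambda> \<subseteq> {l. l \<le> r \<and> mvseq C V D b ! l = size (D j)}"
  shows "inj_on (\<lambda>l. eval_map C P (D j) (T j) (s l)) \<Lambda>"
    and "vec.independent ((\<lambda>l. eval_map C P (D j) (T j) (s l)) ` \<Lambda>)"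
proof -
  let ?B = "{l. l \<le> r \<and> size (D j) < mvseq C V D b ! l}"
  have s: "inj_on s {..r}" "sect.independent (s ` {..r})" "sect.span (s ` {..r}) = V"
    using basis by (simp_all add: is_basis_def)
  have sV: "s l \<in> V" if "l \<le> r" for l using s(3) that sect.span_base[of "s l" "s ` {..r}"] by auto
  have fin: "finite \<Lambda>" using \<Lambda> by (rule finite_subset) simp
  have sj: "s l \<in> van C V (D j)" if "l \<in> \<Lambda>" for l
    using van_if_ord_along[of "s l" b j] sV ord \<Lambda> that by auto
  have B_van: "s ` ?B \<subseteq> van C V (D (Suc j))"
    using van_Suc_if_less_ord_along[of _ j b] sV ord by auto
  have "sect.dim (sect.span (s ` ?B)) = card (s ` ?B)"
    using s(2) by (intro sect.dim_span_eq_card_independent) (rule sect.independent_mono, auto)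
  also have "\<dots> = card ?B" using s(1) by (intro card_image inj_on_subset[OF s(1)]) auto
  also have "\<dots> = card {l. l < sect.dim V \<and> size (D j) < mvseq C V D b ! l}"
    using dim by (simp add: less_Suc_eq_le)
  also have "\<dots> = sect.dim (van C V (D (Suc j)))"
    using s(3) len dim j by (intro card_mvseq_greater[of "s ` {..r}"]) auto
  \<comment> \<open>The sections indexed by \<open>?B\<close> lie in this space, are independent and
    match its dimension.\<close>
  finally have span_B: "sect.span (s ` ?B) = van C V (D (Suc j))"
    using B_van s(3) van_subset subspace_van
    by (intro sect_space.subspace_eq_of_dim_eq[where F = "s ` {..r}"] sect.span_minimal) auto
  have indep: "c l = 0"
    if sum0: "(\<Sum>l\<in>\<Lambda>. (\<lambda>e. c l * eval_map C P (D j) (T j) (s l) e)) = 0" and l: "l \<in> \<Lambda>" for c l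
  proof (rule ccontr)
    assume c: "c l \<noteq> 0"
    \<comment> \<open>\<open>?Q\<close> is spanned by all basis sections except \<open>s l\<close>;
      a nonzero \<open>c l\<close> would express \<open>s l\<close> through them.\<close>
    let ?u = "\<Sum>l\<in>\<Lambda>. (\<lambda>x z. c l * s l x z)" and ?Q = "sect.span (s ` {..r} - {s l})"
    have l': "l \<le> r" "l \<notin> ?B" using l \<Lambda> by auto
    have Q: "s m \<in> ?Q" if "m \<le> r" "m \<noteq> l" for m
      using that s(1) l'(1) by (intro sect.span_base) (auto dest: inj_onD)
    have "?u \<in> van C V (D j)"
      using sj sect.subspace_scale[OF subspace_van] by (intro sect.subspace_sum[OF subspace_van]) blast
    moreover have "eval_map C P (D j) (T j) ?u = 0"
      using eval_map_sum[OF fin sj] sum0 by simp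
    ultimately have "?u \<in> sect.span (s ` ?B)" using van_Suc_if_eval_zero span_B by blast
    moreover have "sect.span (s ` ?B) \<subseteq> ?Q"
      using Q l'(2) by (intro sect.span_minimal sect.subspace_span) auto
    ultimately have u: "?u \<in> ?Q" by blast
    have rest: "(\<Sum>m\<in>\<Lambda> - {l}. (\<lambda>x z. c m * s m x z)) \<in> ?Q"
      using Q \<Lambda> by (intro sect.span_sum sect.span_scale) auto
    have "?u = (\<lambda>x z. c l * s l x z) + (\<Sum>m\<in>\<Lambda> - {l}. (\<lambda>x z. c m * s m x z))"
      using fin l by (rule sum.remove)
    then have "(\<lambda>x z. c l * s l x z) \<in> ?Q" using sect.span_diff[OF u rest] by simp
    then have "(\<lambda>x z. inverse (c l) * (c l * s l x z)) \<in> ?Q" by (rule sect.span_scale)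
    then have "s l \<in> ?Q" using c by simp
    then show False using s(2) l'(1) unfolding sect.dependent_def by blast
  qed
  show "inj_on (\<lambda>l. eval_map C P (D j) (T j) (s l)) \<Lambda>"
    by (rule vec_space.independent_family(1)[OF fin]) (erule (1) indep)
  show "vec.independent ((\<lambda>l. eval_map C P (D j) (T j) (s l)) ` \<Lambda>)"
    by (rule vec_space.independent_family(2)[OF fin]) (erule (1) indep)
qed

end

section \<open>Transport of sections\<close>

lemma line_bundle_chart:
  assumes "line_bundle X L" "x \<in> topspace (ftop X)"
  shows "openin (ftop X) (chart L x)" "x \<in> chart L x"
  using assms by (simp_all add: line_bundle_def)

lemma gsectD:
  assumes "s \<in> gsect X L"
  shows "x \<in> topspace (ftop X) \<Longrightarrow> s x \<in> freg X (chart L x)"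
    and "x \<in> topspace (ftop X) \<Longrightarrow> y \<in> topspace (ftop X) \<Longrightarrow> z \<in> chart L x \<inter> chart L y \<Longrightarrow>
      s x z = cocycle L x y z * s y z"
    and "x \<notin> topspace (ftop X) \<or> z \<notin> chart L x \<Longrightarrow> s x z = 0"
  using assms unfolding gsect_def mem_Collect_eq by - (elim conjE, blast)+

text \<open>The cocycle recovers \<open>s x z\<close> from \<open>s z z\<close>, and
  \<open>gsect\<close> fixes the value 0 elsewhere.\<close>

lemma gsect_eqI:
  assumes L: "line_bundle X L" and st: "s \<in> gsect X L" "t \<in> gsect X L"
    and eq: "\<And>x. x \<in> topspace (ftop X) \<Longrightarrow> s x x = t x x"
  shows "s = t"
proof (intro ext)
  fix x z
  show "s x z = t x z"
  proof (cases "x \<in> topspace (ftop X) \<and> z \<in> chart L x")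
    case True
    then have z: "z \<in> topspace (ftop X)"
      using openin_subset[OF line_bundle_chart(1)[OF L]] by blast
    then have zz: "z \<in> chart L x \<inter> chart L z" using line_bundle_chart(2)[OF L] True by blast
    have "s x z = cocycle L x z z * s z z" "t x z = cocycle L x z z * t z z"
      using gsectD(2)[OF st(1) _ z zz] gsectD(2)[OF st(2) _ z zz] True by blast+
    then show ?thesis using eq[OF z] by simp
  next
    case False
    then show ?thesis using gsectD(3)[OF st(1), of x z] gsectD(3)[OF st(2), of x z] by auto
  qed
qed

lemma gsect_germs:
  assumes "line_bundle X L" "s \<in> gsect X L" "x \<in> topspace (ftop X)"
  shows "s x \<in> germs X x"
proof -
  have "freg X (chart L x) \<subseteq> germs X x"
    using line_bundle_chart[OF assms(1,3)] unfolding germs_def by blast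
  then show ?thesis using gsectD(1)[OF assms(2,3)] by blast
qed

text \<open>The subspace and dimension conditions on \<open>transported\<close> will come from the
  pre-limit condition contained in the limit series. They take the place of a construction of
  pulled-back sections.\<close>

locale section_transport =
  fixes Y :: "('y, 'k::field) fspace" and X :: "('x, 'k) fspace" and \<pi> :: "'y \<Rightarrow> 'x"
    and L :: "('y, 'k) lbundle" and M :: "('x, 'k) lbundle" and h :: "'y \<Rightarrow> 'y \<Rightarrow> 'k"
    and V :: "('x \<Rightarrow> 'x \<Rightarrow> 'k) set"
  assumes iso: "fspace_iso Y X \<pi>" and L: "line_bundle Y L" and M: "line_bundle X M"
    and h: "bundle_iso Y L (lb_pullback \<pi> (topspace (ftop Y)) M) h"
    and subspace_V: "sect.subspace V" and V_gsect: "V \<subseteq> gsect X M"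
    and subspace_transported: "sect.subspace (transported Y L \<pi> M h V)"
    and dim_transported: "sect.dim (transported Y L \<pi> M h V) = sect.dim V"
    and dim_V: "0 < sect.dim V"
begin

abbreviation "V' \<equiv> transported Y L \<pi> M h V"
abbreviation "\<rho> \<equiv> inv_into (topspace (ftop Y)) \<pi>"

text \<open>\<open>transported\<close> yields only the existence of a corresponding section; this
  explicit formula is linear on all functions. The value at \<open>q\<close> is read in the fibre at
  \<open>\<rho> q\<close>, moved by \<open>h\<close>, and carried by the cocycle from the chart at
  \<open>q\<close> to that at \<open>p\<close>.\<close>

definition push :: "('y \<Rightarrow> 'y \<Rightarrow> 'k) \<Rightarrow> 'x \<Rightarrow> 'x \<Rightarrow> 'k" where
  "push s p q = (if p \<in> topspace (ftop X) \<and> q \<in> chart M p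
     then cocycle M p q q * (h (\<rho> q) (\<rho> q) * s (\<rho> q) (\<rho> q)) else 0)"

lemma linear_push:
  "Vector_Spaces.linear (\<lambda>(c::'k) (s :: 'y \<Rightarrow> 'y \<Rightarrow> 'k) x z. c * s x z)
     (\<lambda>(c::'k) (s :: 'x \<Rightarrow> 'x \<Rightarrow> 'k) x z. c * s x z) push"
  by (auto simp: Vector_Spaces.linear_iff sect.vector_space_axioms push_def fun_eq_iff algebra_simps)

lemma homeomorphic: "homeomorphic_map (ftop Y) (ftop X) \<pi>"
  using iso by (simp add: fspace_iso_def)

lemma image_topspace: "\<pi> ` topspace (ftop Y) = topspace (ftop X)"
  using homeomorphic by (rule homeomorphic_imp_surjective_map)

lemma domain:
  assumes "x \<in> topspace (ftop Y)"
  shows "openin (ftop Y) (chart L x \<inter> {z \<in> topspace (ftop Y). \<pi> z \<in> chart M (\<pi> x)})"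
    and "x \<in> chart L x \<inter> {z \<in> topspace (ftop Y). \<pi> z \<in> chart M (\<pi> x)}"
proof -
  have x: "\<pi> x \<in> topspace (ftop X)" using assms image_topspace by blast
  then have "openin (ftop X) (chart M (\<pi> x))" "\<pi> x \<in> chart M (\<pi> x)"
    "openin (ftop Y) (chart L x)" "x \<in> chart L x"
    using line_bundle_chart[OF L assms] line_bundle_chart[OF M] by auto
  moreover have "continuous_map (ftop Y) (ftop X) \<pi>"
    using homeomorphic by (rule homeomorphic_imp_continuous_map)
  ultimately show "openin (ftop Y) (chart L x \<inter> {z \<in> topspace (ftop Y). \<pi> z \<in> chart M (\<pi> x)})"
    "x \<in> chart L x \<inter> {z \<in> topspace (ftop Y). \<pi> z \<in> chart M (\<pi> x)}"
    using assms openin_continuous_map_preimage by (blast intro: openin_Int)+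
qed

lemma h_properties:
  assumes "x \<in> topspace (ftop Y)"
  shows "h x \<in> germs Y x" "h x x \<noteq> 0"
proof -
  have "h x \<in> freg Y (chart L x \<inter> {z \<in> topspace (ftop Y). \<pi> z \<in> chart M (\<pi> x)})"
    "\<forall>z\<in>chart L x \<inter> {z \<in> topspace (ftop Y). \<pi> z \<in> chart M (\<pi> x)}. h x z \<noteq> 0"
    using h assms by (simp_all add: bundle_iso_def lb_pullback_def)
  then show "h x \<in> germs Y x" "h x x \<noteq> 0" using domain[OF assms] unfolding germs_def by blast+
qed

lemma push_transported:
  assumes s: "s \<in> V'"
  shows "push s \<in> V"
    and "\<And>x z. x \<in> topspace (ftop Y) \<Longrightarrow> z \<in> chart L x \<inter> {z \<in> topspace (ftop Y). \<pi> z \<in> chart M (\<pi> x)} \<Longrightarrow>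
      push s (\<pi> x) (\<pi> z) = h x z * s x z"
proof -
  obtain s' where s': "s' \<in> V"
    "\<And>x z. x \<in> topspace (ftop Y) \<Longrightarrow> z \<in> chart L x \<inter> {z \<in> topspace (ftop Y). \<pi> z \<in> chart M (\<pi> x)} \<Longrightarrow>
      s' (\<pi> x) (\<pi> z) = h x z * s x z"
    using s by (auto simp: transported_def lb_pullback_def)
  have g: "s' \<in> gsect X M" using s'(1) V_gsect by blast
  \<comment> \<open>The witness \<open>s'\<close> is forced: on the diagonal by \<open>h\<close>,
    off the diagonal by its cocycle, and outside the charts by normalisation.\<close>
  have "push s p q = s' p q" for p q
  proof (cases "p \<in> topspace (ftop X) \<and> q \<in> chart M p")
    case True
    then have q: "q \<in> topspace (ftop X)"
      using openin_subset[OF line_bundle_chart(1)[OF M]] by blast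
    then have "q \<in> chart M p \<inter> chart M q" using line_bundle_chart(2)[OF M] True by blast
    then have "s' p q = cocycle M p q q * s' q q"
      using gsectD(2)[OF g _ q] True by blast
    moreover have "\<rho> q \<in> topspace (ftop Y)" "\<pi> (\<rho> q) = q"
      using q image_topspace by (auto intro: inv_into_into f_inv_into_f)
    then have "s' q q = h (\<rho> q) (\<rho> q) * s (\<rho> q) (\<rho> q)"
      using s'(2)[of "\<rho> q" "\<rho> q"] domain(2)[of "\<rho> q"] by simp
    ultimately show ?thesis using True by (simp add: push_def)
  next
    case False
    then show ?thesis using gsectD(3)[OF g, of p q] unfolding push_def by auto
  qed
  then have "push s = s'" by (intro ext)
  then show "push s \<in> V" "\<And>x z. x \<in> topspace (ftop Y) \<Longrightarrow>
      z \<in> chart L x \<inter> {z \<in> topspace (ftop Y). \<pi> z \<in> chart M (\<pi> x)} \<Longrightarrow> push s (\<pi> x) (\<pi> z) = h x z * s x z"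
    using s' by auto
qed

lemma inj_on_push: "inj_on push V'"
proof (rule inj_onI)
  fix s t assume st: "s \<in> V'" "t \<in> V'" "push s = push t"
  show "s = t"
  proof (rule gsect_eqI[OF L])
    show "s \<in> gsect Y L" "t \<in> gsect Y L" using st by (auto simp: transported_def)
    fix x assume x: "x \<in> topspace (ftop Y)"
    have "h x x * s x x = h x x * t x x"
      using push_transported(2)[OF st(1) x domain(2)[OF x]] push_transported(2)[OF st(2) x domain(2)[OF x]]
        st(3) by metis
    then show "s x x = t x x" using h_properties(2)[OF x] by simp
  qed
qed

text \<open>Surjectivity is a dimension count inside the finite-dimensional space
  \<open>V\<close>.\<close>

lemma image_push: "push ` V' = V"
proof -
  obtain F where "finite F" "V \<subseteq> sect.span F"
    using dim_V by (rule sect_space.finite_spanning_if_dim_pos)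
  moreover have "sect.subspace (push ` V')"
    by (rule sect_pair.linear_subspace_image[OF linear_push subspace_transported])
  moreover have "sect.dim (push ` V') = sect.dim V"
    using sect_pair.dim_image_inj[OF linear_push subspace_transported inj_on_push] dim_transported by simp
  ultimately show ?thesis
    using push_transported(1) subspace_V
    by (intro sect_space.subspace_eq_of_dim_eq[where F = F]) auto
qed

lemma near_push:
  assumes "s \<in> V'" "x \<in> topspace (ftop Y)"
  shows "\<forall>\<^sub>F z in nhdsin (ftop Y) x. push s (\<pi> x) (\<pi> z) = h x z * s x z"
  using domain[OF assms(2)] push_transported(2)[OF assms] unfolding eventually_nhdsin by blast

end

section \<open>Corresponding divisor chains on two curves\<close>

locale divisor_chain_transport =
  section_transport Y X \<pi> L M h V +
  Y: divisor_chain Y E Q T "transported Y L \<pi> M h V" DY + X: divisor_chain X E P T V DX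
  for Y :: "('y, 'k::field) fspace" and X :: "('x, 'k) fspace" and \<pi> L M h V
    and E :: "'e set" and Q P T DY DX +
  assumes P_eq: "e \<in> E \<Longrightarrow> P e = \<pi> (Q e)"
begin

lemma smooth_point_iso: "e \<in> E \<Longrightarrow> smooth_point_iso Y (Q e) X \<pi>"
  using Y.smooth_P[of e] X.smooth_P[of e] iso
  by (simp add: P_eq smooth_point_iso_def smooth_point_iso_axioms_def)

lemma Q_topspace: "e \<in> E \<Longrightarrow> Q e \<in> topspace (ftop Y)"
  using Y.smooth_P smooth_point.axioms(1) pointed_fspace.pt by metis

lemma transport_at:
  assumes e: "e \<in> E"
  obtains c where "c \<noteq> 0"
    "\<forall>s\<in>V'. (vanishes_to X (P e) m (push s (P e)) \<longleftrightarrow> vanishes_to Y (Q e) m (s (Q e))) \<and>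
       (vanishes_to Y (Q e) m (s (Q e)) \<longrightarrow>
         lead_val X (P e) m (push s (P e)) = c * lead_val Y (Q e) m (s (Q e)))"
proof -
  note Q = Q_topspace[OF e]
  obtain c where c: "c \<noteq> 0"
    "\<forall>s s'. (\<forall>\<^sub>F z in nhdsin (ftop Y) (Q e). s' (\<pi> z) = h (Q e) z * s z) \<longrightarrow>
       (vanishes_to X (\<pi> (Q e)) m s' \<longleftrightarrow> vanishes_to Y (Q e) m s) \<and>
       (vanishes_to Y (Q e) m s \<longrightarrow> lead_val X (\<pi> (Q e)) m s' = c * lead_val Y (Q e) m s)"
    by (rule smooth_point_iso.transport_section[OF smooth_point_iso[OF e] h_properties[OF Q], where m = m])
  show thesis
  proof (rule that[OF c(1)], rule ballI)
    fix s assume "s \<in> V'"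
    from c(2)[rule_format, OF near_push[OF this Q]]
    show "(vanishes_to X (P e) m (push s (P e)) \<longleftrightarrow> vanishes_to Y (Q e) m (s (Q e))) \<and>
       (vanishes_to Y (Q e) m (s (Q e)) \<longrightarrow>
         lead_val X (P e) m (push s (P e)) = c * lead_val Y (Q e) m (s (Q e)))"
      by (simp add: P_eq[OF e])
  qed
qed

lemma van_push: "s \<in> V' \<Longrightarrow> push s \<in> van X V (DX i) \<longleftrightarrow> s \<in> van Y V' (DY i)"
proof -
  assume s: "s \<in> V'"
  have "vanishes_to X (P e) m (push s (P e)) \<longleftrightarrow> vanishes_to Y (Q e) m (s (Q e))"
    if "e \<in> E" for e m
    by (rule transport_at[OF that, of m]) (use s in blast)
  then show ?thesis unfolding X.van_iff Y.van_iff using s push_transported(1)[OF s] by simp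
qed

lemma image_van: "push ` van Y V' (DY i) = van X V (DX i)"
proof
  show "push ` van Y V' (DY i) \<subseteq> van X V (DX i)"
    using van_push Y.van_subset[of i] by blast
  show "van X V (DX i) \<subseteq> push ` van Y V' (DY i)"
  proof
    fix t assume t: "t \<in> van X V (DX i)"
    then have "t \<in> push ` V'" using X.van_subset[of i] image_push by blast
    then obtain s where "s \<in> V'" "t = push s" by blast
    then show "t \<in> push ` van Y V' (DY i)" using van_push t by blast
  qed
qed

lemma mvseq_eq: "mvseq X V DX b = mvseq Y V' DY b"
proof -
  have "sect.dim (van X V (DX i)) = sect.dim (van Y V' (DY i))" for i
    using sect_pair.dim_image_inj[OF linear_push Y.subspace_van inj_on_subset[OF inj_on_push Y.van_subset]]
    by (simp add: image_van)
  then show ?thesis by (simp add: mvseq_def X.crit_iff Y.crit_iff X.size_D Y.size_D)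
qed

lemma eval_map_push:
  obtains c where "\<forall>e. c e \<noteq> 0"
    "\<forall>s\<in>van Y V' (DY i).
       eval_map X P (DX i) (T i) (push s) = rescale c (eval_map Y Q (DY i) (T i) s)"
proof -
  \<comment> \<open>The condition is vacuous outside \<open>E\<close>, so that the chosen scalars
    form a total, nowhere vanishing function.\<close>
  have "\<exists>c. c \<noteq> 0 \<and> (e \<in> E \<longrightarrow> (\<forall>s\<in>van Y V' (DY i).
      lead_val X (P e) (count (DX i) (P e)) (push s (P e)) =
      c * lead_val Y (Q e) (count (DY i) (Q e)) (s (Q e))))" for e
  proof (cases "e \<in> E")
    case True
    obtain c where "c \<noteq> 0" and "\<forall>s\<in>V'.
       (vanishes_to X (P e) (card {k. k < i \<and> e \<in> T k}) (push s (P e)) \<longleftrightarrow>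
         vanishes_to Y (Q e) (card {k. k < i \<and> e \<in> T k}) (s (Q e))) \<and>
       (vanishes_to Y (Q e) (card {k. k < i \<and> e \<in> T k}) (s (Q e)) \<longrightarrow>
         lead_val X (P e) (card {k. k < i \<and> e \<in> T k}) (push s (P e)) =
         c * lead_val Y (Q e) (card {k. k < i \<and> e \<in> T k}) (s (Q e)))"
      by (rule transport_at[OF True])
    then show ?thesis using True
      by (intro exI[of _ c]) (simp add: X.count_D Y.count_D Y.van_iff)
  qed (auto intro: exI[of _ 1])
  then obtain c where c: "\<And>e. c e \<noteq> 0" "\<And>e s. e \<in> E \<Longrightarrow> s \<in> van Y V' (DY i) \<Longrightarrow>
      lead_val X (P e) (count (DX i) (P e)) (push s (P e)) =
      c e * lead_val Y (Q e) (count (DY i) (Q e)) (s (Q e))"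
    by (metis (no_types))
  show thesis
    by (rule that[of c]) (auto simp: eval_map_def rescale_def fun_eq_iff c subsetD[OF X.T_subset])
qed

end

section \<open>Twists and glueing isomorphisms\<close>

lemma orient_other:
  assumes "loopfree_digraph G" "e \<in> between G v v'"
  shows "orient G e v = - orient G e v'"
proof -
  have "tail G e \<noteq> head G e"
    using assms by (auto simp: between_def loopfree_digraph_def loopfree_digraph_axioms_def)
  then show ?thesis using assms(2) by (auto simp: between_def orient_def doubleton_eq_iff)
qed

lemma cong_cpos_edge_twist:
  assumes "e \<in> between G v v'"
  shows "[cpos ((edge_twist G n v v' ^^ k) u) e = cpos u e + int k * orient G e v] (mod int (n e))"
proof (induction k)
  case (Suc k)
  have "[cpos ((edge_twist G n v v' ^^ Suc k) u) e =
      cpos ((edge_twist G n v v' ^^ k) u) e + orient G e v] (mod int (n e))"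
    using assms by (simp add: edge_twist_def twist_on_def cong_def)
  also have "[cpos ((edge_twist G n v v' ^^ k) u) e + orient G e v =
      cpos u e + int k * orient G e v + orient G e v] (mod int (n e))"
    using Suc by (rule cong_add) simp
  finally show ?case by (simp add: algebra_simps)
qed simp

lemma between_commute: "between G v v' = between G v' v"
  by (auto simp: between_def)

text \<open>Going from \<open>w v'\<close> to \<open>w v\<close> moves the position on
  \<open>e\<close> by \<open>b v v'\<close> steps away from \<open>v'\<close>, while the orientation
  signs at the two ends are opposite. Hence step \<open>j\<close> seen from \<open>v\<close> is step
  \<open>b v v' - j\<close> seen from \<open>v'\<close>.\<close>

lemma twist_support_reverse:
  assumes loopfree: "loopfree_digraph G" and tight: "tight G n w b"
    and adj: "adjacent G v v'" and j: "j \<le> b v v'"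
  shows "twist_support G n w v' v (b v v' - j) = twist_support G n w v v' j"
proof -
  have "[orient G e v' * cpos (w v') e = - int (b v v' - j)] (mod int (n e)) \<longleftrightarrow>
      [orient G e v * cpos (w v) e = - int j] (mod int (n e))" if e: "e \<in> between G v v'" for e
  proof -
    let ?o = "orient G e v'"
    have o: "orient G e v = - ?o" "?o * ?o = 1"
      using orient_other[OF loopfree e] by (auto simp: orient_def)
    have "[cpos (w v) e = cpos (w v') e + int (b v v') * ?o] (mod int (n e))"
      using tight adj e cong_cpos_edge_twist[of e G v' v "b v v'" n "w v'"]
      by (simp add: tight_def between_commute[of G v])
    then have "[- ?o * cpos (w v) e = - ?o * (cpos (w v') e + int (b v v') * ?o)] (mod int (n e))"
      by (rule cong_scalar_left)
    also have "- ?o * (cpos (w v') e + int (b v v') * ?o) = - (?o * cpos (w v') e) - int (b v v')"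
      using o(2) by (simp add: algebra_simps)
    finally have "[orient G e v * cpos (w v) e = - (?o * cpos (w v') e) - int (b v v')] (mod int (n e))"
      using o(1) by simp
    then have "[orient G e v * cpos (w v) e = - int j] (mod int (n e)) \<longleftrightarrow>
        [- (?o * cpos (w v') e) - int (b v v') = - int j] (mod int (n e))"
      by (meson cong_sym cong_trans)
    also have "\<dots> \<longleftrightarrow> int (n e) dvd ?o * cpos (w v') e + (int (b v v') - int j)"
    proof -
      have "- (?o * cpos (w v') e) - int (b v v') - - int j =
          - (?o * cpos (w v') e + (int (b v v') - int j))" by simp
      then show ?thesis by (simp only: cong_iff_dvd_diff dvd_minus_iff)
    qed
    \<comment> \<open>The bound \<open>j \<le> b v v'\<close> makes the natural subtraction
      exact.\<close>
    also have "\<dots> \<longleftrightarrow> [?o * cpos (w v') e = - int (b v v' - j)] (mod int (n e))"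
      using j by (simp add: cong_iff_dvd_diff of_nat_diff algebra_simps)
    finally show ?thesis by blast
  qed
  then show ?thesis by (auto simp: twist_support_def between_commute[of G v'])
qed

text \<open>The function \<open>f\<close> in \<open>lb_of_mdeg\<close> is an arbitrary choice, but
  charts of a twist are intersections whatever the exponents are.\<close>

lemma chart_lb_of_mdeg:
  assumes "line_bundle X L" "\<forall>u\<in>verts (subdiv G n). line_bundle X (N u)" "x \<in> topspace (ftop X)"
  shows "x \<in> chart (lb_of_mdeg G n N w0 L m) x"
  using assms by (auto simp: lb_of_mdeg_def lb_twist_def line_bundle_def Let_def)

text \<open>The defining equation of \<open>\<phi>\<close> at \<open>e\<close> involves only the
  coordinate at \<open>e\<close>, with nonzero factors. Agreement with \<open>rescale k\<close> is
  restricted to vectors supported on \<open>S\<close>, as \<open>\<phi>\<close> gives 0 outside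
  \<open>S\<close> while \<open>k\<close> is 1 there.\<close>

lemma glueing_iso_diagonal:
  fixes \<phi> :: "('e \<Rightarrow> 'k::field) \<Rightarrow> 'e \<Rightarrow> 'k"
  assumes S: "S = twist_support G n w v v' i"
    and glue: "glueing_iso G n w b X Z nd Lw v v' i \<phi>"
    and chart: "\<And>m x. x \<in> topspace (ftop X) \<Longrightarrow> x \<in> chart (Lw m) x"
    and ends: "\<And>e. e \<in> S \<Longrightarrow> end_node G n nd e v \<in> topspace (ftop X) \<inter> Z (Vtx v) \<inter> inserted_chain n Z nd e"
      "\<And>e. e \<in> S \<Longrightarrow> end_node G n nd e v' \<in> topspace (ftop X) \<inter> Z (Vtx v') \<inter> inserted_chain n Z nd e"
  obtains k where "\<forall>e. k e \<noteq> 0" "\<forall>x. (\<forall>e. e \<notin> S \<longrightarrow> x e = 0) \<longrightarrow> \<phi> x = rescale k x"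
proof -
  define Li where "Li = Lw ((edge_twist G n v v' ^^ i) (w v))"
  obtain M M' \<alpha> \<beta> \<tau> where
    M: "line_bundle (subsp X (Z (Vtx v))) M" "line_bundle (subsp X (Z (Vtx v'))) M'" and
    \<alpha>: "bundle_iso (subsp X (Z (Vtx v))) (lb_restr Li (Z (Vtx v)))
          (lb_tensor (lb_restr (Lw (w v)) (Z (Vtx v))) M) \<alpha>" and
    \<beta>: "bundle_iso (subsp X (Z (Vtx v'))) (lb_restr Li (Z (Vtx v')))
          (lb_tensor (lb_restr (Lw (w v')) (Z (Vtx v'))) M') \<beta>" and
    \<tau>: "\<And>e. e \<in> S \<Longrightarrow> bundle_iso (subsp X (inserted_chain n Z nd e)) (lb_restr Li (inserted_chain n Z nd e))
          (lb_trivial (subsp X (inserted_chain n Z nd e))) (\<tau> e)" and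
    \<phi>: "\<And>e x. e \<in> S \<Longrightarrow> \<tau> e (end_node G n nd e v') (end_node G n nd e v') *
            (\<phi> x e / \<beta> (end_node G n nd e v') (end_node G n nd e v')) =
          \<tau> e (end_node G n nd e v) (end_node G n nd e v) *
            (x e / \<alpha> (end_node G n nd e v) (end_node G n nd e v))" and
    \<phi>0: "\<And>e x. e \<notin> S \<Longrightarrow> \<phi> x e = 0"
    using glue unfolding glueing_iso_def Let_def div_bundle_def S[symmetric] Li_def[symmetric] by metis
  define P where "P e = end_node G n nd e v" for e
  define P' where "P' e = end_node G n nd e v'" for e
  have top: "topspace (ftop (subsp X A)) = topspace (ftop X) \<inter> A" for A
    by (simp add: subsp_def)
  \<comment> \<open>A bundle isomorphism is nonzero on common charts, and the chart at an end node
    contains that node for every bundle involved.\<close>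
  have nz: "\<alpha> (P e) (P e) \<noteq> 0" "\<beta> (P' e) (P' e) \<noteq> 0" "\<tau> e (P e) (P e) \<noteq> 0" "\<tau> e (P' e) (P' e) \<noteq> 0"
    if e: "e \<in> S" for e
  proof -
    note P = ends(1)[OF e, folded P_def] and P' = ends(2)[OF e, folded P'_def]
    have c: "P e \<in> chart (Lw m) (P e)" "P' e \<in> chart (Lw m) (P' e)" for m
      using chart P P' by auto
    have "P e \<in> chart M (P e)" "P' e \<in> chart M' (P' e)"
      using line_bundle_chart(2)[OF M(1)] line_bundle_chart(2)[OF M(2)] P P' unfolding top by blast+
    then show "\<alpha> (P e) (P e) \<noteq> 0" "\<beta> (P' e) (P' e) \<noteq> 0"
      using \<alpha> \<beta> c P P' unfolding bundle_iso_def top lb_restr_def lb_tensor_def Li_def by auto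
    show "\<tau> e (P e) (P e) \<noteq> 0" "\<tau> e (P' e) (P' e) \<noteq> 0"
      using \<tau>[OF e] c P P' unfolding bundle_iso_def lb_trivial_def lb_restr_def Li_def
      by (auto simp: top)
  qed
  define k where "k e = (if e \<in> S
    then \<beta> (P' e) (P' e) * \<tau> e (P e) (P e) / (\<tau> e (P' e) (P' e) * \<alpha> (P e) (P e)) else 1)" for e
  show thesis
  proof (rule that; (intro allI impI)?)
    show "k e \<noteq> 0" for e using nz by (simp add: k_def)
    fix x :: "'e \<Rightarrow> 'k" assume x: "\<forall>e. e \<notin> S \<longrightarrow> x e = 0"
    have "\<phi> x e = k e * x e" if "e \<in> S" for e
      using \<phi>[OF that, of x, folded P_def P'_def] nz[OF that] that by (simp add: k_def field_simps)
    moreover have "\<phi> x e = k e * x e" if "e \<notin> S" for e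
      using \<phi>0[OF that] x that by simp
    ultimately show "\<phi> x = rescale k x" unfolding rescale_def by (intro ext) blast
  qed
qed

section \<open>Nodes at the ends of the inserted chains\<close>

lemma between_arcs:
  assumes "e \<in> between G v v'"
  shows "e \<in> arcs G" "v = tail G e \<or> v = head G e"
  using assms by (auto simp: between_def doubleton_eq_iff)

lemma irreducible_components_subset: "C \<in> irreducible_components T \<Longrightarrow> C \<subseteq> topspace T"
  by (simp add: irreducible_components_def irreducible_set_def)

lemma end_node_properties:
  assumes ins: "chain_insertion X G Z nd n X' Z' nd' \<pi>" and n: "chain_structure G n"
    and e: "e \<in> arcs G" and v: "v = tail G e \<or> v = head G e" "v \<in> verts G"
  shows "end_node G n nd' e v \<in> Z' (Vtx v)" "end_node G n nd' e v \<in> topspace (ftop X')"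
    "end_node G n nd' e v \<in> inserted_chain n Z' nd' e" "\<pi> (end_node G n nd' e v) = nd e"
proof -
  let ?i = "if v = tail G e then 0 else n e - 1"
  have i: "?i < n e" using n e by (auto simp: chain_structure_def)
  have dual: "dual_graph X' (subdiv G n) Z' nd'" using ins by (simp add: chain_insertion_def)
  have a: "(e, ?i) \<in> arcs (subdiv G n)" using i e by (simp add: subdiv_def)
  have "Vtx v \<in> verts (subdiv G n)" using v(2) by (simp add: subdiv_def)
  \<comment> \<open>The head of the last segment \<open>n e - 1\<close> is at distance
    \<open>n e\<close> from the tail, where \<open>on_edge\<close> returns the vertex
    \<open>head G e\<close>.\<close>
  moreover have "Vtx v = tail (subdiv G n) (e, ?i) \<or> Vtx v = head (subdiv G n) (e, ?i)"
    using v(1) i by (auto simp: subdiv_def on_edge_def)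
  ultimately show "end_node G n nd' e v \<in> Z' (Vtx v)"
    using dual a unfolding dual_graph_def end_node_def by blast
  show "end_node G n nd' e v \<in> topspace (ftop X')"
    using dual a unfolding dual_graph_def end_node_def bij_betw_def by blast
  show "end_node G n nd' e v \<in> inserted_chain n Z' nd' e"
    using i unfolding end_node_def inserted_chain_def by blast
  show "\<pi> (end_node G n nd' e v) = nd e"
    using ins e i unfolding end_node_def chain_insertion_def by blast
qed

lemma inj_on_end_node:
  assumes "chain_insertion X G Z nd n X' Z' nd' \<pi>" "chain_structure G n"
  shows "inj_on (\<lambda>e. end_node G n nd' e v) (arcs G)"
proof (rule inj_onI)
  fix e e' assume e: "e \<in> arcs G" "e' \<in> arcs G" "end_node G n nd' e v = end_node G n nd' e' v"
  have "inj_on nd' (arcs (subdiv G n))"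
    using assms(1) by (simp add: chain_insertion_def dual_graph_def bij_betw_def)
  moreover have "(d, if v = tail G d then 0 else n d - 1) \<in> arcs (subdiv G n)" if "d \<in> arcs G" for d
    using that assms(2) by (auto simp: subdiv_def chain_structure_def)
  ultimately show "e = e'" using e unfolding end_node_def by (blast dest: inj_onD)
qed

theorem proposition3p6:
  fixes X :: "('x, 'k::alg_closed_field) fspace"
    and X' :: "('y, 'k) fspace"
    and G :: "('v, 'e) pre_digraph"
    and Z :: "'v \<Rightarrow> 'x set" and nd :: "'e \<Rightarrow> 'x"
    and Z' :: "('v, 'e) mpoint \<Rightarrow> 'y set" and nd' :: "'e \<times> nat \<Rightarrow> 'y" and \<pi> :: "'y \<Rightarrow> 'x"
    and n :: "'e \<Rightarrow> nat" and d :: int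
    and w0 :: "('v, 'e) mdeg" and w :: "'v \<Rightarrow> ('v, 'e) mdeg" and b :: "'v \<Rightarrow> 'v \<Rightarrow> nat"
    and N :: "('v, 'e) mpoint \<Rightarrow> ('y, 'k) lbundle"
    and r :: nat and L :: "'v \<Rightarrow> ('x, 'k) lbundle" and V :: "'v \<Rightarrow> ('x \<Rightarrow> 'x \<Rightarrow> 'k) set"
  assumes "curve X" and "multitree G" and "dual_graph X G Z nd"
    and "chain_structure G n"
    and "chain_insertion X G Z nd n X' Z' nd' \<pi>"
    and "admissible G n d w0"
    and "\<forall>v\<in>verts G. w v \<in> twist_class G n w0"
    and "tight G n w b"
    and "enriched_structure X' (subdiv G n) Z' N"
    and "prelimit_series G n w b (\<lambda>v. subsp X (Z v)) (\<lambda>e v. nd e) r L V"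
    and "lifts_to_limit_series G n w0 w b X' Z' nd' \<pi> N r L V"
  shows "weak_glueing G n w b (\<lambda>v. subsp X (Z v)) (\<lambda>e v. nd e) r V"
proof -
  note curve = \<open>curve X\<close> and dual = \<open>dual_graph X G Z nd\<close> and chain = \<open>chain_structure G n\<close>
    and ins = \<open>chain_insertion X G Z nd n X' Z' nd' \<pi>\<close> and tight = \<open>tight G n w b\<close>
    and pre = \<open>prelimit_series G n w b (\<lambda>v. subsp X (Z v)) (\<lambda>e v. nd e) r L V\<close>
  have fin: "fin_digraph G" and loopfree: "loopfree_digraph G"
    using \<open>multitree G\<close> by (auto simp: multitree_def)
  have N: "\<forall>u\<in>verts (subdiv G n). line_bundle X' (N u)"
    using \<open>enriched_structure X' (subdiv G n) Z' N\<close> by (simp add: enriched_structure_def)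
  have curve': "curve X'" and dual': "dual_graph X' (subdiv G n) Z' nd'"
    using ins by (simp_all add: chain_insertion_def)
  \<comment> \<open>\<open>C v\<close> and \<open>C' v\<close> are the components at
    \<open>v\<close> of the original and of the blown-up curve; \<open>\<pi>\<close> identifies
    them.\<close>
  define C where "C v = subsp X (Z v)" for v
  define C' where "C' v = subsp X' (Z' (Vtx v))" for v
  obtain \<L> h where iso_h: "\<forall>v\<in>verts G. bundle_iso (C' v)
        (lb_restr (lb_of_mdeg G n N w0 \<L> (w v)) (Z' (Vtx v))) (lb_pullback \<pi> (Z' (Vtx v)) (L v)) (h v)"
    and lim: "limit_series G n w0 w b X' Z' nd' N r \<L> (\<lambda>v. transported (C' v)
        (lb_restr (lb_of_mdeg G n N w0 \<L> (w v)) (Z' (Vtx v))) \<pi> (L v) (h v) (V v))"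
    using \<open>lifts_to_limit_series G n w0 w b X' Z' nd' \<pi> N r L V\<close>
    unfolding lifts_to_limit_series_def Let_def C'_def by blast
  define \<L>v where "\<L>v v = lb_restr (lb_of_mdeg G n N w0 \<L> (w v)) (Z' (Vtx v))" for v
  define V' where "V' v = transported (C' v) (\<L>v v) \<pi> (L v) (h v) (V v)" for v
  note lim = lim[folded \<L>v_def, folded V'_def, unfolded limit_series_def Let_def, folded C'_def \<L>v_def]
  have \<L>: "line_bundle X' \<L>" using lim by blast
  have pre': "prelimit_series G n w b C' (end_node G n nd') r \<L>v V'"
    using lim by (simp add: C'_def[abs_def] \<L>v_def[abs_def])
  have adj_verts: "v \<in> verts G" "v' \<in> verts G" if adj: "adjacent G v v'" for v v'
  proof -
    obtain e where e: "e \<in> arcs G" "{tail G e, head G e} = {v, v'}"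
      using adj by (auto simp: adjacent_def between_def)
    interpret fin_digraph G by (rule fin)
    show "v \<in> verts G" "v' \<in> verts G"
      using e tail_in_verts[OF e(1)] head_in_verts[OF e(1)] by (auto simp: doubleton_eq_iff)
  qed
  have comp: "Z v \<in> irreducible_components (ftop X)" "Z' (Vtx v) \<in> irreducible_components (ftop X')"
    if "v \<in> verts G" for v
    using that dual dual' by (auto simp: dual_graph_def bij_betw_def subdiv_def)
  \<comment> \<open>Stated for an ordered pair, so that exchanging \<open>v\<close> and
    \<open>v'\<close> covers both ends of an edge.\<close>
  have chain_transport: "divisor_chain_transport (C' v) (C v) \<pi> (\<L>v v) (L v) (h v) (V v)
      (between G v v') (\<lambda>e. end_node G n nd' e v) nd (twist_support G n w v v')
      (twist_div G n w (end_node G n nd') v v') (twist_div G n w (\<lambda>e v. nd e) v v')"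
    if adj: "adjacent G v v'" for v v'
  proof -
    note v = adj_verts(1)[OF adj]
    have bundles: "line_bundle (C' v) (\<L>v v)" "V' v \<subseteq> gsect (C' v) (\<L>v v)" "sect.subspace (V' v)"
      "sect.dim (V' v) = r + 1" "line_bundle (C v) (L v)" "V v \<subseteq> gsect (C v) (L v)"
      "sect.subspace (V v)" "sect.dim (V v) = r + 1"
      using pre pre' v by (simp_all add: prelimit_series_def C_def)
    have top': "topspace (ftop (C' v)) = Z' (Vtx v)"
      using irreducible_components_subset[OF comp(2)[OF v]] by (auto simp: C'_def subsp_def)
    have finite: "finite (between G v v')"
      using fin_digraph.finite_arcs[OF fin] by (rule finite_subset[rotated]) (auto simp: between_def)
    have supp: "twist_support G n w v v' i \<subseteq> between G v v'" for i
      by (auto simp: twist_support_def)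
    have smooth: "smooth_point (C v) (nd e)" "smooth_point (C' v) (end_node G n nd' e v)"
      "\<pi> (end_node G n nd' e v) = nd e" if e: "e \<in> between G v v'" for e
    proof -
      note props = end_node_properties[OF ins chain between_arcs[OF e] v]
      have "nd e \<in> Z v" using dual between_arcs[OF e] v unfolding dual_graph_def by blast
      then show "smooth_point (C v) (nd e)"
        unfolding C_def by (intro smooth_point_component curve comp v)
      show "smooth_point (C' v) (end_node G n nd' e v)"
        unfolding C'_def by (intro smooth_point_component curve' comp v props)
      show "\<pi> (end_node G n nd' e v) = nd e" by (rule props)
    qed
    \<comment> \<open>The two pre-limit conditions give dimension \<open>r + 1\<close> on both
      curves.\<close>
    have trans: "section_transport (C' v) (C v) \<pi> (\<L>v v) (L v) (h v) (V v)"
    proof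
      show "fspace_iso (C' v) (C v) \<pi>" using ins v by (simp add: chain_insertion_def C_def C'_def)
      show "bundle_iso (C' v) (\<L>v v) (lb_pullback \<pi> (topspace (ftop (C' v))) (L v)) (h v)"
        using iso_h v top' by (simp add: \<L>v_def)
    qed (use bundles in \<open>simp_all add: V'_def\<close>)
    have chain_Y: "divisor_chain (C' v) (between G v v') (\<lambda>e. end_node G n nd' e v) (twist_support G n w v v')
        (V' v) (twist_div G n w (end_node G n nd') v v')"
    proof (rule divisor_chain.intro)
      show "inj_on (\<lambda>e. end_node G n nd' e v) (between G v v')"
        using inj_on_end_node[OF ins chain] by (rule inj_on_subset) (auto simp: between_def)
      show "s (end_node G n nd' e v) \<in> germs (C' v) (end_node G n nd' e v)"
        if s: "s \<in> V' v" and e: "e \<in> between G v v'" for s e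
      proof -
        have "end_node G n nd' e v \<in> topspace (ftop (C' v))"
          by (rule pointed_fspace.pt[OF smooth_point.axioms(1)[OF smooth(2)[OF e]]])
        then show ?thesis using bundles(2) s by (intro gsect_germs[OF bundles(1)]) auto
      qed
    qed (use bundles smooth supp finite in \<open>simp_all add: twist_div_def\<close>)
    have chain_X: "divisor_chain (C v) (between G v v') nd (twist_support G n w v v')
        (V v) (twist_div G n w (\<lambda>e v. nd e) v v')"
    proof (rule divisor_chain.intro)
      have "inj_on nd (arcs G)" using dual by (simp add: dual_graph_def bij_betw_def)
      then show "inj_on nd (between G v v')" by (rule inj_on_subset) (auto simp: between_def)
      show "s (nd e) \<in> germs (C v) (nd e)"
        if s: "s \<in> V v" and e: "e \<in> between G v v'" for s e
      proof -
        have "nd e \<in> topspace (ftop (C v))"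
          by (rule pointed_fspace.pt[OF smooth_point.axioms(1)[OF smooth(1)[OF e]]])
        then show ?thesis using bundles(6) s by (intro gsect_germs[OF bundles(5)]) auto
      qed
    qed (use bundles smooth supp finite in \<open>simp_all add: twist_div_def\<close>)
    show ?thesis
      unfolding divisor_chain_transport_def divisor_chain_transport_axioms_def
      using trans chain_Y chain_X smooth(3) by (auto simp: V'_def)
  qed
  \<comment> \<open>\<open>\<Lambda>\<close> is a variable with a defining equation, so that it can
    be matched with the set counted by \<open>g\<close> in \<open>weak_glueing\<close>.\<close>
  have "\<exists>W W'. vec.subspace W \<and>
      W \<subseteq> eval_map (C v) nd (twist_div G n w (\<lambda>e v. nd e) v v' j) (twist_support G n w v v' j) `
        van (C v) (V v) (twist_div G n w (\<lambda>e v. nd e) v v' j) \<and>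
      vec.subspace W' \<and>
      W' \<subseteq> eval_map (C v') nd (twist_div G n w (\<lambda>e v. nd e) v' v (b v v' - j))
          (twist_support G n w v' v (b v v' - j)) `
        van (C v') (V v') (twist_div G n w (\<lambda>e v. nd e) v' v (b v v' - j)) \<and>
      vec.dim W = card \<Lambda> \<and> vec.dim W' = card \<Lambda> \<and>
      (\<forall>I\<subseteq>twist_support G n w v v' j.
         krull_dim (subtopology (zariski (twist_support G n w v v' j)) (torus_orbit I \<inter> W)) =
         krull_dim (subtopology (zariski (twist_support G n w v' v (b v v' - j))) (torus_orbit I \<inter> W')))"
    if adj: "adjacent G v v'" and j: "j \<le> b v v'" and crit: "crit (twist_div G n w (\<lambda>e v. nd e) v v') j"
      and \<Lambda>: "\<Lambda> = {l. l \<le> r \<and>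
        mv G n w b C (\<lambda>e v. nd e) V v v' ! l = size (twist_div G n w (\<lambda>e v. nd e) v v' j) \<and>
        mv G n w b C (\<lambda>e v. nd e) V v' v ! (r - l) = size (twist_div G n w (\<lambda>e v. nd e) v' v (b v v' - j))}"
    for v v' j \<Lambda>
  proof -
    have adj': "adjacent G v' v" using adj by (simp add: adjacent_def between_commute[of G v'])
    interpret A: divisor_chain_transport "C' v" "C v" \<pi> "\<L>v v" "L v" "h v" "V v" "between G v v'"
      "\<lambda>e. end_node G n nd' e v" nd "twist_support G n w v v'"
      "twist_div G n w (end_node G n nd') v v'" "twist_div G n w (\<lambda>e v. nd e) v v'"
      by (rule chain_transport[OF adj])
    interpret B: divisor_chain_transport "C' v'" "C v'" \<pi> "\<L>v v'" "L v'" "h v'" "V v'" "between G v' v"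
      "\<lambda>e. end_node G n nd' e v'" nd "twist_support G n w v' v"
      "twist_div G n w (end_node G n nd') v' v" "twist_div G n w (\<lambda>e v. nd e) v' v"
      by (rule chain_transport[OF adj'])
    let ?D = "twist_div G n w (end_node G n nd') v v'" and ?D' = "twist_div G n w (end_node G n nd') v' v"
    let ?a = "mv G n w b C' (end_node G n nd') V'"
    let ?S = "twist_support G n w v v' j" and ?j' = "b v v' - j"
    let ?ev = "eval_map (C' v) (\<lambda>e. end_node G n nd' e v) (?D j) ?S"
    let ?ev' = "eval_map (C' v') (\<lambda>e. end_node G n nd' e v') (?D' ?j') (twist_support G n w v' v ?j')"
    have S: "twist_support G n w v' v ?j' = ?S"
      by (rule twist_support_reverse[OF loopfree tight adj j])
    have mv_eq: "mv G n w b C (\<lambda>e v. nd e) V v v' = ?a v v'" "mv G n w b C (\<lambda>e v. nd e) V v' v = ?a v' v"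
      using A.mvseq_eq B.mvseq_eq by (simp_all add: mv_def V'_def)
    \<comment> \<open>Degrees and sequences agree on the two curves, so the counted indices are
      those to which the glueing of the limit series applies.\<close>
    have \<Lambda>': "\<Lambda> = {l. l \<le> r \<and> ?a v v' ! l = size (?D j) \<and> ?a v' v ! (r - l) = size (?D' ?j')}"
      by (simp add: \<Lambda> mv_eq A.X.size_D A.Y.size_D B.X.size_D B.Y.size_D)
    have crit': "crit ?D j" using crit by (simp add: A.X.crit_iff A.Y.crit_iff)
    obtain s s' where s: "is_basis r (V' v) s" "is_basis r (V' v') s'"
      "\<forall>l\<le>r. ord_along (C' v) (V' v) ?D (b v v') (s l) = ?a v v' ! l"
      "\<forall>l\<le>r. ord_along (C' v') (V' v') ?D' (b v' v) (s' l) = ?a v' v ! l"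
      and glue: "\<forall>j\<le>b v v'. crit ?D j \<longrightarrow>
        (\<exists>\<phi>. glueing_iso G n w b X' Z' nd' (lb_of_mdeg G n N w0 \<L>) v v' j \<phi> \<and>
          (\<forall>l\<le>r. ?a v v' ! l = size (?D j) \<and> ?a v' v ! (r - l) = size (?D' (b v v' - j)) \<longrightarrow>
            \<phi> (eval_map (C' v) (\<lambda>e. end_node G n nd' e v) (?D j) (twist_support G n w v v' j) (s l)) =
            eval_map (C' v') (\<lambda>e. end_node G n nd' e v') (?D' (b v v' - j))
              (twist_support G n w v' v (b v v' - j)) (s' (r - l))))"
      using lim adj by blast
    obtain \<phi> where \<phi>: "glueing_iso G n w b X' Z' nd' (lb_of_mdeg G n N w0 \<L>) v v' j \<phi>"
      "\<forall>l\<in>\<Lambda>. \<phi> (?ev (s l)) = ?ev' (s' (r - l))"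
      using glue j crit' unfolding \<Lambda>' by blast
    obtain k where k: "\<forall>e. k e \<noteq> 0" "\<forall>x. (\<forall>e. e \<notin> ?S \<longrightarrow> x e = 0) \<longrightarrow> \<phi> x = rescale k x"
    proof (rule glueing_iso_diagonal[OF refl \<phi>(1)])
      show "x \<in> chart (lb_of_mdeg G n N w0 \<L> m) x" if "x \<in> topspace (ftop X')" for m x
        using chart_lb_of_mdeg[OF \<L> N that] .
      fix e assume "e \<in> ?S"
      then have e: "e \<in> between G v v'" "e \<in> between G v' v"
        by (auto simp: twist_support_def between_commute[of G v'])
      show "end_node G n nd' e v \<in> topspace (ftop X') \<inter> Z' (Vtx v) \<inter> inserted_chain n Z' nd' e"
        using end_node_properties[OF ins chain between_arcs[OF e(1)] adj_verts(1)[OF adj]] by blast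
      show "end_node G n nd' e v' \<in> topspace (ftop X') \<inter> Z' (Vtx v') \<inter> inserted_chain n Z' nd' e"
        using end_node_properties[OF ins chain between_arcs[OF e(2)] adj_verts(2)[OF adj]] by blast
    qed
    obtain c where c: "\<forall>e. c e \<noteq> 0" "\<forall>t\<in>van (C' v) (V' v) (?D j).
        eval_map (C v) nd (twist_div G n w (\<lambda>e v. nd e) v v' j) ?S (A.push t) = rescale c (?ev t)"
      unfolding V'_def by (rule A.eval_map_push[of j])
    obtain c' where c': "\<forall>e. c' e \<noteq> 0" "\<forall>t\<in>van (C' v') (V' v') (?D' ?j').
        eval_map (C v') nd (twist_div G n w (\<lambda>e v. nd e) v' v ?j') (twist_support G n w v' v ?j') (B.push t) =
        rescale c' (?ev' t)"
      unfolding V'_def by (rule B.eval_map_push[of ?j'])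
    define U where "U = vec.span ((\<lambda>l. ?ev (s l)) ` \<Lambda>)"
    \<comment> \<open>\<open>K\<close> combines the glueing isomorphism with the change of
      coordinates at \<open>v'\<close>.\<close>
    define K where "K e = c' e * k e" for e
    have K: "\<forall>e. K e \<noteq> 0" using c' k by (simp add: K_def)
    have basis_mem: "s l \<in> V' v" "s' l \<in> V' v'" if "l \<le> r" for l
      using s(1,2) that sect.span_base[of "s l" "s ` {..r}"] sect.span_base[of "s' l" "s' ` {..r}"]
      by (auto simp: is_basis_def)
    have s_van: "s l \<in> van (C' v) (V' v) (?D j)" if "l \<in> \<Lambda>" for l
      using A.Y.van_if_ord_along[folded V'_def, OF basis_mem(1)] s(3) that \<Lambda>' by auto
    have s'_van: "s' (r - l) \<in> van (C' v') (V' v') (?D' ?j')" if "l \<in> \<Lambda>" for l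
      using B.Y.van_if_ord_along[folded V'_def, OF basis_mem(2), of "r - l" "b v' v" ?j'] s(4) that \<Lambda>' by auto
    have len: "length (?a v v') = r + 1" and dim: "sect.dim (V' v) = r + 1"
      using pre' adj adj_verts(1)[OF adj] by (simp_all add: prelimit_series_def)
    have ind: "inj_on (\<lambda>l. ?ev (s l)) \<Lambda>" "vec.independent ((\<lambda>l. ?ev (s l)) ` \<Lambda>)"
      using A.Y.independent_eval_map[folded V'_def, OF s(1) dim _ _ j crit', of \<Lambda>] len s(3) \<Lambda>'
      by (auto simp: mv_def)
    have dim_U: "vec.dim U = card \<Lambda>"
      unfolding U_def vec.dim_span_eq_card_independent[OF ind(2)] using ind(1) by (rule card_image)
    have image: "vec.subspace (rescale m ` U)" "vec.dim (rescale m ` U) = card \<Lambda>"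
      if "\<forall>e. m e \<noteq> 0" for m
      using vec_pair.linear_subspace_image[OF linear_rescale, of U]
        vec_pair.dim_image_inj[OF linear_rescale, of U] inj_rescale[OF that] dim_U
      by (simp_all add: U_def inj_on_subset)
    have span_image: "rescale m ` U = vec.span ((\<lambda>l. rescale m (?ev (s l))) ` \<Lambda>)" for m
      unfolding U_def vec_pair.linear_span_image[OF linear_rescale, symmetric] by (simp add: image_image)
    have sub: "rescale c ` U \<subseteq> eval_map (C v) nd (twist_div G n w (\<lambda>e v. nd e) v v' j) ?S `
        van (C v) (V v) (twist_div G n w (\<lambda>e v. nd e) v v' j)"
      unfolding span_image
    proof (intro vec.span_minimal A.X.subspace_eval_image image_subsetI)
      fix l assume l: "l \<in> \<Lambda>"
      have "A.push (s l) \<in> van (C v) (V v) (twist_div G n w (\<lambda>e v. nd e) v v' j)"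
        using A.image_van[of j] imageI[OF s_van[OF l], of A.push] unfolding V'_def by simp
      then show "rescale c (?ev (s l)) \<in> eval_map (C v) nd (twist_div G n w (\<lambda>e v. nd e) v v' j) ?S `
          van (C v) (V v) (twist_div G n w (\<lambda>e v. nd e) v v' j)"
        unfolding bspec[OF c(2) s_van[OF l], symmetric] by (rule imageI)
    qed
    have sub': "rescale K ` U \<subseteq> eval_map (C v') nd (twist_div G n w (\<lambda>e v. nd e) v' v ?j')
        (twist_support G n w v' v ?j') ` van (C v') (V v') (twist_div G n w (\<lambda>e v. nd e) v' v ?j')"
      unfolding span_image
    proof (intro vec.span_minimal B.X.subspace_eval_image image_subsetI)
      fix l assume l: "l \<in> \<Lambda>"
      have "B.push (s' (r - l)) \<in> van (C v') (V v') (twist_div G n w (\<lambda>e v. nd e) v' v ?j')"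
        using B.image_van[of ?j'] imageI[OF s'_van[OF l], of B.push] unfolding V'_def by simp
      \<comment> \<open>The generators of the second subspace are evaluations of the pushed partners
        \<open>s' (r - l)\<close>.\<close>
      moreover have eq: "rescale K (?ev (s l)) = rescale c' (?ev' (s' (r - l)))"
      proof -
        \<comment> \<open>Evaluations vanish outside \<open>?S\<close>, so the diagonal form of
          \<open>\<phi>\<close> applies to them.\<close>
        have "?ev' (s' (r - l)) = rescale k (?ev (s l))"
          using k(2)[rule_format, of "?ev (s l)"] \<phi>(2) l by (simp add: eval_map_def)
        then show ?thesis by (simp add: rescale_def K_def mult.assoc)
      qed
      ultimately show "rescale K (?ev (s l)) \<in> eval_map (C v') nd (twist_div G n w (\<lambda>e v. nd e) v' v ?j')
          (twist_support G n w v' v ?j') ` van (C v') (V v') (twist_div G n w (\<lambda>e v. nd e) v' v ?j')"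
        unfolding eq bspec[OF c'(2) s'_van[OF l], symmetric] by (intro imageI)
    qed
    \<comment> \<open>Both sides equal the dimension of the intersection of the orbit with
      \<open>U\<close>.\<close>
    have krull: "\<forall>I\<subseteq>?S. krull_dim (subtopology (zariski ?S) (torus_orbit I \<inter> rescale c ` U)) =
        krull_dim (subtopology (zariski (twist_support G n w v' v ?j')) (torus_orbit I \<inter> rescale K ` U))"
      unfolding S by (simp add: krull_dim_torus_orbit_rescale c(1) K)
    show ?thesis
      by (intro exI[of _ "rescale c ` U"] exI[of _ "rescale K ` U"] conjI
        image[OF c(1)] image[OF K] sub sub' krull)
  qed
  note main = this[unfolded C_def[abs_def]]
  show ?thesis
    unfolding weak_glueing_def Let_def
    by (intro allI impI, elim conjE) (rule main, assumption+, rule refl)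
qed

end
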